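(* Let $p$ be a prime, let $n\ge 1$, let $F_q$ be the finite field with $q=p^n$ elements, and let $QD_{16}=\langle a,x \mid a^{8}=x^2=1,\ xax=a^{3}\rangle$ be the quasidihedral group of order $16$. Let $U(F_q[QD_{16}])$ be the unit group of the group algebra $F_q[QD_{16}]$, and let $V=1+J(F_q[QD_{16}])$, where $J(F_q[QD_{16}])$ is the Jacobson radical of $F_q[QD_{16}]$. 1. If $p=2$, i.e. $|F_q|=2^n$, then: (a) $U(F_q[QD_{16}])/V\cong C_{q-1}$; (b) $V$ is a $2$-group of order $2^{15n}$ and exponent $8$; (c) the nilpotency class of $V$ is $4$; (d) $V$ is centrally metabelian. 2. If $p>2$, then: (a) if $q\equiv 1$ or $3 \pmod 8$, then $U(F_q[QD_{16}])\cong C_{q-1}^{4}\times GL(2,F_q)^{3}$; (b) if $q\equiv -1$ or $-3 \pmod 8$, then $U(F_q[QD_{16}])\cong C_{q-1}^{4}\times GL(2,F_q)\times GL(2,F_{q^2})$.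
   Context: $C_m$ denotes the cyclic group of order $m$, $GL(2,K)$ the general linear group of degree $2$ over the field $K$, and for a group $H$, $H^{k}$ (also written $C_m^{k}$ for $H=C_m$) denotes the direct product of $k$ copies of $H$. The set $V=1+J(F_q[QD_{16}])$ is a normal subgroup of $U(F_q[QD_{16}])$. For a group $H$, put $\gamma_1(H)=H$ and $\gamma_{c+1}(H)=(\gamma_c(H),H)$, the subgroup generated by all commutators $(g,h)=g^{-1}h^{-1}gh$ with $g\in\gamma_c(H)$, $h\in H$; $H$ is nilpotent of class $c$ if $\gamma_{c+1}(H)=1$ but $\gamma_c(H)\neq 1$. A group $H$ is centrally metabelian if its second derived subgroup $H''$ is contained in the center of $H$. *)

theory Defs
  imports "HOL-Algebra.Algebra" "HOL-Number_Theory.Cong"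
begin

section \<open>Groups given by generators and relations\<close>

text \<open>
  A word over the generator type is a list of letters; the letter \<open>(s, True)\<close> stands
  for the generator \<open>s\<close> and \<open>(s, False)\<close> for its formal inverse. Every element of the type
  \<open>'s\<close> is a generator. A pair \<open>(u, v)\<close> in the relation set is read as the relation \<open>u = v\<close>.
\<close>

type_synonym 's word = "('s \<times> bool) list"

inductive word_eq :: "('s word \<times> 's word) set \<Rightarrow> 's word \<Rightarrow> 's word \<Rightarrow> bool"
  for R :: "('s word \<times> 's word) set"
where
  refl: "word_eq R u u"
| sym: "word_eq R u v \<Longrightarrow> word_eq R v u"
| trans: "word_eq R u v \<Longrightarrow> word_eq R v w \<Longrightarrow> word_eq R u w"
| append: "word_eq R u u' \<Longrightarrow> word_eq R v v' \<Longrightarrow> word_eq R (u @ v) (u' @ v')"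
| cancel: "word_eq R [(s, b), (s, \<not> b)] []"
| relation: "(u, v) \<in> R \<Longrightarrow> word_eq R u v"

definition word_class :: "('s word \<times> 's word) set \<Rightarrow> 's word \<Rightarrow> 's word set"
  where "word_class R u = {v. word_eq R u v}"

definition presented_group :: "('s word \<times> 's word) set \<Rightarrow> 's word set monoid"
  where "presented_group R =
    \<lparr>carrier = range (word_class R),
     monoid.mult = (\<lambda>A B. \<Union>u\<in>A. \<Union>v\<in>B. word_class R (u @ v)),
     one = word_class R []\<rparr>"

lemma word_class_eq_iff: "word_class R u = word_class R v \<longleftrightarrow> word_eq R u v"
proof
  assume "word_class R u = word_class R v"
  moreover have "v \<in> word_class R v" by (simp add: word_class_def word_eq.refl)
  ultimately have "v \<in> word_class R u" by (simp only:)
  then show "word_eq R u v" by (simp add: word_class_def)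
next
  assume "word_eq R u v"
  then show "word_class R u = word_class R v"
    unfolding word_class_def by (blast intro: word_eq.sym word_eq.trans)
qed

lemma presented_group_mult:
  "word_class R u \<otimes>\<^bsub>presented_group R\<^esub> word_class R v = word_class R (u @ v)"
proof -
  have *: "word_class R (u' @ v') = word_class R (u @ v)"
    if "u' \<in> word_class R u" "v' \<in> word_class R v" for u' v'
  proof -
    have "word_eq R (u @ v) (u' @ v')"
      using that unfolding word_class_def by (blast intro: word_eq.append)
    then show ?thesis by (simp only: flip: word_class_eq_iff)
  qed
  have "u \<in> word_class R u" "v \<in> word_class R v"
    by (simp_all add: word_class_def word_eq.refl)
  then have "(\<Union>u'\<in>word_class R u. \<Union>v'\<in>word_class R v. word_class R (u' @ v')) =
      word_class R (u @ v)"
    using * by blast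
  then show ?thesis
    by (simp add: presented_group_def)
qed

lemma word_eq_inverse:
  "word_eq R (rev (map (\<lambda>(s, b). (s, \<not> b)) u) @ u) []"
proof (induction u)
  case Nil
  then show ?case by (simp add: word_eq.refl)
next
  case (Cons l u)
  obtain s b where l: "l = (s, b)" by (cases l)
  let ?u' = "rev (map (\<lambda>(s, b). (s, \<not> b)) u)"
  have "word_eq R [(s, \<not> b), (s, b)] []"
    using word_eq.cancel[of R s "\<not> b"] by simp
  then have "word_eq R (?u' @ ([(s, \<not> b), (s, b)] @ u)) (?u' @ ([] @ u))"
    by (intro word_eq.append word_eq.refl)
  with Cons.IH show ?case
    using word_eq.trans by (fastforce simp: l)
qed

lemma group_presented_group: "group (presented_group R)"
proof (rule groupI)
  have carr: "carrier (presented_group R) = range (word_class R)"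
    and one: "\<one>\<^bsub>presented_group R\<^esub> = word_class R []"
    by (simp_all add: presented_group_def)
  show "\<one>\<^bsub>presented_group R\<^esub> \<in> carrier (presented_group R)"
    by (simp add: carr one)
  fix A B C
  assume A: "A \<in> carrier (presented_group R)"
  then obtain u where u: "A = word_class R u" by (auto simp: carr)
  show "\<one>\<^bsub>presented_group R\<^esub> \<otimes>\<^bsub>presented_group R\<^esub> A = A"
    by (simp add: u one presented_group_mult)
  have "word_class R (rev (map (\<lambda>(s, b). (s, \<not> b)) u)) \<otimes>\<^bsub>presented_group R\<^esub> A
        = \<one>\<^bsub>presented_group R\<^esub>"
    by (simp add: u one presented_group_mult word_class_eq_iff word_eq_inverse)
  then show "\<exists>B\<in>carrier (presented_group R).
      B \<otimes>\<^bsub>presented_group R\<^esub> A = \<one>\<^bsub>presented_group R\<^esub>"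
    unfolding carr by blast
  assume B: "B \<in> carrier (presented_group R)"
  then obtain v where v: "B = word_class R v" by (auto simp: carr)
  show "A \<otimes>\<^bsub>presented_group R\<^esub> B \<in> carrier (presented_group R)"
    by (simp add: u v presented_group_mult carr)
  assume "C \<in> carrier (presented_group R)"
  then obtain w where w: "C = word_class R w" by (auto simp: carr)
  show "A \<otimes>\<^bsub>presented_group R\<^esub> B \<otimes>\<^bsub>presented_group R\<^esub> C
      = A \<otimes>\<^bsub>presented_group R\<^esub> (B \<otimes>\<^bsub>presented_group R\<^esub> C)"
    by (simp add: u v w presented_group_mult)
qed

datatype qd_gen = Gen_a | Gen_x

definition QD16 :: "qd_gen word set monoid"
  where "QD16 =
    (let a = [(Gen_a, True)]; x = [(Gen_x, True)]
     in presented_group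
          {(a @ a @ a @ a @ a @ a @ a @ a, []),
           (x @ x, []),
           (x @ a @ x, a @ a @ a)})"


section \<open>Group algebras and the Jacobson radical\<close>

text \<open>
  Elements of \<open>R[G]\<close> are the finitely supported functions from \<open>G\<close> to \<open>R\<close>, and
  \<open>(f h)(z) = \<Sum>\<^sub>y f(y) h(y\<inverse>z)\<close>; the sum is taken over the support of \<open>f\<close> because
  \<^const>\<open>finsum\<close> is meaningful only on finite index sets.
\<close>

definition group_algebra ::
    "('r, 'm) ring_scheme \<Rightarrow> ('g, 'n) monoid_scheme \<Rightarrow> ('g \<Rightarrow> 'r) ring"
  where "group_algebra R G =
    \<lparr>carrier = {f \<in> carrier G \<rightarrow>\<^sub>E carrier R. finite {y \<in> carrier G. f y \<noteq> \<zero>\<^bsub>R\<^esub>}},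
     monoid.mult = (\<lambda>f h. \<lambda>z\<in>carrier G.
       finsum R (\<lambda>y. f y \<otimes>\<^bsub>R\<^esub> h (inv\<^bsub>G\<^esub> y \<otimes>\<^bsub>G\<^esub> z)) {y \<in> carrier G. f y \<noteq> \<zero>\<^bsub>R\<^esub>}),
     one = (\<lambda>z\<in>carrier G. if z = \<one>\<^bsub>G\<^esub> then \<one>\<^bsub>R\<^esub> else \<zero>\<^bsub>R\<^esub>),
     ring.zero = (\<lambda>z\<in>carrier G. \<zero>\<^bsub>R\<^esub>),
     ring.add = (\<lambda>f h. \<lambda>z\<in>carrier G. f z \<oplus>\<^bsub>R\<^esub> h z)\<rparr>"

text \<open>
  \<^const>\<open>ideal\<close> and \<^const>\<open>maximalideal\<close> are two-sided; the Jacobson radical of a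
  noncommutative ring needs maximal left ideals.
\<close>

definition left_ideal :: "'r set \<Rightarrow> ('r, 'm) ring_scheme \<Rightarrow> bool"
  where "left_ideal I R \<longleftrightarrow>
    additive_subgroup I R \<and> (\<forall>r\<in>carrier R. \<forall>y\<in>I. r \<otimes>\<^bsub>R\<^esub> y \<in> I)"

definition maximal_left_ideal :: "'r set \<Rightarrow> ('r, 'm) ring_scheme \<Rightarrow> bool"
  where "maximal_left_ideal I R \<longleftrightarrow>
    left_ideal I R \<and> I \<noteq> carrier R \<and>
    (\<forall>I'. left_ideal I' R \<and> I \<subseteq> I' \<longrightarrow> I' = I \<or> I' = carrier R)"

definition jacobson_radical :: "('r, 'm) ring_scheme \<Rightarrow> 'r set"
  where "jacobson_radical R = carrier R \<inter> \<Inter>{I. maximal_left_ideal I R}"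

definition one_plus_jacobson :: "('r, 'm) ring_scheme \<Rightarrow> 'r set"
  where "one_plus_jacobson R = {\<one>\<^bsub>R\<^esub> \<oplus>\<^bsub>R\<^esub> r | r. r \<in> jacobson_radical R}"


section \<open>The general linear group\<close>

definition mat_monoid :: "nat \<Rightarrow> ('r, 'm) ring_scheme \<Rightarrow> (nat \<times> nat \<Rightarrow> 'r) monoid"
  where "mat_monoid n R =
    \<lparr>carrier = {..<n} \<times> {..<n} \<rightarrow>\<^sub>E carrier R,
     monoid.mult = (\<lambda>A B. \<lambda>(i, j)\<in>{..<n} \<times> {..<n}.
       finsum R (\<lambda>k. A (i, k) \<otimes>\<^bsub>R\<^esub> B (k, j)) {..<n}),
     one = (\<lambda>(i, j)\<in>{..<n} \<times> {..<n}. if i = j then \<one>\<^bsub>R\<^esub> else \<zero>\<^bsub>R\<^esub>)\<rparr>"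

definition GL :: "nat \<Rightarrow> ('r, 'm) ring_scheme \<Rightarrow> (nat \<times> nat \<Rightarrow> 'r) monoid"
  where "GL n R = units_of (mat_monoid n R)"


section \<open>Group-theoretic notions\<close>

definition p_group :: "nat \<Rightarrow> ('g, 'm) monoid_scheme \<Rightarrow> bool"
  where "p_group p G \<longleftrightarrow> group G \<and> (\<forall>g\<in>carrier G. \<exists>k. group.ord G g = p ^ k)"

text \<open>The exponent is meaningful only for groups of bounded exponent, e.g. finite ones.\<close>

definition group_exponent :: "('g, 'm) monoid_scheme \<Rightarrow> nat"
  where "group_exponent G = (LEAST e. e > 0 \<and> (\<forall>g\<in>carrier G. g [^]\<^bsub>G\<^esub> e = \<one>\<^bsub>G\<^esub>))"

definition commutator :: "('g, 'm) monoid_scheme \<Rightarrow> 'g \<Rightarrow> 'g \<Rightarrow> 'g"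
  where "commutator G g h = inv\<^bsub>G\<^esub> g \<otimes>\<^bsub>G\<^esub> inv\<^bsub>G\<^esub> h \<otimes>\<^bsub>G\<^esub> g \<otimes>\<^bsub>G\<^esub> h"

text \<open>The lower central series starts at index 1; the value at 0 is a dummy.\<close>

fun lower_central :: "('g, 'm) monoid_scheme \<Rightarrow> nat \<Rightarrow> 'g set"
  where
    "lower_central G 0 = carrier G"
  | "lower_central G (Suc 0) = carrier G"
  | "lower_central G (Suc (Suc c)) =
       generate G {commutator G g h | g h. g \<in> lower_central G (Suc c) \<and> h \<in> carrier G}"

definition nilpotent_of_class :: "('g, 'm) monoid_scheme \<Rightarrow> nat \<Rightarrow> bool"
  where "nilpotent_of_class G c \<longleftrightarrow>
    lower_central G (c + 1) = {\<one>\<^bsub>G\<^esub>} \<and> lower_central G c \<noteq> {\<one>\<^bsub>G\<^esub>}"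

definition group_center :: "('g, 'm) monoid_scheme \<Rightarrow> 'g set"
  where "group_center G = {z \<in> carrier G. \<forall>g\<in>carrier G. z \<otimes>\<^bsub>G\<^esub> g = g \<otimes>\<^bsub>G\<^esub> z}"

definition centrally_metabelian :: "('g, 'm) monoid_scheme \<Rightarrow> bool"
  where "centrally_metabelian G \<longleftrightarrow> derived G (derived G (carrier G)) \<subseteq> group_center G"

end

theory Submission
  imports Defs "HOL-Decision_Procs.Algebra_Aux" "HOL-Number_Theory.Gauss"
    "HOL-Computational_Algebra.Polynomial"
begin

text \<open>
  Let \<open>R\<close> be the group algebra and \<open>\<epsilon>\<close> its augmentation.

  In characteristic two put \<open>t = 1 + a\<close>, so that \<open>t\<^sup>8 = 0 \<noteq> t\<^sup>7\<close>. The relation \<open>xax = a\<^sup>3\<close> becomes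
  \<open>xt = (t + t\<^sup>2 + t\<^sup>3)x\<close>; hence each \<open>I\<^sub>k = t\<^sup>kR\<close> is a two-sided ideal, \<open>R / I\<^sub>2\<close> is commutative, and
  commuting with an arbitrary element carries \<open>I\<^sub>2\<^sub>k\<close> into \<open>I\<^sub>2\<^sub>k\<^sub>+\<^sub>2\<close>. Everything follows from this
  filtration. Squaring is a ring homomorphism modulo \<open>I\<^sub>2\<close>, so \<open>u\<^sup>2 \<equiv> \<epsilon>(u)\<^sup>2\<close> and every element of
  augmentation zero has eighth power zero. Therefore \<open>R\<close> is local, its Jacobson radical is the kernel of
  \<open>\<epsilon>\<close>, and \<open>V\<close> is the kernel of \<open>\<epsilon>\<close> on the units; this gives the quotient, the order and the exponent,
  which is attained by \<open>a\<close>. The groups \<open>1 + I\<^sub>2\<^sub>c\<close> contain the terms \<open>\<gamma>\<^sub>c\<^sub>+\<^sub>1(V)\<close> of the lower central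
  series, so the class is at most 4, and \<open>V''\<close> lies in \<open>1 + I\<^sub>6\<close>, which is central. That the class is
  not smaller is witnessed by the commutator \<open>(((a, x), 1 + a + x), a)\<close>.

  In odd characteristic \<open>R\<close> is mapped into a product of matrix rings by the four linear characters,
  the two-dimensional representation of the dihedral quotient, and the faithful two-dimensional
  representations, in which \<open>a\<^sup>2 = sa + 1\<close> with \<open>s\<^sup>2 = -2\<close>. Injectivity is column orthogonality of
  characters made explicit. If all these maps vanish on \<open>\<delta>\<close>, they vanish on the translates of \<open>\<delta>\<close>, and
  taking traces gives, at every group element \<open>g\<close>,
  \<open>\<delta>(g) + \<delta>(ga\<^sup>4) = -(\<delta>(ga\<^sup>2) + \<delta>(ga\<^sup>6))\<close> from the linear characters,
  \<open>\<delta>(g) + \<delta>(ga\<^sup>4) = \<delta>(ga\<^sup>2) + \<delta>(ga\<^sup>6)\<close> from the dihedral representation, and \<open>\<delta>(g) = \<delta>(ga\<^sup>4)\<close> from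
  the faithful ones; since 2 is invertible, \<open>\<delta>(g) = 0\<close>. Source and target both have \<open>q\<^sup>1\<^sup>6\<close> elements,
  so the map is bijective and identifies the unit groups. If \<open>-2\<close> is a square in \<open>F\<close>, the two values of
  \<open>s\<close> give two representations over \<open>F\<close>. Otherwise a single one over the quadratic extension \<open>L\<close> is
  enough, because 1 and \<open>s\<close> are linearly independent over \<open>F\<close>. Eighth roots of unity and Gauss's lemma
  show that \<open>-2\<close> is a square exactly when \<open>q \<equiv> 1\<close> or \<open>3\<close> modulo 8. As \<open>L\<close> is an arbitrary field with
  \<open>q\<^sup>2\<close> elements, an embedding of \<open>F\<close> into it has to be constructed as well.
\<close>

hide_const (open) Polynomial.order

section \<open>Group algebras of finite groups\<close>

lemma (in abelian_monoid) finsum_swap: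
  assumes "finite A" "finite B" "\<And>x y. x \<in> A \<Longrightarrow> y \<in> B \<Longrightarrow> f x y \<in> carrier G"
  shows "(\<Oplus>x\<in>A. \<Oplus>y\<in>B. f x y) = (\<Oplus>y\<in>B. \<Oplus>x\<in>A. f x y)"
  using assms(1,3)
proof (induction A rule: finite_induct)
  case empty
  then show ?case by simp
next
  case (insert a A)
  then have "(\<Oplus>x\<in>insert a A. \<Oplus>y\<in>B. f x y) = (\<Oplus>y\<in>B. f a y) \<oplus> (\<Oplus>y\<in>B. \<Oplus>x\<in>A. f x y)"
    by (subst finsum_insert) (auto intro!: finsum_closed)
  also have "\<dots> = (\<Oplus>y\<in>B. f a y \<oplus> (\<Oplus>x\<in>A. f x y))"
    using insert by (subst finsum_addf) (auto intro!: finsum_closed)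
  also have "\<dots> = (\<Oplus>y\<in>B. \<Oplus>x\<in>insert a A. f x y)"
    using insert by (intro finsum_cong') (auto intro!: finsum_closed finsum_insert[symmetric])
  finally show ?case .
qed

lemma (in abelian_monoid) finsum_left_translate:
  assumes "group H" "y \<in> carrier H" "\<And>z. z \<in> carrier H \<Longrightarrow> f z \<in> carrier G"
  shows "(\<Oplus>z\<in>carrier H. f z) = (\<Oplus>w\<in>carrier H. f (y \<otimes>\<^bsub>H\<^esub> w))"
proof -
  interpret H: group H by fact
  have im: "(\<lambda>w. y \<otimes>\<^bsub>H\<^esub> w) ` carrier H = carrier H"
    using H.surj_const_mult assms(2) by blast
  have "inj_on (\<lambda>w. y \<otimes>\<^bsub>H\<^esub> w) (carrier H)"
    using H.inj_on_multc assms(2) by (simp add: inj_on_def)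
  then have "(\<Oplus>z\<in>(\<lambda>w. y \<otimes>\<^bsub>H\<^esub> w) ` carrier H. f z) = (\<Oplus>w\<in>carrier H. f (y \<otimes>\<^bsub>H\<^esub> w))"
    by (intro finsum_reindex) (use assms im in auto)
  then show ?thesis by (simp add: im)
qed

locale finite_group_algebra = R: ring R + G: group G for R (structure) and G (structure) +
  assumes finite_group: "finite (carrier G)"
begin

abbreviation KG where "KG \<equiv> group_algebra R G"

lemma carrier_KG: "carrier KG = carrier G \<rightarrow>\<^sub>E carrier R"
  using finite_group by (auto simp: group_algebra_def)

lemma KG_app [simp, intro]: "f \<in> carrier KG \<Longrightarrow> y \<in> carrier G \<Longrightarrow> f y \<in> carrier R"
  by (auto simp: carrier_KG)

lemma KG_eqI:
  assumes "f \<in> carrier KG" "h \<in> carrier KG" "\<And>z. z \<in> carrier G \<Longrightarrow> f z = h z"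
  shows "f = h"
  using assms by (auto simp: carrier_KG intro: PiE_ext)

text \<open>
  For a finite group the sum in the convolution product may run over the whole group instead of the
  support of the first factor; only then do the usual rearrangements of sums apply.
\<close>

lemma mult_KG:
  assumes "f \<in> carrier KG" "h \<in> carrier KG"
  shows "f \<otimes>\<^bsub>KG\<^esub> h = (\<lambda>z\<in>carrier G. \<Oplus>y\<in>carrier G. f y \<otimes> h (inv\<^bsub>G\<^esub> y \<otimes>\<^bsub>G\<^esub> z))"
proof -
  have "finsum R (\<lambda>y. f y \<otimes> h (inv\<^bsub>G\<^esub> y \<otimes>\<^bsub>G\<^esub> z)) {y \<in> carrier G. f y \<noteq> \<zero>}
      = (\<Oplus>y\<in>carrier G. f y \<otimes> h (inv\<^bsub>G\<^esub> y \<otimes>\<^bsub>G\<^esub> z))" if "z \<in> carrier G" for z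
    using finite_group assms that
    by (intro R.add.finprod_mono_neutral_cong_left) auto
  then show ?thesis
    by (simp add: group_algebra_def restrict_def fun_eq_iff)
qed

lemma mult_KG_app:
  assumes "f \<in> carrier KG" "h \<in> carrier KG" "z \<in> carrier G"
  shows "(f \<otimes>\<^bsub>KG\<^esub> h) z = (\<Oplus>y\<in>carrier G. f y \<otimes> h (inv\<^bsub>G\<^esub> y \<otimes>\<^bsub>G\<^esub> z))"
  using assms by (simp add: mult_KG)

lemma add_KG_app: "z \<in> carrier G \<Longrightarrow> (f \<oplus>\<^bsub>KG\<^esub> h) z = f z \<oplus> h z"
  by (simp add: group_algebra_def)

lemma zero_KG_app: "z \<in> carrier G \<Longrightarrow> \<zero>\<^bsub>KG\<^esub> z = \<zero>"
  by (simp add: group_algebra_def)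

lemma one_KG_app: "z \<in> carrier G \<Longrightarrow> \<one>\<^bsub>KG\<^esub> z = (if z = \<one>\<^bsub>G\<^esub> then \<one> else \<zero>)"
  by (simp add: group_algebra_def)

lemma mult_KG_closed [simp, intro]:
  "f \<in> carrier KG \<Longrightarrow> h \<in> carrier KG \<Longrightarrow> f \<otimes>\<^bsub>KG\<^esub> h \<in> carrier KG"
  by (simp add: mult_KG) (auto simp: carrier_KG intro!: R.finsum_closed)

lemma add_KG_closed: "f \<in> carrier KG \<Longrightarrow> h \<in> carrier KG \<Longrightarrow> f \<oplus>\<^bsub>KG\<^esub> h \<in> carrier KG"
  unfolding carrier_KG by (auto simp: group_algebra_def)

lemma zero_KG_closed: "\<zero>\<^bsub>KG\<^esub> \<in> carrier KG"
  by (auto simp: carrier_KG) (auto simp: group_algebra_def)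

lemma one_KG_closed: "\<one>\<^bsub>KG\<^esub> \<in> carrier KG"
  by (auto simp: carrier_KG) (auto simp: group_algebra_def)

text \<open>
  After exchanging the two sums, the inner one is reindexed by left translation,
  \<open>y = wv\<close>, which turns it into the convolution of the last two factors.
\<close>

lemma mult_KG_assoc:
  assumes f: "f \<in> carrier KG" and h: "h \<in> carrier KG" and k: "k \<in> carrier KG"
  shows "f \<otimes>\<^bsub>KG\<^esub> h \<otimes>\<^bsub>KG\<^esub> k = f \<otimes>\<^bsub>KG\<^esub> (h \<otimes>\<^bsub>KG\<^esub> k)"
proof (rule KG_eqI)
  fix z assume z: "z \<in> carrier G"
  let ?G = "carrier G"
  have "(f \<otimes>\<^bsub>KG\<^esub> h \<otimes>\<^bsub>KG\<^esub> k) z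
      = (\<Oplus>y\<in>?G. (\<Oplus>w\<in>?G. f w \<otimes> h (inv\<^bsub>G\<^esub> w \<otimes>\<^bsub>G\<^esub> y)) \<otimes> k (inv\<^bsub>G\<^esub> y \<otimes>\<^bsub>G\<^esub> z))"
    using z f h k by (simp add: mult_KG_app cong: R.finsum_cong')
                     (auto intro!: R.finsum_cong' R.finsum_closed simp: mult_KG_app)
  also have "\<dots> = (\<Oplus>y\<in>?G. \<Oplus>w\<in>?G. f w \<otimes> h (inv\<^bsub>G\<^esub> w \<otimes>\<^bsub>G\<^esub> y) \<otimes> k (inv\<^bsub>G\<^esub> y \<otimes>\<^bsub>G\<^esub> z))"
    using z f h k finite_group
    by (intro R.finsum_cong') (auto intro!: R.finsum_closed R.finsum_ldistr)
  also have "\<dots> = (\<Oplus>w\<in>?G. \<Oplus>y\<in>?G. f w \<otimes> h (inv\<^bsub>G\<^esub> w \<otimes>\<^bsub>G\<^esub> y) \<otimes> k (inv\<^bsub>G\<^esub> y \<otimes>\<^bsub>G\<^esub> z))"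
    using z f h k finite_group by (intro R.finsum_swap) auto
  also have "\<dots> = (\<Oplus>w\<in>?G. f w \<otimes> (\<Oplus>v\<in>?G. h v \<otimes> k (inv\<^bsub>G\<^esub> v \<otimes>\<^bsub>G\<^esub> (inv\<^bsub>G\<^esub> w \<otimes>\<^bsub>G\<^esub> z))))"
  proof (intro R.finsum_cong')
    fix w assume w: "w \<in> ?G"
    have "(\<Oplus>y\<in>?G. f w \<otimes> h (inv\<^bsub>G\<^esub> w \<otimes>\<^bsub>G\<^esub> y) \<otimes> k (inv\<^bsub>G\<^esub> y \<otimes>\<^bsub>G\<^esub> z))
        = (\<Oplus>v\<in>?G. f w \<otimes> h (inv\<^bsub>G\<^esub> w \<otimes>\<^bsub>G\<^esub> (w \<otimes>\<^bsub>G\<^esub> v)) \<otimes> k (inv\<^bsub>G\<^esub> (w \<otimes>\<^bsub>G\<^esub> v) \<otimes>\<^bsub>G\<^esub> z))"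
      using w z f h k by (intro R.finsum_left_translate) auto
    also have "\<dots> = (\<Oplus>v\<in>?G. f w \<otimes> (h v \<otimes> k (inv\<^bsub>G\<^esub> v \<otimes>\<^bsub>G\<^esub> (inv\<^bsub>G\<^esub> w \<otimes>\<^bsub>G\<^esub> z))))"
      using w z f h k
      by (intro R.finsum_cong')
         (auto simp: G.inv_mult_group G.m_assoc R.m_assoc simp flip: G.m_assoc[of _ w])
    also have "\<dots> = f w \<otimes> (\<Oplus>v\<in>?G. h v \<otimes> k (inv\<^bsub>G\<^esub> v \<otimes>\<^bsub>G\<^esub> (inv\<^bsub>G\<^esub> w \<otimes>\<^bsub>G\<^esub> z)))"
      using w z f h k finite_group by (intro R.finsum_rdistr[symmetric]) auto
    finally show "(\<Oplus>y\<in>?G. f w \<otimes> h (inv\<^bsub>G\<^esub> w \<otimes>\<^bsub>G\<^esub> y) \<otimes> k (inv\<^bsub>G\<^esub> y \<otimes>\<^bsub>G\<^esub> z))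
        = f w \<otimes> (\<Oplus>v\<in>?G. h v \<otimes> k (inv\<^bsub>G\<^esub> v \<otimes>\<^bsub>G\<^esub> (inv\<^bsub>G\<^esub> w \<otimes>\<^bsub>G\<^esub> z)))" .
  qed (use z f h k in \<open>auto intro!: R.finsum_closed\<close>)
  also have "\<dots> = (f \<otimes>\<^bsub>KG\<^esub> (h \<otimes>\<^bsub>KG\<^esub> k)) z"
    using z f h k
    by (simp add: mult_KG_app) (auto intro!: R.finsum_cong' R.finsum_closed simp: mult_KG_app)
  finally show "(f \<otimes>\<^bsub>KG\<^esub> h \<otimes>\<^bsub>KG\<^esub> k) z = (f \<otimes>\<^bsub>KG\<^esub> (h \<otimes>\<^bsub>KG\<^esub> k)) z" .
qed (use assms in auto)

definition basis :: "'c \<Rightarrow> 'c \<Rightarrow> 'a"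
  where "basis g = (\<lambda>z\<in>carrier G. if z = g then \<one> else \<zero>)"

definition scalar :: "'a \<Rightarrow> 'c \<Rightarrow> 'a"
  where "scalar c = (\<lambda>z\<in>carrier G. if z = \<one>\<^bsub>G\<^esub> then c else \<zero>)"

lemma basis_closed [simp, intro]: "basis g \<in> carrier KG"
  by (auto simp: basis_def carrier_KG)

lemma scalar_closed [simp, intro]: "c \<in> carrier R \<Longrightarrow> scalar c \<in> carrier KG"
  by (auto simp: scalar_def carrier_KG)

lemma finsum_delta:
  assumes "a \<in> A" "finite A" "f a \<in> carrier R"
  shows "(\<Oplus>y\<in>A. if y = a then f y else \<zero>) = f a"
proof -
  have "(\<Oplus>y\<in>A. if y = a then f y else \<zero>) = (\<Oplus>y\<in>A. if a = y then f a else \<zero>)"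
    using assms by (intro R.finsum_cong') auto
  also have "\<dots> = f a"
    using assms R.finsum_singleton[of a A "\<lambda>_. f a"] by simp
  finally show ?thesis .
qed

lemma scalar_mult_app:
  assumes "c \<in> carrier R" "h \<in> carrier KG" "z \<in> carrier G"
  shows "(scalar c \<otimes>\<^bsub>KG\<^esub> h) z = c \<otimes> h z"
proof -
  have "(scalar c \<otimes>\<^bsub>KG\<^esub> h) z
      = (\<Oplus>y\<in>carrier G. if y = \<one>\<^bsub>G\<^esub> then c \<otimes> h (inv\<^bsub>G\<^esub> y \<otimes>\<^bsub>G\<^esub> z) else \<zero>)"
    using assms by (simp add: mult_KG_app) (auto intro!: R.finsum_cong' simp: scalar_def)
  also have "\<dots> = c \<otimes> h z"
    using assms finite_group by (subst finsum_delta) auto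
  finally show ?thesis .
qed

lemma basis_mult_app:
  assumes "g \<in> carrier G" "h \<in> carrier KG" "z \<in> carrier G"
  shows "(basis g \<otimes>\<^bsub>KG\<^esub> h) z = h (inv\<^bsub>G\<^esub> g \<otimes>\<^bsub>G\<^esub> z)"
proof -
  have "(basis g \<otimes>\<^bsub>KG\<^esub> h) z
      = (\<Oplus>y\<in>carrier G. if y = g then h (inv\<^bsub>G\<^esub> y \<otimes>\<^bsub>G\<^esub> z) else \<zero>)"
    using assms by (simp add: mult_KG_app) (auto intro!: R.finsum_cong' simp: basis_def)
  also have "\<dots> = h (inv\<^bsub>G\<^esub> g \<otimes>\<^bsub>G\<^esub> z)"
    using assms finite_group by (subst finsum_delta) auto
  finally show ?thesis .
qed

lemma basis_one: "basis \<one>\<^bsub>G\<^esub> = \<one>\<^bsub>KG\<^esub>"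
  by (rule KG_eqI) (simp_all add: one_KG_closed one_KG_app, simp add: basis_def)

lemma basis_mult:
  assumes "g \<in> carrier G" "h \<in> carrier G"
  shows "basis g \<otimes>\<^bsub>KG\<^esub> basis h = basis (g \<otimes>\<^bsub>G\<^esub> h)"
proof (rule KG_eqI)
  fix z assume z: "z \<in> carrier G"
  have "inv\<^bsub>G\<^esub> g \<otimes>\<^bsub>G\<^esub> z = h \<longleftrightarrow> z = g \<otimes>\<^bsub>G\<^esub> h"
    using assms z G.inv_solve_left' by auto
  then show "(basis g \<otimes>\<^bsub>KG\<^esub> basis h) z = basis (g \<otimes>\<^bsub>G\<^esub> h) z"
    using assms z by (simp add: basis_mult_app) (simp add: basis_def)
qed (use assms in auto)

lemma one_mult_KG: "f \<in> carrier KG \<Longrightarrow> \<one>\<^bsub>KG\<^esub> \<otimes>\<^bsub>KG\<^esub> f = f"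
  by (rule KG_eqI) (auto simp: one_KG_closed basis_mult_app simp flip: basis_one)

lemma mult_one_KG:
  assumes f: "f \<in> carrier KG" shows "f \<otimes>\<^bsub>KG\<^esub> \<one>\<^bsub>KG\<^esub> = f"
proof (rule KG_eqI)
  fix z assume z: "z \<in> carrier G"
  have "inv\<^bsub>G\<^esub> y \<otimes>\<^bsub>G\<^esub> z = \<one>\<^bsub>G\<^esub> \<longleftrightarrow> y = z" if "y \<in> carrier G" for y
    using that z by (metis G.inv_closed G.inv_equality G.inv_inv G.l_inv)
  then have "(f \<otimes>\<^bsub>KG\<^esub> \<one>\<^bsub>KG\<^esub>) z = (\<Oplus>y\<in>carrier G. if y = z then f y else \<zero>)"
    using z f by (simp add: mult_KG_app one_KG_closed)
                 (auto intro!: R.finsum_cong' simp: one_KG_app)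
  also have "\<dots> = f z"
    using z f finite_group by (subst finsum_delta) auto
  finally show "(f \<otimes>\<^bsub>KG\<^esub> \<one>\<^bsub>KG\<^esub>) z = f z" .
qed (use f one_KG_closed in auto)

lemma ring_KG: "ring KG"
proof (intro ringI abelian_groupI monoidI)
  fix f assume f: "f \<in> carrier KG"
  let ?n = "\<lambda>z\<in>carrier G. \<ominus> f z"
  have "?n \<in> carrier KG" using f by (auto simp: carrier_KG)
  moreover have "?n \<oplus>\<^bsub>KG\<^esub> f = \<zero>\<^bsub>KG\<^esub>"
    using f by (intro KG_eqI) (auto simp: add_KG_app zero_KG_app R.l_neg \<open>?n \<in> carrier KG\<close>
      intro: add_KG_closed zero_KG_closed)
  ultimately show "\<exists>h\<in>carrier KG. h \<oplus>\<^bsub>KG\<^esub> f = \<zero>\<^bsub>KG\<^esub>" by blast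
next
  fix f h k assume *: "f \<in> carrier KG" "h \<in> carrier KG" "k \<in> carrier KG"
  show "(f \<oplus>\<^bsub>KG\<^esub> h) \<otimes>\<^bsub>KG\<^esub> k = f \<otimes>\<^bsub>KG\<^esub> k \<oplus>\<^bsub>KG\<^esub> h \<otimes>\<^bsub>KG\<^esub> k"
  proof (rule KG_eqI)
    fix z assume "z \<in> carrier G"
    then show "((f \<oplus>\<^bsub>KG\<^esub> h) \<otimes>\<^bsub>KG\<^esub> k) z = (f \<otimes>\<^bsub>KG\<^esub> k \<oplus>\<^bsub>KG\<^esub> h \<otimes>\<^bsub>KG\<^esub> k) z"
      using * by (simp add: mult_KG_app add_KG_app add_KG_closed)
        (subst R.finsum_addf[symmetric], fastforce, fastforce,
          intro R.finsum_cong', auto simp: add_KG_app R.l_distr)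
  qed (use * add_KG_closed in auto)
  show "k \<otimes>\<^bsub>KG\<^esub> (f \<oplus>\<^bsub>KG\<^esub> h) = k \<otimes>\<^bsub>KG\<^esub> f \<oplus>\<^bsub>KG\<^esub> k \<otimes>\<^bsub>KG\<^esub> h"
  proof (rule KG_eqI)
    fix z assume "z \<in> carrier G"
    then show "(k \<otimes>\<^bsub>KG\<^esub> (f \<oplus>\<^bsub>KG\<^esub> h)) z = (k \<otimes>\<^bsub>KG\<^esub> f \<oplus>\<^bsub>KG\<^esub> k \<otimes>\<^bsub>KG\<^esub> h) z"
      using * by (simp add: mult_KG_app add_KG_app add_KG_closed)
        (subst R.finsum_addf[symmetric], fastforce, fastforce,
          intro R.finsum_cong', auto simp: add_KG_app R.r_distr)
  qed (use * add_KG_closed in auto)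
  show "f \<oplus>\<^bsub>KG\<^esub> h \<oplus>\<^bsub>KG\<^esub> k = f \<oplus>\<^bsub>KG\<^esub> (h \<oplus>\<^bsub>KG\<^esub> k)"
    using * by (intro KG_eqI) (auto simp: add_KG_app R.a_assoc intro: add_KG_closed)
  show "f \<oplus>\<^bsub>KG\<^esub> h = h \<oplus>\<^bsub>KG\<^esub> f"
    using * by (intro KG_eqI) (auto simp: add_KG_app R.a_comm intro: add_KG_closed)
  show "\<zero>\<^bsub>KG\<^esub> \<oplus>\<^bsub>KG\<^esub> f = f"
    using * by (intro KG_eqI) (auto simp: add_KG_app zero_KG_app intro: add_KG_closed zero_KG_closed)
qed (auto simp: add_KG_closed zero_KG_closed one_KG_closed one_mult_KG mult_one_KG mult_KG_assoc)

end

section \<open>Extension of matrix representations to the group algebra\<close>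

lemma mat_monoid_app:
  "i < n \<Longrightarrow> j < n \<Longrightarrow> (A \<otimes>\<^bsub>mat_monoid n K\<^esub> B) (i, j) = finsum K (\<lambda>k. A (i, k) \<otimes>\<^bsub>K\<^esub> B (k, j)) {..<n}"
  by (simp add: mat_monoid_def)

lemma carrier_mat_monoid: "carrier (mat_monoid n K) = {..<n} \<times> {..<n} \<rightarrow>\<^sub>E carrier K"
  by (simp add: mat_monoid_def)

text \<open>
  The matrices have entries in a ring \<open>K\<close> that may be larger than the coefficient ring: \<open>\<phi>\<close> carries the
  coefficients into \<open>K\<close>. This covers the faithful representation over a quadratic extension.
\<close>

locale finite_group_matrix_rep = finite_group_algebra R G + K: cring K
  for R (structure) and G (structure) and K (structure) +
  fixes \<phi> and n :: nat and \<rho>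
  assumes hom: "\<phi> \<in> ring_hom R K"
    and rep: "\<rho> \<in> hom G (mat_monoid n K)"
    and rep_one: "\<rho> \<one>\<^bsub>G\<^esub> = \<one>\<^bsub>mat_monoid n K\<^esub>"
begin

definition ext
  where "ext f = (\<lambda>(i, j)\<in>{..<n} \<times> {..<n}. \<Oplus>\<^bsub>K\<^esub>y\<in>carrier G. \<phi> (f y) \<otimes>\<^bsub>K\<^esub> \<rho> y (i, j))"

lemma hom_closed [simp, intro]: "c \<in> carrier R \<Longrightarrow> \<phi> c \<in> carrier K"
  using hom by (auto simp: ring_hom_def)

lemma rep_app [simp, intro]: "y \<in> carrier G \<Longrightarrow> i < n \<Longrightarrow> j < n \<Longrightarrow> \<rho> y (i, j) \<in> carrier K"
  using rep by (auto simp: hom_def carrier_mat_monoid)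

lemma ext_app: "i < n \<Longrightarrow> j < n \<Longrightarrow>
    ext f (i, j) = (\<Oplus>\<^bsub>K\<^esub>y\<in>carrier G. \<phi> (f y) \<otimes>\<^bsub>K\<^esub> \<rho> y (i, j))"
  by (simp add: ext_def)

lemma ext_closed: "f \<in> carrier KG \<Longrightarrow> ext f \<in> carrier (mat_monoid n K)"
  by (auto simp: ext_def carrier_mat_monoid intro!: K.finsum_closed)

lemma hom_finsum:
  assumes "finite A" "\<And>y. y \<in> A \<Longrightarrow> f y \<in> carrier R"
  shows "\<phi> (\<Oplus>\<^bsub>R\<^esub>y\<in>A. f y) = (\<Oplus>\<^bsub>K\<^esub>y\<in>A. \<phi> (f y))"
proof -
  interpret \<phi>: ring_hom_ring R K \<phi>
    using hom by (intro ring_hom_ringI2 R.ring_axioms K.ring_axioms)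
  show ?thesis
    using assms by (subst \<phi>.hom_finsum) (auto simp: comp_def)
qed

lemma hom_mult: "b \<in> carrier R \<Longrightarrow> c \<in> carrier R \<Longrightarrow> \<phi> (b \<otimes> c) = \<phi> b \<otimes>\<^bsub>K\<^esub> \<phi> c"
  using hom by (auto simp: ring_hom_def)

lemma hom_zero: "\<phi> \<zero> = \<zero>\<^bsub>K\<^esub>"
  using hom_finsum[of "{}"] by simp

lemma hom_add: "b \<in> carrier R \<Longrightarrow> c \<in> carrier R \<Longrightarrow> \<phi> (b \<oplus> c) = \<phi> b \<oplus>\<^bsub>K\<^esub> \<phi> c"
  using hom by (auto simp: ring_hom_def)

lemma ext_add_app:
  assumes "f \<in> carrier KG" "h \<in> carrier KG" "i < n" "j < n"
  shows "ext (f \<oplus>\<^bsub>KG\<^esub> h) (i, j) = ext f (i, j) \<oplus>\<^bsub>K\<^esub> ext h (i, j)"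
proof -
  have "ext f (i, j) \<oplus>\<^bsub>K\<^esub> ext h (i, j) = (\<Oplus>\<^bsub>K\<^esub>y\<in>carrier G.
      \<phi> (f y) \<otimes>\<^bsub>K\<^esub> \<rho> y (i, j) \<oplus>\<^bsub>K\<^esub> \<phi> (h y) \<otimes>\<^bsub>K\<^esub> \<rho> y (i, j))"
    using assms by (simp add: ext_app K.finsum_addf)
  also have "\<dots> = ext (f \<oplus>\<^bsub>KG\<^esub> h) (i, j)"
    unfolding ext_app[OF assms(3,4)] using assms
    by (intro K.finsum_cong') (auto simp: add_KG_app hom_add K.l_distr)
  finally show ?thesis by simp
qed

lemma ext_basis_scalar:
  assumes g: "g \<in> carrier G" and c: "c \<in> carrier R" and ij: "i < n" "j < n"
  shows "ext (\<lambda>z\<in>carrier G. if z = g then c else \<zero>) (i, j) = \<phi> c \<otimes>\<^bsub>K\<^esub> \<rho> g (i, j)"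
proof -
  have "ext (\<lambda>z\<in>carrier G. if z = g then c else \<zero>) (i, j)
      = (\<Oplus>\<^bsub>K\<^esub>y\<in>carrier G. if g = y then \<phi> c \<otimes>\<^bsub>K\<^esub> \<rho> y (i, j) else \<zero>\<^bsub>K\<^esub>)"
    using assms by (auto simp: ext_app hom_zero intro!: K.finsum_cong')
  also have "\<dots> = \<phi> c \<otimes>\<^bsub>K\<^esub> \<rho> g (i, j)"
    using assms finite_group by (intro K.finsum_singleton) auto
  finally show ?thesis .
qed

lemma ext_one: "ext \<one>\<^bsub>KG\<^esub> = \<one>\<^bsub>mat_monoid n K\<^esub>"
proof -
  have *: "\<one>\<^bsub>KG\<^esub> = (\<lambda>z\<in>carrier G. if z = \<one>\<^bsub>G\<^esub> then \<one> else \<zero>)"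
    by (simp add: group_algebra_def)
  have "\<phi> \<one> = \<one>\<^bsub>K\<^esub>" using hom by (simp add: ring_hom_def)
  then have "ext \<one>\<^bsub>KG\<^esub> (i, j) = \<rho> \<one>\<^bsub>G\<^esub> (i, j)" if "i < n" "j < n" for i j
    using that by (simp only: * ext_basis_scalar G.one_closed R.one_closed) simp
  then show ?thesis
    by (auto simp: rep_one fun_eq_iff) (auto simp: ext_def mat_monoid_def)
qed

text \<open>
  Expanding the convolution and substituting \<open>z = yw\<close> gives a double sum over \<open>y\<close> and \<open>w\<close> in which
  \<open>\<rho> (yw)\<close> is the matrix product of \<open>\<rho> y\<close> and \<open>\<rho> w\<close>; moving the sum over the inner matrix index
  outwards separates the two factors.
\<close>

lemma ext_mult:
  assumes f: "f \<in> carrier KG" and h: "h \<in> carrier KG"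
  shows "ext (f \<otimes>\<^bsub>KG\<^esub> h) = ext f \<otimes>\<^bsub>mat_monoid n K\<^esub> ext h"
proof -
  let ?G = "carrier G"
  have "ext (f \<otimes>\<^bsub>KG\<^esub> h) (i, j) = (ext f \<otimes>\<^bsub>mat_monoid n K\<^esub> ext h) (i, j)"
    if ij: "i < n" "j < n" for i j
  proof -
    have "ext (f \<otimes>\<^bsub>KG\<^esub> h) (i, j)
        = (\<Oplus>\<^bsub>K\<^esub>z\<in>?G. (\<Oplus>\<^bsub>K\<^esub>y\<in>?G. \<phi> (f y) \<otimes>\<^bsub>K\<^esub> \<phi> (h (inv\<^bsub>G\<^esub> y \<otimes>\<^bsub>G\<^esub> z))) \<otimes>\<^bsub>K\<^esub> \<rho> z (i, j))"
      using ij f h finite_group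
      by (simp add: ext_app)
         (auto intro!: K.finsum_cong' K.finsum_closed arg_cong2[of _ _ _ _ "(\<otimes>\<^bsub>K\<^esub>)"]
           simp: mult_KG_app hom_finsum hom_mult)
    also have "\<dots> = (\<Oplus>\<^bsub>K\<^esub>z\<in>?G. \<Oplus>\<^bsub>K\<^esub>y\<in>?G.
        \<phi> (f y) \<otimes>\<^bsub>K\<^esub> \<phi> (h (inv\<^bsub>G\<^esub> y \<otimes>\<^bsub>G\<^esub> z)) \<otimes>\<^bsub>K\<^esub> \<rho> z (i, j))"
      using ij f h finite_group
      by (intro K.finsum_cong') (auto intro!: K.finsum_closed K.finsum_ldistr)
    also have "\<dots> = (\<Oplus>\<^bsub>K\<^esub>y\<in>?G. \<Oplus>\<^bsub>K\<^esub>z\<in>?G.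
        \<phi> (f y) \<otimes>\<^bsub>K\<^esub> \<phi> (h (inv\<^bsub>G\<^esub> y \<otimes>\<^bsub>G\<^esub> z)) \<otimes>\<^bsub>K\<^esub> \<rho> z (i, j))"
      using ij f h finite_group by (intro K.finsum_swap) auto
    also have "\<dots> = (\<Oplus>\<^bsub>K\<^esub>y\<in>?G. \<Oplus>\<^bsub>K\<^esub>w\<in>?G. \<Oplus>\<^bsub>K\<^esub>k\<in>{..<n}.
        (\<phi> (f y) \<otimes>\<^bsub>K\<^esub> \<rho> y (i, k)) \<otimes>\<^bsub>K\<^esub> (\<phi> (h w) \<otimes>\<^bsub>K\<^esub> \<rho> w (k, j)))"
    proof (rule K.finsum_cong')
      fix y assume y: "y \<in> ?G"
      have "(\<Oplus>\<^bsub>K\<^esub>z\<in>?G. \<phi> (f y) \<otimes>\<^bsub>K\<^esub> \<phi> (h (inv\<^bsub>G\<^esub> y \<otimes>\<^bsub>G\<^esub> z)) \<otimes>\<^bsub>K\<^esub> \<rho> z (i, j))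
          = (\<Oplus>\<^bsub>K\<^esub>w\<in>?G. \<phi> (f y) \<otimes>\<^bsub>K\<^esub> \<phi> (h (inv\<^bsub>G\<^esub> y \<otimes>\<^bsub>G\<^esub> (y \<otimes>\<^bsub>G\<^esub> w)))
                \<otimes>\<^bsub>K\<^esub> \<rho> (y \<otimes>\<^bsub>G\<^esub> w) (i, j))"
        using y ij f h by (intro K.finsum_left_translate) auto
      also have "\<dots> = (\<Oplus>\<^bsub>K\<^esub>w\<in>?G. \<Oplus>\<^bsub>K\<^esub>k\<in>{..<n}.
          (\<phi> (f y) \<otimes>\<^bsub>K\<^esub> \<rho> y (i, k)) \<otimes>\<^bsub>K\<^esub> (\<phi> (h w) \<otimes>\<^bsub>K\<^esub> \<rho> w (k, j)))"
      proof (rule K.finsum_cong')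
        fix w assume w: "w \<in> ?G"
        have "\<phi> (f y) \<otimes>\<^bsub>K\<^esub> \<phi> (h (inv\<^bsub>G\<^esub> y \<otimes>\<^bsub>G\<^esub> (y \<otimes>\<^bsub>G\<^esub> w))) \<otimes>\<^bsub>K\<^esub> \<rho> (y \<otimes>\<^bsub>G\<^esub> w) (i, j)
            = \<phi> (f y) \<otimes>\<^bsub>K\<^esub> \<phi> (h w) \<otimes>\<^bsub>K\<^esub> (\<Oplus>\<^bsub>K\<^esub>k\<in>{..<n}. \<rho> y (i, k) \<otimes>\<^bsub>K\<^esub> \<rho> w (k, j))"
          using y w rep ij by (simp add: hom_def mat_monoid_app flip: G.m_assoc)
        also have "\<dots> = (\<Oplus>\<^bsub>K\<^esub>k\<in>{..<n}.
            (\<phi> (f y) \<otimes>\<^bsub>K\<^esub> \<rho> y (i, k)) \<otimes>\<^bsub>K\<^esub> (\<phi> (h w) \<otimes>\<^bsub>K\<^esub> \<rho> w (k, j)))"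
          using y w ij f h
          by (subst K.finsum_rdistr) (auto intro!: K.finsum_cong' simp: K.m_ac)
        finally show "\<phi> (f y) \<otimes>\<^bsub>K\<^esub> \<phi> (h (inv\<^bsub>G\<^esub> y \<otimes>\<^bsub>G\<^esub> (y \<otimes>\<^bsub>G\<^esub> w))) \<otimes>\<^bsub>K\<^esub> \<rho> (y \<otimes>\<^bsub>G\<^esub> w) (i, j)
            = (\<Oplus>\<^bsub>K\<^esub>k\<in>{..<n}. (\<phi> (f y) \<otimes>\<^bsub>K\<^esub> \<rho> y (i, k)) \<otimes>\<^bsub>K\<^esub> (\<phi> (h w) \<otimes>\<^bsub>K\<^esub> \<rho> w (k, j)))" .
      qed (use y ij f h in \<open>auto intro!: K.finsum_closed\<close>)
      finally show "(\<Oplus>\<^bsub>K\<^esub>z\<in>?G. \<phi> (f y) \<otimes>\<^bsub>K\<^esub> \<phi> (h (inv\<^bsub>G\<^esub> y \<otimes>\<^bsub>G\<^esub> z)) \<otimes>\<^bsub>K\<^esub> \<rho> z (i, j))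
          = (\<Oplus>\<^bsub>K\<^esub>w\<in>?G. \<Oplus>\<^bsub>K\<^esub>k\<in>{..<n}.
          (\<phi> (f y) \<otimes>\<^bsub>K\<^esub> \<rho> y (i, k)) \<otimes>\<^bsub>K\<^esub> (\<phi> (h w) \<otimes>\<^bsub>K\<^esub> \<rho> w (k, j)))" .
    qed (use ij f h in \<open>auto intro!: K.finsum_closed\<close>)
    also have "\<dots> = (\<Oplus>\<^bsub>K\<^esub>y\<in>?G. \<Oplus>\<^bsub>K\<^esub>k\<in>{..<n}. \<Oplus>\<^bsub>K\<^esub>w\<in>?G.
        (\<phi> (f y) \<otimes>\<^bsub>K\<^esub> \<rho> y (i, k)) \<otimes>\<^bsub>K\<^esub> (\<phi> (h w) \<otimes>\<^bsub>K\<^esub> \<rho> w (k, j)))"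
      using ij f h finite_group
      by (intro K.finsum_cong' K.finsum_swap) (auto intro!: K.finsum_closed)
    also have "\<dots> = (\<Oplus>\<^bsub>K\<^esub>k\<in>{..<n}. \<Oplus>\<^bsub>K\<^esub>y\<in>?G. \<Oplus>\<^bsub>K\<^esub>w\<in>?G.
        (\<phi> (f y) \<otimes>\<^bsub>K\<^esub> \<rho> y (i, k)) \<otimes>\<^bsub>K\<^esub> (\<phi> (h w) \<otimes>\<^bsub>K\<^esub> \<rho> w (k, j)))"
      using ij f h finite_group by (intro K.finsum_swap) (auto intro!: K.finsum_closed)
    also have "\<dots> = (\<Oplus>\<^bsub>K\<^esub>k\<in>{..<n}. \<Oplus>\<^bsub>K\<^esub>y\<in>?G. (\<phi> (f y) \<otimes>\<^bsub>K\<^esub> \<rho> y (i, k)) \<otimes>\<^bsub>K\<^esub> ext h (k, j))"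
      using ij f h finite_group
      by (intro K.finsum_cong')
         (auto intro!: K.finsum_closed K.finsum_rdistr[symmetric] simp: ext_app)
    also have "\<dots> = (\<Oplus>\<^bsub>K\<^esub>k\<in>{..<n}. ext f (i, k) \<otimes>\<^bsub>K\<^esub> ext h (k, j))"
      using ij f h finite_group
      by (intro K.finsum_cong')
         (auto intro!: K.finsum_closed K.finsum_ldistr[symmetric] simp: ext_app)
    finally show ?thesis
      using ij by (simp add: mat_monoid_app)
  qed
  then show ?thesis
    by (auto simp: fun_eq_iff) (auto simp: ext_def mat_monoid_def)
qed

end

section \<open>Normal forms in the quasidihedral group\<close>

definition qd_rel :: "(qd_gen word \<times> qd_gen word) set"
  where "qd_rel = {(replicate 8 (Gen_a, True), []), (replicate 2 (Gen_x, True), []),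
    ([(Gen_x, True), (Gen_a, True), (Gen_x, True)], replicate 3 (Gen_a, True))}"

lemma QD16_eq: "QD16 = presented_group qd_rel"
  by (simp add: QD16_def qd_rel_def Let_def numeral_eq_Suc)

interpretation QD: group QD16
  by (simp add: QD16_eq group_presented_group)

definition qd_a :: "qd_gen word set" where "qd_a = word_class qd_rel [(Gen_a, True)]"
definition qd_x :: "qd_gen word set" where "qd_x = word_class qd_rel [(Gen_x, True)]"

text \<open>
  The normal form \<open>a\<^sup>i x\<^sup>j\<close>; the exponents matter only modulo 8 and 2.
\<close>

definition qd_elt :: "nat \<Rightarrow> nat \<Rightarrow> qd_gen word set"
  where "qd_elt i j = qd_a [^]\<^bsub>QD16\<^esub> i \<otimes>\<^bsub>QD16\<^esub> qd_x [^]\<^bsub>QD16\<^esub> j"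

lemma carrier_QD16: "carrier QD16 = range (word_class qd_rel)"
  by (simp add: QD16_eq presented_group_def)

lemma one_QD16: "\<one>\<^bsub>QD16\<^esub> = word_class qd_rel []"
  by (simp add: QD16_eq presented_group_def)

lemma mult_QD16:
  "word_class qd_rel u \<otimes>\<^bsub>QD16\<^esub> word_class qd_rel v = word_class qd_rel (u @ v)"
  by (simp add: QD16_eq presented_group_mult)

lemma word_class_closed [simp, intro]: "word_class qd_rel u \<in> carrier QD16"
  by (simp add: carrier_QD16)

lemma qd_closed [simp, intro]: "qd_a \<in> carrier QD16" "qd_x \<in> carrier QD16"
  by (auto simp: carrier_QD16 qd_a_def qd_x_def)

lemma qd_elt_closed [simp, intro]: "qd_elt i j \<in> carrier QD16"
  by (simp add: qd_elt_def)

lemma word_class_replicate: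
  "word_class qd_rel [l] [^]\<^bsub>QD16\<^esub> n = word_class qd_rel (replicate n l)"
  by (induction n) (simp_all add: one_QD16 mult_QD16 replicate_append_same)

lemma qd_relations:
  "qd_a [^]\<^bsub>QD16\<^esub> (8::nat) = \<one>\<^bsub>QD16\<^esub>" "qd_x [^]\<^bsub>QD16\<^esub> (2::nat) = \<one>\<^bsub>QD16\<^esub>"
  "qd_x \<otimes>\<^bsub>QD16\<^esub> qd_a \<otimes>\<^bsub>QD16\<^esub> qd_x = qd_a [^]\<^bsub>QD16\<^esub> (3::nat)"
  unfolding qd_a_def qd_x_def word_class_replicate one_QD16 mult_QD16 word_class_eq_iff
  by (rule word_eq.relation; simp add: qd_rel_def)+

lemma qd_elt_eq: "qd_elt i j = word_class qd_rel (replicate i (Gen_a, True) @ replicate j (Gen_x, True))"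
  by (simp add: qd_elt_def qd_a_def qd_x_def word_class_replicate mult_QD16)

context monoid
begin

lemma nat_pow_mod_eq:
  assumes "x \<in> carrier G" "x [^] (n::nat) = \<one>"
  shows "x [^] (i mod n) = x [^] i"
proof -
  have "x [^] i = x [^] (n * (i div n) + i mod n)" by simp
  also have "\<dots> = (x [^] n) [^] (i div n) \<otimes> x [^] (i mod n)"
    using assms(1) by (simp only: nat_pow_mult nat_pow_pow)
  finally show ?thesis using assms by simp
qed

lemma semidihedral_swap:
  assumes [simp]: "a \<in> carrier G" "x \<in> carrier G" and x2: "x [^] (2::nat) = \<one>"
    and rel: "x \<otimes> a \<otimes> x = a [^] (3::nat)"
  shows "x [^] j \<otimes> a [^] (k::nat) = a [^] (3 ^ j * k) \<otimes> x [^] (j::nat)"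
proof -
  have xx: "x \<otimes> x = \<one>" using x2 by (simp add: numeral_2_eq_2)
  have xa: "x \<otimes> a = a [^] (3::nat) \<otimes> x"
    using rel xx by (metis assms(1,2) m_assoc m_closed r_one)
  have xak: "x \<otimes> a [^] k = a [^] (3 * k) \<otimes> x" for k :: nat
  proof (induction k)
    case (Suc k)
    have "x \<otimes> a [^] Suc k = a [^] (3 * k) \<otimes> (x \<otimes> a)"
      using Suc by (simp flip: m_assoc)
    also have "\<dots> = a [^] (3 * k) \<otimes> a [^] (3::nat) \<otimes> x"
      by (simp add: xa m_assoc)
    also have "\<dots> = a [^] (3 * Suc k) \<otimes> x"
      by (simp add: nat_pow_mult add.commute)
    finally show ?case .
  qed simp
  show ?thesis
  proof (induction j arbitrary: k)
    case (Suc j)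
    have "x [^] Suc j \<otimes> a [^] k = x [^] j \<otimes> a [^] (3 * k) \<otimes> x"
      by (simp add: m_assoc xak)
    then show ?case by (simp add: Suc m_assoc mult_ac)
  qed simp
qed

lemma semidihedral_mult:
  assumes [simp]: "a \<in> carrier G" "x \<in> carrier G" and "x [^] (2::nat) = \<one>"
    and "x \<otimes> a \<otimes> x = a [^] (3::nat)"
  shows "(a [^] i \<otimes> x [^] j) \<otimes> (a [^] k \<otimes> x [^] l)
    = a [^] (i + 3 ^ j * k :: nat) \<otimes> x [^] (j + l :: nat)"
proof -
  have "(a [^] i \<otimes> x [^] j) \<otimes> (a [^] k \<otimes> x [^] l) = a [^] i \<otimes> (x [^] j \<otimes> a [^] k) \<otimes> x [^] l"
    by (simp add: m_assoc)
  also have "\<dots> = a [^] i \<otimes> a [^] (3 ^ j * k) \<otimes> (x [^] j \<otimes> x [^] l)"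
    by (simp add: m_assoc semidihedral_swap[OF assms])
  finally show ?thesis by (simp add: nat_pow_mult)
qed

end

lemma qd_elt_mult: "qd_elt i j \<otimes>\<^bsub>QD16\<^esub> qd_elt k l = qd_elt (i + 3 ^ j * k) (j + l)"
  unfolding qd_elt_def by (rule QD.semidihedral_mult) (auto simp: qd_relations)

lemma qd_elt_mod: "qd_elt (i mod 8) (j mod 2) = qd_elt i j"
  by (simp add: qd_elt_def QD.nat_pow_mod_eq qd_relations)

lemma word_class_in_qd_elt: "\<exists>i j. word_class qd_rel u = qd_elt i j"
proof (induction u)
  case Nil
  have "word_class qd_rel [] = qd_elt 0 0" by (simp add: qd_elt_eq)
  then show ?case by blast
next
  case (Cons l u)
  then obtain i j where u: "word_class qd_rel u = qd_elt i j" by blast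
  obtain s b where l: "l = (s, b)" by (cases l)
  have inverse: "word_class qd_rel [(s, False)] = word_class qd_rel [(s, True)] [^]\<^bsub>QD16\<^esub> (n::nat)"
    if "word_class qd_rel [(s, True)] [^]\<^bsub>QD16\<^esub> (Suc n) = \<one>\<^bsub>QD16\<^esub>" for n
  proof -
    have "word_class qd_rel [(s, True)] \<otimes>\<^bsub>QD16\<^esub> word_class qd_rel [(s, False)] = \<one>\<^bsub>QD16\<^esub>"
      using word_eq.cancel[of qd_rel s True] by (simp add: mult_QD16 one_QD16 word_class_eq_iff)
    with that show ?thesis
      by (metis QD.inv_unique QD.nat_pow_Suc QD.nat_pow_closed word_class_closed)
  qed
  have "\<exists>i j. word_class qd_rel [l] = qd_elt i j"
  proof (cases s)
    case Gen_a
    \<comment> \<open>The inverse generators are the positive powers \<open>a\<^sup>7\<close> and \<open>x\<close>.\<close>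
    have "word_class qd_rel [l] = qd_elt (if b then 1 else 7) 0"
      using inverse[of 7] qd_relations(1) Gen_a
      by (cases b) (simp_all add: l qd_elt_def qd_a_def)
    then show ?thesis by blast
  next
    case Gen_x
    have "word_class qd_rel [l] = qd_elt 0 1"
      using inverse[of 1] qd_relations(2) Gen_x
      by (cases b) (simp_all add: l qd_elt_def qd_x_def numeral_2_eq_2)
    then show ?thesis by blast
  qed
  moreover have "word_class qd_rel (l # u) = word_class qd_rel [l] \<otimes>\<^bsub>QD16\<^esub> word_class qd_rel u"
    by (simp add: mult_QD16)
  ultimately show ?case using u qd_elt_mult by metis
qed

text \<open>
  Words act on pairs of exponents by left multiplication of the normal form. Because the action
  respects the relations, it separates the sixteen normal forms, which an argument with words
  alone cannot do.
\<close>

fun qd_act :: "qd_gen \<times> bool \<Rightarrow> nat \<times> nat \<Rightarrow> nat \<times> nat"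
  where
    "qd_act (Gen_a, b) (i, j) = ((i + (if b then 1 else 7)) mod 8, j)"
  | "qd_act (Gen_x, b) (i, j) = ((3 * i) mod 8, 1 - j)"

lemma qd_act_word_eq:
  assumes "word_eq qd_rel u v"
  shows "s \<in> {..<8} \<times> {..<2} \<Longrightarrow>
    foldr qd_act u s = foldr qd_act v s \<and> foldr qd_act u s \<in> {..<8} \<times> {..<2}"
  using assms
proof (induction arbitrary: s rule: word_eq.induct)
  case (refl u)
  then show ?case
  proof (induction u)
    case (Cons l u)
    then show ?case by (cases "(l, foldr qd_act u s)" rule: qd_act.cases) auto
  qed simp
next
  case (cancel g b)
  obtain i j where s: "s = (i, j)" "i < 8" "j < 2" using cancel by auto
  have i: "i \<in> {0,1,2,3,4,5,6,7}" and j: "j \<in> {0,1}" using s by auto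
  show ?case using i j by (cases g; cases b) (auto simp: s)
next
  case (relation u v)
  obtain i j where s: "s = (i, j)" "i < 8" "j < 2" using relation by auto
  have i: "i \<in> {0,1,2,3,4,5,6,7}" and j: "j \<in> {0,1}" using s by auto
  have rep: "replicate 8 z = [z, z, z, z, z, z, z, z]" "replicate 2 z = [z, z]"
    "replicate 3 z = [z, z, z]" for z :: "qd_gen \<times> bool"
    by (simp_all add: numeral_eq_Suc)
  show ?case using relation(1) unfolding qd_rel_def rep insert_iff empty_iff
  proof (elim disjE)
  qed (use i j in \<open>auto simp: s\<close>)
next
  case (append u u' v v')
  then show ?case by (metis foldr_append comp_apply)
qed metis+

lemma qd_elt_inj:
  assumes "qd_elt i j = qd_elt k l" "i < 8" "j < 2" "k < 8" "l < 2"
  shows "i = k \<and> j = l"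
proof -
  let ?w = "\<lambda>i j. replicate i (Gen_a, True) @ replicate j (Gen_x, True)"
  have ev: "foldr qd_act (?w i j) (0, 0) = (i, j)" if "i < 8" "j < 2" for i j
  proof -
    have "foldr qd_act (replicate j (Gen_x, True)) (0, 0) = (0, j)"
      using that by (auto simp: less_2_cases_iff)
    moreover have "foldr qd_act (replicate i (Gen_a, True)) (0, j) = (i, j)"
      using that by (induction i) auto
    ultimately show ?thesis by simp
  qed
  have "word_eq qd_rel (?w i j) (?w k l)"
    using assms(1) by (simp add: qd_elt_eq word_class_eq_iff)
  from qd_act_word_eq[OF this, of "(0, 0)"] show ?thesis
    using ev assms by auto
qed

lemma qd_elt_bij: "bij_betw (\<lambda>(i, j). qd_elt i j) ({..<8} \<times> {..<2}) (carrier QD16)"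
  unfolding bij_betw_def
proof
  show "inj_on (\<lambda>(i, j). qd_elt i j) ({..<8} \<times> {..<2})"
    by (auto simp: inj_on_def dest: qd_elt_inj)
  have "g \<in> (\<lambda>(i, j). qd_elt i j) ` ({..<8} \<times> {..<2})" if g: "g \<in> carrier QD16" for g
  proof -
    obtain i j where "g = qd_elt i j"
      using g word_class_in_qd_elt unfolding carrier_QD16 by blast
    then have "g = qd_elt (i mod 8) (j mod 2)" by (simp add: qd_elt_mod)
    then show ?thesis by (auto intro!: rev_image_eqI[of "(i mod 8, j mod 2)"])
  qed
  then show "(\<lambda>(i, j). qd_elt i j) ` ({..<8} \<times> {..<2}) = carrier QD16" by auto
qed

lemma finite_QD16: "finite (carrier QD16)"
  using qd_elt_bij bij_betw_finite by (metis finite_SigmaI finite_lessThan)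

lemma card_QD16: "card (carrier QD16) = 16"
  using bij_betw_same_card[OF qd_elt_bij] by simp

text \<open>
  The universal property of the presentation, obtained from the normal form: the multiplication rule
  of the normal forms uses nothing but the three relations, so it also holds for \<open>a\<close> and \<open>x\<close> in \<open>G\<close>.
\<close>

lemma (in monoid) QD16_rep_exists:
  assumes a: "a \<in> carrier G" "x \<in> carrier G" and a8: "a [^] (8::nat) = \<one>"
    and x2: "x [^] (2::nat) = \<one>" and rel: "x \<otimes> a \<otimes> x = a [^] (3::nat)"
  obtains \<rho> where "\<rho> \<in> hom QD16 G" "\<And>i j. \<rho> (qd_elt i j) = a [^] i \<otimes> x [^] j"
proof
  define \<nu> where "\<nu> = inv_into ({..<8} \<times> {..<2}) (\<lambda>(i, j). qd_elt i j)"
  let ?\<rho> = "\<lambda>g. case \<nu> g of (i, j) \<Rightarrow> a [^] i \<otimes> x [^] j"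
  show elt: "?\<rho> (qd_elt i j) = a [^] i \<otimes> x [^] j" for i j
  proof -
    have "\<nu> (case (i mod 8, j mod 2) of (i, j) \<Rightarrow> qd_elt i j) = (i mod 8, j mod 2)"
      unfolding \<nu>_def by (rule bij_betw_inv_into_left[OF qd_elt_bij]) auto
    then show ?thesis
      using assms by (simp add: qd_elt_mod nat_pow_mod_eq)
  qed
  have cover: "\<exists>i j. g = qd_elt i j" if "g \<in> carrier QD16" for g
    using that word_class_in_qd_elt unfolding carrier_QD16 by blast
  show "?\<rho> \<in> hom QD16 G"
  proof (rule homI)
    fix g assume "g \<in> carrier QD16"
    then obtain i j where g: "g = qd_elt i j" using cover by blast
    then show "?\<rho> g \<in> carrier G" using a by (simp only: elt) simp
    fix h assume "h \<in> carrier QD16"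
    then obtain k l where h: "h = qd_elt k l" using cover by blast
    show "?\<rho> (g \<otimes>\<^bsub>QD16\<^esub> h) = ?\<rho> g \<otimes> ?\<rho> h"
      unfolding g h qd_elt_mult elt by (simp add: semidihedral_mult[OF a x2 rel])
  qed
qed

lemma (in abelian_monoid) finsum_QD16:
  assumes "\<And>g. g \<in> carrier QD16 \<Longrightarrow> f g \<in> carrier G"
  shows "(\<Oplus>g\<in>carrier QD16. f g) = (\<Oplus>i\<in>{..<8}. f (qd_elt i 0)) \<oplus> (\<Oplus>i\<in>{..<8}. f (qd_elt i 1))"
proof -
  have img: "carrier QD16 = (\<lambda>i. qd_elt i 0) ` {..<8} \<union> (\<lambda>i. qd_elt i 1) ` {..<8}"
  proof -
    have "{..<8} \<times> {..<2} = (\<lambda>i. (i, 0)) ` {..<8} \<union> (\<lambda>i. (i, 1::nat)) ` {..<8::nat}"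
      by (auto simp: less_2_cases_iff)
    then have "carrier QD16 = (\<lambda>(i, j). qd_elt i j) `
        ((\<lambda>i. (i, 0)) ` {..<8} \<union> (\<lambda>i. (i, 1::nat)) ` {..<8::nat})"
      using qd_elt_bij by (simp add: bij_betw_def)
    then show ?thesis by (simp only: image_Un image_image prod.case)
  qed
  have inj: "inj_on (\<lambda>i. qd_elt i j) {..<8}" if "j < 2" for j
    using that by (auto simp: inj_on_def dest: qd_elt_inj)
  have disj: "(\<lambda>i. qd_elt i 0) ` {..<8} \<inter> (\<lambda>i. qd_elt i 1) ` {..<8} = {}"
    by (auto dest: qd_elt_inj)
  have "(\<Oplus>g\<in>carrier QD16. f g)
      = (\<Oplus>g\<in>(\<lambda>i. qd_elt i 0) ` {..<8}. f g) \<oplus> (\<Oplus>g\<in>(\<lambda>i. qd_elt i 1) ` {..<8}. f g)"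
    unfolding img by (rule finsum_Un_disjoint) (use disj assms in auto)
  also have "\<dots> = (\<Oplus>i\<in>{..<8}. f (qd_elt i 0)) \<oplus> (\<Oplus>i\<in>{..<8}. f (qd_elt i 1))"
    using inj by (subst (1 2) finsum_reindex) (auto intro!: assms)
  finally show ?thesis .
qed

section \<open>The filtration by powers of 1 + a in characteristic two\<close>

text \<open>
  The features of \<open>F[QD\<^sub>1\<^sub>6]\<close> in characteristic two on which the filtration rests, with
  \<open>t = 1 + a\<close>, the embedding \<open>\<iota>\<close> of the scalars and the augmentation \<open>\<epsilon>\<close>. The rule \<open>x_t\<close> is the relation
  \<open>xax = a\<^sup>3\<close>, since \<open>1 + (1 + t)\<^sup>3 = t + t\<^sup>2 + t\<^sup>3\<close>. The assumption \<open>generated\<close> is an induction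
  principle: a property that holds for scalars, \<open>t\<close> and \<open>x\<close> and is stable under sums and products
  holds everywhere.
\<close>

locale qd_char2 = ring R + F: field F for R (structure) and F (structure) +
  fixes \<iota> \<epsilon> and t x
  assumes char2: "\<one> \<oplus> \<one> = \<zero>"
    and scalar_hom: "\<iota> \<in> ring_hom F R"
    and scalar_central: "c \<in> carrier F \<Longrightarrow> r \<in> carrier R \<Longrightarrow> \<iota> c \<otimes> r = r \<otimes> \<iota> c"
    and t_closed [simp, intro]: "t \<in> carrier R" and x_closed [simp, intro]: "x \<in> carrier R"
    and x_square: "x \<otimes> x = \<one>"
    and x_t: "x \<otimes> t = (t \<oplus> t [^] (2::nat) \<oplus> t [^] (3::nat)) \<otimes> x"
    and t8: "t [^] (8::nat) = \<zero>" and t7: "t [^] (7::nat) \<noteq> \<zero>"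
    and generated: "\<lbrakk>\<iota> ` carrier F \<subseteq> P; t \<in> P; x \<in> P; \<And>r s. r \<in> P \<Longrightarrow> s \<in> P \<Longrightarrow> r \<oplus> s \<in> P;
      \<And>r s. r \<in> P \<Longrightarrow> s \<in> P \<Longrightarrow> r \<otimes> s \<in> P\<rbrakk> \<Longrightarrow> carrier R \<subseteq> P"
    and aug_hom: "\<epsilon> \<in> ring_hom R F"
    and aug_scalar: "c \<in> carrier F \<Longrightarrow> \<epsilon> (\<iota> c) = c"
    and aug_t: "\<epsilon> t = \<zero>\<^bsub>F\<^esub>" and aug_x: "\<epsilon> x = \<one>\<^bsub>F\<^esub>"
begin

lemma scalar_closed [simp, intro]: "c \<in> carrier F \<Longrightarrow> \<iota> c \<in> carrier R"
  and scalar_mult: "b \<in> carrier F \<Longrightarrow> c \<in> carrier F \<Longrightarrow> \<iota> (b \<otimes>\<^bsub>F\<^esub> c) = \<iota> b \<otimes> \<iota> c"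
  and scalar_add: "b \<in> carrier F \<Longrightarrow> c \<in> carrier F \<Longrightarrow> \<iota> (b \<oplus>\<^bsub>F\<^esub> c) = \<iota> b \<oplus> \<iota> c"
  and scalar_one: "\<iota> \<one>\<^bsub>F\<^esub> = \<one>"
  using scalar_hom by (auto simp: ring_hom_def)

lemma scalar_zero: "\<iota> \<zero>\<^bsub>F\<^esub> = \<zero>"
  using scalar_add[of "\<zero>\<^bsub>F\<^esub>" "\<zero>\<^bsub>F\<^esub>"] by simp

lemma aug_closed [simp, intro]: "r \<in> carrier R \<Longrightarrow> \<epsilon> r \<in> carrier F"
  and aug_mult: "r \<in> carrier R \<Longrightarrow> s \<in> carrier R \<Longrightarrow> \<epsilon> (r \<otimes> s) = \<epsilon> r \<otimes>\<^bsub>F\<^esub> \<epsilon> s"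
  and aug_add: "r \<in> carrier R \<Longrightarrow> s \<in> carrier R \<Longrightarrow> \<epsilon> (r \<oplus> s) = \<epsilon> r \<oplus>\<^bsub>F\<^esub> \<epsilon> s"
  and aug_one: "\<epsilon> \<one> = \<one>\<^bsub>F\<^esub>"
  using aug_hom by (auto simp: ring_hom_def)

lemma aug_zero: "\<epsilon> \<zero> = \<zero>\<^bsub>F\<^esub>"
  using aug_add[of "\<zero>" "\<zero>"] by simp

lemma double [simp]: "r \<in> carrier R \<Longrightarrow> r \<oplus> r = \<zero>"
  using char2 by (metis l_distr l_null l_one one_closed)

lemma cancel [simp]: "r \<in> carrier R \<Longrightarrow> s \<in> carrier R \<Longrightarrow> r \<oplus> (r \<oplus> s) = s"
  by (simp flip: a_assoc)

lemma eq_iff_add_eq_zero: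
  assumes "r \<in> carrier R" "s \<in> carrier R"
  shows "r \<oplus> s = \<zero> \<longleftrightarrow> r = s"
  using assms by (metis cancel r_zero double)

lemma field_double: "c \<in> carrier F \<Longrightarrow> c \<oplus>\<^bsub>F\<^esub> c = \<zero>\<^bsub>F\<^esub>"
  by (metis aug_add aug_scalar aug_zero double scalar_closed)

lemmas expand = l_distr r_distr m_assoc a_ac

text \<open>
  The additive commutator; in characteristic two the sign is a plus. It is a derivation in each
  argument, so it can be computed on generators.
\<close>

definition comm where "comm r s = r \<otimes> s \<oplus> s \<otimes> r"

lemma comm_closed [simp, intro]: "r \<in> carrier R \<Longrightarrow> s \<in> carrier R \<Longrightarrow> comm r s \<in> carrier R"
  by (simp add: comm_def)

lemma comm_sym: "r \<in> carrier R \<Longrightarrow> s \<in> carrier R \<Longrightarrow> comm r s = comm s r"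
  by (simp add: comm_def a_comm)

lemma comm_mult_right:
  "r \<in> carrier R \<Longrightarrow> s \<in> carrier R \<Longrightarrow> u \<in> carrier R \<Longrightarrow>
    comm r (s \<otimes> u) = comm r s \<otimes> u \<oplus> s \<otimes> comm r u"
  by (simp add: comm_def expand)

lemma comm_mult_left:
  "r \<in> carrier R \<Longrightarrow> s \<in> carrier R \<Longrightarrow> u \<in> carrier R \<Longrightarrow>
    comm (r \<otimes> s) u = r \<otimes> comm s u \<oplus> comm r u \<otimes> s"
  by (simp add: comm_def expand)

lemma comm_add_right:
  "r \<in> carrier R \<Longrightarrow> s \<in> carrier R \<Longrightarrow> u \<in> carrier R \<Longrightarrow> comm r (s \<oplus> u) = comm r s \<oplus> comm r u"
  by (simp add: comm_def expand)

definition I :: "nat \<Rightarrow> 'a set" where "I k = {t [^] k \<otimes> r | r. r \<in> carrier R}"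

lemma I_subset: "u \<in> I k \<Longrightarrow> u \<in> carrier R"
  by (auto simp: I_def)

lemma I_intro: "r \<in> carrier R \<Longrightarrow> t [^] k \<otimes> r \<in> I k"
  by (auto simp: I_def)

lemma I_zero: "\<zero> \<in> I k"
  using I_intro[of \<zero> k] by simp

lemma I_add: "u \<in> I k \<Longrightarrow> v \<in> I k \<Longrightarrow> u \<oplus> v \<in> I k"
  by (auto simp: I_def) (metis a_closed nat_pow_closed r_distr t_closed)

lemma I_right: "u \<in> I k \<Longrightarrow> r \<in> carrier R \<Longrightarrow> u \<otimes> r \<in> I k"
  by (auto simp: I_def) (metis m_closed m_assoc nat_pow_closed t_closed)

lemma I_t: "u \<in> I k \<Longrightarrow> t [^] l \<otimes> u \<in> I (l + k)"
  by (auto simp: I_def) (metis m_assoc nat_pow_closed nat_pow_mult t_closed)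

lemma I_0: "I 0 = carrier R"
  using I_intro[of _ 0] I_subset[of _ 0] by auto

lemma I_8: "I 8 = {\<zero>}"
  using I_zero[of 8] by (auto simp: I_def t8)

text \<open>
  This makes the right ideals \<open>I k\<close> two-sided: moving \<open>x\<close> past \<open>t\<close> replaces \<open>t\<close> by
  \<open>t (1 + t + t\<^sup>2)\<close>.
\<close>

lemma t_mult_left:
  assumes "r \<in> carrier R"
  shows "\<exists>s\<in>carrier R. r \<otimes> t = t \<otimes> s"
proof -
  let ?P = "{r \<in> carrier R. \<exists>s\<in>carrier R. r \<otimes> t = t \<otimes> s}"
  have "carrier R \<subseteq> ?P"
  proof (rule generated)
    show "\<iota> ` carrier F \<subseteq> ?P" using scalar_central by (auto intro!: bexI)
    show "t \<in> ?P" by auto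
    have "x \<otimes> t = t \<otimes> ((\<one> \<oplus> t \<oplus> t [^] (2::nat)) \<otimes> x)"
      by (simp add: x_t expand numeral_eq_Suc)
    then show "x \<in> ?P" by (simp) (metis a_closed m_closed nat_pow_closed one_closed t_closed x_closed)
  next
    fix r s assume rs: "r \<in> ?P" "s \<in> ?P"
    then obtain r' s' where *: "r' \<in> carrier R" "r \<otimes> t = t \<otimes> r'" "s' \<in> carrier R" "s \<otimes> t = t \<otimes> s'"
      by auto
    have "(r \<oplus> s) \<otimes> t = t \<otimes> (r' \<oplus> s')" using * rs by (simp add: l_distr r_distr)
    then show "r \<oplus> s \<in> ?P" using * rs by auto
    have "(r \<otimes> s) \<otimes> t = t \<otimes> (r' \<otimes> s')" using * rs by (metis (no_types, lifting) m_assoc mem_Collect_eq t_closed)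
    then show "r \<otimes> s \<in> ?P" using * rs by auto
  qed
  then show ?thesis using assms by blast
qed

lemma t_pow_mult_left:
  assumes "r \<in> carrier R"
  shows "\<exists>s\<in>carrier R. r \<otimes> t [^] (k::nat) = t [^] k \<otimes> s"
proof (induction k)
  case 0
  then show ?case using assms by auto
next
  case (Suc k)
  then obtain s where s: "s \<in> carrier R" "r \<otimes> t [^] k = t [^] k \<otimes> s" by blast
  obtain s' where s': "s' \<in> carrier R" "s \<otimes> t = t \<otimes> s'" using t_mult_left s by blast
  have "r \<otimes> t [^] Suc k = t [^] k \<otimes> (s \<otimes> t)"
    using assms s by (simp flip: m_assoc)
  also have "\<dots> = t [^] Suc k \<otimes> s'"
    using s s' by (simp add: m_assoc)
  finally show ?case using s' by blast
qed

lemma I_mult: "u \<in> I j \<Longrightarrow> v \<in> I k \<Longrightarrow> u \<otimes> v \<in> I (j + k)"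
proof -
  assume "u \<in> I j" "v \<in> I k"
  then obtain r s where *: "r \<in> carrier R" "s \<in> carrier R" "u = t [^] j \<otimes> r" "v = t [^] k \<otimes> s"
    by (auto simp: I_def)
  obtain r' where r': "r' \<in> carrier R" "r \<otimes> t [^] k = t [^] k \<otimes> r'"
    using * t_pow_mult_left by blast
  have "u \<otimes> v = t [^] j \<otimes> (r \<otimes> t [^] k) \<otimes> s"
    using * by (simp add: m_assoc)
  also have "\<dots> = t [^] (j + k) \<otimes> (r' \<otimes> s)"
    using * r' by (simp add: m_assoc flip: nat_pow_mult)
  finally show ?thesis using * r' I_intro by simp
qed

lemma I_left: "u \<in> I k \<Longrightarrow> r \<in> carrier R \<Longrightarrow> r \<otimes> u \<in> I k"
  using I_mult[of r 0 u k] by (simp add: I_0)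

text \<open>
  The elements whose commutator with \<open>y\<close> lies in an ideal form a subring containing the scalars.
\<close>

lemma comm_generated:
  assumes y: "y \<in> carrier R" and "comm y t \<in> I k" "comm y x \<in> I k" and s: "s \<in> carrier R"
  shows "comm y s \<in> I k"
proof -
  have "carrier R \<subseteq> {s \<in> carrier R. comm y s \<in> I k}"
  proof (rule generated)
    show "\<iota> ` carrier F \<subseteq> {s \<in> carrier R. comm y s \<in> I k}"
      using y scalar_central by (auto simp: comm_def I_zero)
  qed (use assms in \<open>auto simp: comm_add_right comm_mult_right intro: I_add I_right I_left\<close>)
  then show ?thesis using s by blast
qed

lemma comm_t_x: "comm t x \<in> I 2"
proof -
  have "comm t x = t [^] (2::nat) \<otimes> ((\<one> \<oplus> t) \<otimes> x)"
    by (simp add: comm_def x_t expand numeral_eq_Suc)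
  then show ?thesis by (simp add: I_intro)
qed

text \<open>
  The quotient by \<open>I 2\<close> is commutative, because the only commutator of generators that could be
  nonzero is that of \<open>t\<close> and \<open>x\<close>.
\<close>

lemma comm_I2: "r \<in> carrier R \<Longrightarrow> s \<in> carrier R \<Longrightarrow> comm r s \<in> I 2"
proof -
  have self: "comm y y \<in> I 2" if "y \<in> carrier R" for y
    using that by (simp add: comm_def I_zero)
  have xt: "comm x t \<in> I 2" using comm_t_x comm_sym[of x t] by simp
  have t: "comm s t \<in> I 2" if "s \<in> carrier R" for s
    using that comm_generated[OF t_closed self comm_t_x that] comm_sym[of s t] by simp
  have x: "comm s x \<in> I 2" if "s \<in> carrier R" for s
    using that comm_generated[OF x_closed xt self that] comm_sym[of s x] by simp
  assume "r \<in> carrier R" "s \<in> carrier R"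
  then show ?thesis
    using t x comm_generated[of r 2 s] by blast
qed

text \<open>
  Here lies the gain of two steps in the filtration: squaring \<open>t + t\<^sup>2 + t\<^sup>3\<close> in characteristic two
  kills the mixed terms, so \<open>xt\<^sup>2 = (t\<^sup>2 + t\<^sup>4 + t\<^sup>6)x\<close> and \<open>t\<^sup>2\<close> commutes with \<open>x\<close> up to \<open>t\<^sup>4\<close>. For odd
  powers of \<open>t\<close> the gain is one step only, which is why the even ideals are used below.
\<close>

lemma comm_t2_x: "comm (t [^] (2::nat)) x = t [^] (4::nat) \<otimes> ((\<one> \<oplus> t [^] (2::nat)) \<otimes> x)"
proof -
  let ?w = "t \<oplus> t [^] (2::nat) \<oplus> t [^] (3::nat)"
  have p: "t [^] (2::nat) = t \<otimes> t" "t [^] (3::nat) = t \<otimes> (t \<otimes> t)"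
    by (simp_all add: numeral_eq_Suc m_assoc)
  have "x \<otimes> t [^] (2::nat) = (x \<otimes> t) \<otimes> t" by (simp add: numeral_2_eq_2 m_assoc)
  also have "\<dots> = ?w \<otimes> (x \<otimes> t)" by (simp add: x_t m_assoc)
  also have "\<dots> = (?w \<otimes> ?w) \<otimes> x" unfolding x_t by (simp add: m_assoc)
  also have "?w \<otimes> ?w = t \<otimes> t \<oplus> t \<otimes> (t \<otimes> (t \<otimes> t)) \<oplus> t \<otimes> (t \<otimes> (t \<otimes> (t \<otimes> (t \<otimes> t))))"
    by (simp add: p expand)
  finally have "comm (t [^] (2::nat)) x = t \<otimes> (t \<otimes> (t \<otimes> t)) \<otimes> x
      \<oplus> t \<otimes> (t \<otimes> (t \<otimes> (t \<otimes> (t \<otimes> t)))) \<otimes> x"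
    by (simp add: comm_def p expand)
  moreover have "t [^] (4::nat) = t \<otimes> (t \<otimes> (t \<otimes> t))"
    by (simp add: numeral_eq_Suc m_assoc)
  ultimately show ?thesis by (simp add: p l_distr r_distr m_assoc)
qed

text \<open>
  Since the commutator of \<open>t\<^sup>2\<close> and \<open>x\<close> lies in \<open>I 4\<close>, the product rule applied to \<open>t\<^sup>2 \<dots> t\<^sup>2\<close> replaces one factor
  \<open>t\<^sup>2\<close> by a multiple of \<open>t\<^sup>4\<close>.
\<close>

lemma comm_t_even: "s \<in> carrier R \<Longrightarrow> comm (t [^] (2 * k)) s \<in> I (2 * k + 2)"
proof (rule comm_generated)
  have "comm (t [^] (2 * k)) t = \<zero>"
    unfolding comm_def by (metis double m_closed nat_pow_closed nat_pow_Suc nat_pow_Suc2 t_closed)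
  then show "comm (t [^] (2 * k)) t \<in> I (2 * k + 2)" by (simp only: I_zero)
  have 4: "comm (t [^] (2::nat)) x \<in> I 4" unfolding comm_t2_x by (rule I_intro) auto
  have t2: "t [^] (2::nat) \<in> I 2" using I_intro[of \<one> 2] by simp
  show "comm (t [^] (2 * k)) x \<in> I (2 * k + 2)"
  proof (induction k)
    case 0
    then show ?case by (simp add: comm_def I_zero)
  next
    case (Suc k)
    have "2 * Suc k = 2 * k + 2" by simp
    then have "t [^] (2 * Suc k) = t [^] (2 * k) \<otimes> t [^] (2::nat)"
      by (simp only: nat_pow_mult t_closed)
    then have "comm (t [^] (2 * Suc k)) x
        = t [^] (2 * k) \<otimes> comm (t [^] (2::nat)) x \<oplus> comm (t [^] (2 * k)) x \<otimes> t [^] (2::nat)"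
      by (simp only: comm_mult_left t_closed x_closed nat_pow_closed)
    moreover have "t [^] (2 * k) \<otimes> comm (t [^] (2::nat)) x \<in> I (2 * k + 4)"
      using I_t[OF 4] .
    moreover have "comm (t [^] (2 * k)) x \<otimes> t [^] (2::nat) \<in> I (2 * k + 2 + 2)"
      using I_mult[OF Suc t2] .
    moreover have "2 * k + 4 = 2 * Suc k + 2" "2 * k + 2 + 2 = 2 * Suc k + 2" by simp_all
    ultimately show ?case by (simp only: I_add)
  qed
qed simp_all

lemma comm_I: "u \<in> I (2 * k) \<Longrightarrow> s \<in> carrier R \<Longrightarrow> comm u s \<in> I (2 * k + 2)"
proof -
  assume "u \<in> I (2 * k)" and s: "s \<in> carrier R"
  then obtain r where r: "r \<in> carrier R" "u = t [^] (2 * k) \<otimes> r" by (auto simp: I_def)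
  then have "comm u s = t [^] (2 * k) \<otimes> comm r s \<oplus> comm (t [^] (2 * k)) s \<otimes> r"
    using s by (simp add: comm_mult_left)
  moreover have "t [^] (2 * k) \<otimes> comm r s \<in> I (2 * k + 2)"
    using I_t[OF comm_I2[OF r(1) s]] .
  moreover have "comm (t [^] (2 * k)) s \<otimes> r \<in> I (2 * k + 2)"
    using I_right[OF comm_t_even[OF s] r(1)] .
  ultimately show ?thesis by (simp only: I_add)
qed

text \<open>
  One even step better than the previous lemma: if both factors are written as multiples of \<open>t\<^sup>2\<close>, the
  commutator of \<open>t\<^sup>2\<close> with itself drops out and an additional factor \<open>t\<^sup>2\<close> remains in front of every
  other term.
\<close>

lemma comm_I2_I2:
  assumes "u \<in> I 2" "v \<in> I 2"
  shows "comm u v \<in> I 6"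
proof -
  have t2: "comm (t [^] (2::nat)) s \<in> I 4" if "s \<in> carrier R" for s
    using comm_t_even[OF that, of 1] by simp
  obtain r where r: "r \<in> carrier R" "u = t [^] (2::nat) \<otimes> r" using assms by (auto simp: I_def)
  obtain s where s: "s \<in> carrier R" "v = t [^] (2::nat) \<otimes> s" using assms by (auto simp: I_def)
  have v: "v \<in> carrier R" using s by simp
  have "comm u v = t [^] (2::nat) \<otimes> comm r v \<oplus> comm (t [^] (2::nat)) v \<otimes> r"
    using r v by (simp add: comm_mult_left)
  moreover have "t [^] (2::nat) \<otimes> comm r v \<in> I 6"
    using comm_I[of v 1 r] I_t[of "comm r v" 4 2] assms r v comm_sym[of r v] by simp
  moreover have "comm (t [^] (2::nat)) v = t [^] (2::nat) \<otimes> comm (t [^] (2::nat)) s"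
    using s by (simp add: comm_mult_right) (simp add: comm_def)
  then have "comm (t [^] (2::nat)) v \<otimes> r \<in> I 6"
    using I_right[of _ 6 r] I_t[OF t2[OF s(1)], of 2] r by simp
  ultimately show ?thesis by (simp only: I_add)
qed

lemma I6_central: "u \<in> I 6 \<Longrightarrow> s \<in> carrier R \<Longrightarrow> u \<otimes> s = s \<otimes> u"
  using comm_I[of u 3 s] I_subset by (simp add: I_8 comm_def eq_iff_add_eq_zero)

text \<open>
  Modulo the commutative quotient by \<open>I 2\<close>, squaring is a ring homomorphism; it agrees with the square
  of the augmentation on scalars, on \<open>t\<close> and on \<open>x\<close>.
\<close>

lemma square_mod_I2: "u \<in> carrier R \<Longrightarrow> u \<otimes> u \<oplus> \<iota> (\<epsilon> u \<otimes>\<^bsub>F\<^esub> \<epsilon> u) \<in> I 2"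
proof -
  let ?P = "{u \<in> carrier R. u \<otimes> u \<oplus> \<iota> (\<epsilon> u \<otimes>\<^bsub>F\<^esub> \<epsilon> u) \<in> I 2}"
  have "carrier R \<subseteq> ?P"
  proof (rule generated)
    show "\<iota> ` carrier F \<subseteq> ?P"
      by (auto simp: aug_scalar scalar_mult I_zero)
    show "t \<in> ?P"
      using I_intro[of \<one> 2] by (simp add: aug_t scalar_zero numeral_2_eq_2)
    show "x \<in> ?P"
      by (simp add: aug_x scalar_one x_square I_zero)
  next
    fix r s assume rs: "r \<in> ?P" "s \<in> ?P"
    let ?e = "\<lambda>u. \<iota> (\<epsilon> u \<otimes>\<^bsub>F\<^esub> \<epsilon> u)"
    have e: "?e u \<in> carrier R" if "u \<in> carrier R" for u using that by auto
    have esum: "?e (r \<oplus> s) = ?e r \<oplus> ?e s"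
    proof -
      have "\<epsilon> (r \<oplus> s) \<otimes>\<^bsub>F\<^esub> \<epsilon> (r \<oplus> s) = \<epsilon> r \<otimes>\<^bsub>F\<^esub> \<epsilon> r \<oplus>\<^bsub>F\<^esub> \<epsilon> s \<otimes>\<^bsub>F\<^esub> \<epsilon> s
          \<oplus>\<^bsub>F\<^esub> (\<epsilon> r \<otimes>\<^bsub>F\<^esub> \<epsilon> s \<oplus>\<^bsub>F\<^esub> \<epsilon> r \<otimes>\<^bsub>F\<^esub> \<epsilon> s)"
        using rs by (simp add: aug_add F.l_distr F.r_distr F.a_ac F.m_comm)
      also have "\<dots> = \<epsilon> r \<otimes>\<^bsub>F\<^esub> \<epsilon> r \<oplus>\<^bsub>F\<^esub> \<epsilon> s \<otimes>\<^bsub>F\<^esub> \<epsilon> s"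
        using rs by (simp add: field_double)
      finally show ?thesis using rs by (simp add: scalar_add)
    qed
    have "(r \<oplus> s) \<otimes> (r \<oplus> s) \<oplus> ?e (r \<oplus> s) = (r \<otimes> r \<oplus> ?e r) \<oplus> (s \<otimes> s \<oplus> ?e s) \<oplus> comm r s"
      using rs e by (simp add: esum comm_def expand)
    then show "r \<oplus> s \<in> ?P"
      using rs I_add[OF I_add[of "r \<otimes> r \<oplus> ?e r" 2 "s \<otimes> s \<oplus> ?e s"] comm_I2[of r s]] by simp
    have eprod: "?e (r \<otimes> s) = ?e r \<otimes> ?e s"
      using rs by (simp add: aug_mult F.m_ac flip: scalar_mult)
    have "(r \<otimes> s) \<otimes> (r \<otimes> s) \<oplus> ?e (r \<otimes> s)
        = r \<otimes> comm s r \<otimes> s \<oplus> (r \<otimes> r \<oplus> ?e r) \<otimes> (s \<otimes> s) \<oplus> ?e r \<otimes> (s \<otimes> s \<oplus> ?e s)"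
      using rs e by (simp add: eprod comm_def expand)
    moreover have "r \<otimes> comm s r \<otimes> s \<in> I 2"
      using rs by (simp add: I_left I_right comm_I2)
    moreover have "(r \<otimes> r \<oplus> ?e r) \<otimes> (s \<otimes> s) \<in> I 2" "?e r \<otimes> (s \<otimes> s \<oplus> ?e s) \<in> I 2"
      using rs e by (simp_all add: I_left I_right)
    ultimately show "r \<otimes> s \<in> ?P"
      using rs by (simp add: I_add)
  qed
  then show "u \<in> carrier R \<Longrightarrow> u \<otimes> u \<oplus> \<iota> (\<epsilon> u \<otimes>\<^bsub>F\<^esub> \<epsilon> u) \<in> I 2" by blast
qed

lemma aug_zero_nilpotent:
  assumes "u \<in> carrier R" "\<epsilon> u = \<zero>\<^bsub>F\<^esub>"
  shows "u [^] (8::nat) = \<zero>"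
proof -
  have 2: "u [^] (2::nat) \<in> I 2"
    using square_mod_I2[of u] assms by (simp add: scalar_zero numeral_2_eq_2)
  have "u [^] (2::nat) \<otimes> u [^] (2::nat) \<otimes> (u [^] (2::nat) \<otimes> u [^] (2::nat)) \<in> I 8"
    using I_mult[OF I_mult[OF 2 2] I_mult[OF 2 2]] by simp
  then show ?thesis using assms by (simp add: nat_pow_mult I_8)
qed

lemma aug_one_pow_8:
  assumes "u \<in> carrier R" "\<epsilon> u = \<one>\<^bsub>F\<^esub>"
  shows "u [^] (8::nat) = \<one>"
proof -
  have sq: "(\<one> \<oplus> v) \<otimes> (\<one> \<oplus> v) = \<one> \<oplus> v \<otimes> v" if "v \<in> carrier R" for v
    using that by (simp add: expand)
  define v where "v = \<one> \<oplus> u"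
  have v: "v \<in> carrier R" "u = \<one> \<oplus> v" "\<epsilon> v = \<zero>\<^bsub>F\<^esub>"
    using assms by (simp_all add: v_def aug_add aug_one field_double)
  have pow8: "w [^] (8::nat) = (w \<otimes> w) \<otimes> (w \<otimes> w) \<otimes> ((w \<otimes> w) \<otimes> (w \<otimes> w))" if "w \<in> carrier R" for w
    using that by (simp add: numeral_eq_Suc m_assoc)
  have "u [^] (8::nat) = \<one> \<oplus> v [^] (8::nat)"
    using v by (simp add: pow8 sq)
  then show ?thesis using aug_zero_nilpotent[of v] v by simp
qed

lemma aug_one_Units:
  assumes "u \<in> carrier R" "\<epsilon> u = \<one>\<^bsub>F\<^esub>"
  shows "u \<in> Units R"
proof -
  have "u [^] Suc 7 = \<one>" using aug_one_pow_8[OF assms] by simp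
  then have "u [^] (7::nat) \<otimes> u = \<one>" "u \<otimes> u [^] (7::nat) = \<one>"
    using assms(1) by (simp only: nat_pow_Suc, simp only: nat_pow_Suc2)
  then show ?thesis using assms(1) unfolding Units_def by blast
qed

lemma Units_iff: "u \<in> Units R \<longleftrightarrow> u \<in> carrier R \<and> \<epsilon> u \<noteq> \<zero>\<^bsub>F\<^esub>"
proof
  assume u: "u \<in> Units R"
  then have "\<epsilon> u \<otimes>\<^bsub>F\<^esub> \<epsilon> (inv u) = \<one>\<^bsub>F\<^esub>"
    by (metis Units_closed Units_inv_closed Units_r_inv aug_mult aug_one)
  then show "u \<in> carrier R \<and> \<epsilon> u \<noteq> \<zero>\<^bsub>F\<^esub>"
    using u by auto
next
  assume u: "u \<in> carrier R \<and> \<epsilon> u \<noteq> \<zero>\<^bsub>F\<^esub>"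
  define c where "c = \<epsilon> u"
  have c: "c \<in> Units F" using u by (simp add: c_def F.field_Units)
  have \<iota>c: "\<iota> c \<in> Units R"
  proof -
    have "\<iota> (inv\<^bsub>F\<^esub> c) \<otimes> \<iota> c = \<one>" "\<iota> c \<otimes> \<iota> (inv\<^bsub>F\<^esub> c) = \<one>"
      using c scalar_mult[of c "inv\<^bsub>F\<^esub> c"] scalar_mult[of "inv\<^bsub>F\<^esub> c" c]
      by (simp_all add: scalar_one F.Units_closed)
    then show ?thesis unfolding Units_def using c F.Units_closed F.Units_inv_closed by blast
  qed
  have "\<iota> (inv\<^bsub>F\<^esub> c) \<otimes> u \<in> Units R"
    using u c by (intro aug_one_Units) (auto simp: aug_mult aug_scalar c_def[symmetric])
  then have "\<iota> c \<otimes> (\<iota> (inv\<^bsub>F\<^esub> c) \<otimes> u) \<in> Units R"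
    using \<iota>c by blast
  also have "\<iota> c \<otimes> (\<iota> (inv\<^bsub>F\<^esub> c) \<otimes> u) = u"
    using u c scalar_mult[of c "inv\<^bsub>F\<^esub> c", symmetric]
    by (simp add: scalar_one F.Units_closed flip: m_assoc)
  finally show "u \<in> Units R" .
qed

end

section \<open>The elements of augmentation one\<close>

context qd_char2
begin

abbreviation (input) \<Delta> where "\<Delta> \<equiv> {u \<in> carrier R. \<epsilon> u = \<zero>\<^bsub>F\<^esub>}"
abbreviation (input) V where "V \<equiv> {u \<in> carrier R. \<epsilon> u = \<one>\<^bsub>F\<^esub>}"
abbreviation (input) U where "U \<equiv> units_of R"
abbreviation (input) VG where "VG \<equiv> U\<lparr>carrier := V\<rparr>"

text \<open>
  The elements outside the augmentation ideal are units, so a proper left ideal is contained in it: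
  the ring is local.
\<close>

lemma maximal_left_ideal_iff: "maximal_left_ideal M R \<longleftrightarrow> M = \<Delta>"
proof -
  have "ideal \<Delta> R"
    using ring_hom_ring.kernel_is_ideal[OF ring_hom_ringI2[OF ring_axioms F.ring_axioms aug_hom]]
    by (simp add: a_kernel_def')
  then have left: "left_ideal \<Delta> R"
    unfolding left_ideal_def by (simp add: ideal.axioms(1) aug_mult)
  have proper: "\<Delta> \<noteq> carrier R"
    using aug_one by force
  have sub: "M \<subseteq> \<Delta>" if M: "left_ideal M R" "M \<noteq> carrier R" for M
  proof
    fix u assume u: "u \<in> M"
    have MR: "M \<subseteq> carrier R"
      using M(1) additive_subgroup.a_subset unfolding left_ideal_def by metis
    have "u \<notin> Units R"
    proof
      assume unit: "u \<in> Units R"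
      have "r \<in> M" if r: "r \<in> carrier R" for r
      proof -
        have "r \<otimes> inv u \<otimes> u \<in> M"
          using M(1) u r unit unfolding left_ideal_def by (metis m_closed Units_inv_closed)
        then show ?thesis using r unit by (simp add: m_assoc Units_closed)
      qed
      then show False using MR M(2) by blast
    qed
    then show "u \<in> \<Delta>" using u MR Units_iff by blast
  qed
  show ?thesis
  proof
    assume "maximal_left_ideal M R"
    then show "M = \<Delta>"
      using left proper sub[of M] unfolding maximal_left_ideal_def by metis
  next
    assume "M = \<Delta>"
    then show "maximal_left_ideal M R"
      using left proper sub unfolding maximal_left_ideal_def by (metis subset_antisym)
  qed
qed

lemma one_plus_jacobson_eq: "one_plus_jacobson R = V"
proof -
  have "jacobson_radical R = \<Delta>"
    by (auto simp: jacobson_radical_def maximal_left_ideal_iff)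
  moreover have "u \<in> {\<one> \<oplus> r | r. r \<in> \<Delta>}" if "u \<in> V" for u
    using that by (auto simp: aug_add aug_one field_double intro!: exI[of _ "\<one> \<oplus> u"])
  ultimately show ?thesis
    by (auto simp: one_plus_jacobson_def aug_add aug_one)
qed

text \<open>
  An element is determined by its augmentation and its component of augmentation zero.
\<close>

lemma card_V: "card V * card (carrier F) = card (carrier R)"
proof -
  have "bij_betw (\<lambda>u. (\<epsilon> u, u \<oplus> \<iota> (\<epsilon> u))) (carrier R) (carrier F \<times> \<Delta>)"
    by (rule bij_betw_byWitness[where f' = "\<lambda>(c, v). \<iota> c \<oplus> v"])
       (auto simp: aug_add aug_scalar field_double a_ac)
  then have "card (carrier R) = card (carrier F) * card \<Delta>"
    by (simp add: bij_betw_same_card card_cartesian_product)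
  moreover have "bij_betw (\<lambda>u. \<one> \<oplus> u) V \<Delta>"
    by (rule bij_betw_byWitness[where f' = "\<lambda>u. \<one> \<oplus> u"])
       (auto simp: aug_add aug_one field_double)
  ultimately show ?thesis by (simp add: bij_betw_same_card)
qed

lemma aug_group_hom: "group_hom U (units_of F) \<epsilon>"
proof (intro group_hom.intro group_hom_axioms.intro units_group F.units_group homI)
  show "\<epsilon> u \<in> carrier (units_of F)" if "u \<in> carrier U" for u
    using that by (auto simp: units_of_carrier Units_iff F.field_Units)
qed (auto simp: units_of_carrier units_of_mult aug_mult Units_iff)

lemma kernel_aug: "kernel U (units_of F) \<epsilon> = V"
  by (auto simp: kernel_def units_of_carrier units_of_one Units_iff)

lemma V_normal: "V \<lhd> U"
  using group_hom.normal_kernel[OF aug_group_hom] by (simp add: kernel_aug)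

lemma V_subgroup: "subgroup V U"
  using V_normal by (rule normal_imp_subgroup)

lemma U_Mod_V: "U Mod V \<cong> units_of F"
proof -
  have "\<epsilon> ` carrier U = carrier (units_of F)"
  proof
    show "carrier (units_of F) \<subseteq> \<epsilon> ` carrier U"
    proof
      fix c assume "c \<in> carrier (units_of F)"
      then have "\<iota> c \<in> carrier U" "\<epsilon> (\<iota> c) = c"
        by (auto simp: units_of_carrier Units_iff aug_scalar F.field_Units)
      then show "c \<in> \<epsilon> ` carrier U" by (metis imageI)
    qed
  qed (use group_hom.hom_closed[OF aug_group_hom] in auto)
  then show ?thesis
    using group_hom.FactGroup_iso[OF aug_group_hom] by (simp add: kernel_aug)
qed

lemma group_VG: "group VG"
  using subgroup.subgroup_is_group[OF V_subgroup units_group] .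

declare units_of_mult [simp] units_of_one [simp]

lemma VG_simps [simp]:
  "carrier VG = V" "u \<otimes>\<^bsub>VG\<^esub> v = u \<otimes> v" "\<one>\<^bsub>VG\<^esub> = \<one>"
  by (simp_all add: units_of_def)

lemma V_Units: "u \<in> V \<Longrightarrow> u \<in> Units R"
  using aug_one_Units by blast

lemma inv_VG: "u \<in> V \<Longrightarrow> inv\<^bsub>VG\<^esub> u = inv u"
  using group.m_inv_consistent[OF units_group V_subgroup] V_Units units_of_inv by simp

lemma V_inv: "u \<in> V \<Longrightarrow> inv u \<in> V"
  using group.inv_closed[OF group_VG, of u] by (simp only: inv_VG VG_simps)

lemma V_mult: "u \<in> V \<Longrightarrow> v \<in> V \<Longrightarrow> u \<otimes> v \<in> V"
  by (simp add: aug_mult)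

lemma V_r_inv: "u \<in> V \<Longrightarrow> u \<otimes> inv u = \<one>" and V_l_inv: "u \<in> V \<Longrightarrow> inv u \<otimes> u = \<one>"
  using V_Units Units_r_inv Units_l_inv by blast+

lemma pow_VG: "u [^]\<^bsub>VG\<^esub> (n::nat) = u [^] n"
  by (induction n) simp_all

lemma p_group_VG: "p_group 2 VG"
  unfolding p_group_def
proof (intro conjI ballI group_VG)
  fix u assume "u \<in> carrier VG"
  then have u: "u \<in> V" by (simp only: VG_simps)
  have "u [^]\<^bsub>VG\<^esub> (8::nat) = \<one>\<^bsub>VG\<^esub>"
    unfolding pow_VG using u aug_one_pow_8 by simp
  then have "group.ord VG u dvd 2 ^ 3"
    using group.pow_eq_id[OF group_VG, of u 8] u by simp
  then show "\<exists>k. group.ord VG u = 2 ^ k"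
    using divides_primepow_nat[OF two_is_prime_nat] by blast
qed

lemma one_t_in_V: "\<one> \<oplus> t \<in> V"
  by (simp add: aug_add aug_one aug_t)

lemma one_t_pow_4: "(\<one> \<oplus> t) [^] (4::nat) \<noteq> \<one>"
proof
  assume "(\<one> \<oplus> t) [^] (4::nat) = \<one>"
  moreover have "(\<one> \<oplus> t) [^] (4::nat) = \<one> \<oplus> t [^] (4::nat)"
    by (simp add: numeral_eq_Suc expand)
  ultimately have "t [^] (4::nat) = \<zero>"
    by (metis nat_pow_closed t_closed one_closed cancel double)
  then have "t [^] (4::nat) \<otimes> t [^] (3::nat) = \<zero>" by simp
  then show False using t7 by (simp add: nat_pow_mult)
qed

text \<open>
  The element \<open>a = 1 + t\<close> has order 8, as \<open>a\<^sup>4 = 1 + t\<^sup>4\<close>.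
\<close>

lemma exponent_VG: "group_exponent VG = 8"
  unfolding group_exponent_def
proof (rule Least_equality)
  show "0 < (8::nat) \<and> (\<forall>u\<in>carrier VG. u [^]\<^bsub>VG\<^esub> (8::nat) = \<one>\<^bsub>VG\<^esub>)"
    unfolding pow_VG using aug_one_pow_8 by simp
  fix e :: nat assume e: "0 < e \<and> (\<forall>u\<in>carrier VG. u [^]\<^bsub>VG\<^esub> e = \<one>\<^bsub>VG\<^esub>)"
  let ?o = "group.ord VG (\<one> \<oplus> t)"
  have a: "\<one> \<oplus> t \<in> carrier VG" using one_t_in_V by (simp only: VG_simps)
  have dvd: "?o dvd k \<longleftrightarrow> (\<one> \<oplus> t) [^] k = \<one>" for k
    using group.pow_eq_id[OF group_VG a, of k] unfolding pow_VG by (simp only: VG_simps)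
  have "?o dvd 8" using aug_one_pow_8 one_t_in_V by (simp add: dvd)
  moreover have "\<not> ?o dvd 4" using one_t_pow_4 by (simp add: dvd)
  moreover obtain i where i: "i \<le> 3" "?o = 2 ^ i"
    using \<open>?o dvd 8\<close> divides_primepow_nat[OF two_is_prime_nat, of ?o 3] by auto
  moreover have "i > 2"
  proof (rule ccontr)
    assume "\<not> i > 2"
    then have "?o dvd 2 ^ 2" unfolding i(2) by (intro le_imp_power_dvd) simp
    then show False using \<open>\<not> ?o dvd 4\<close> by simp
  qed
  ultimately have "?o = 2 ^ 3" by (metis Suc_leI le_antisym eval_nat_numeral(3))
  then have "?o = 8" by simp
  moreover have "?o dvd e" unfolding dvd using e a pow_VG VG_simps by metis
  ultimately show "8 \<le> e" using e dvd_imp_le by auto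
qed

text \<open>
  For positive \<open>k\<close> this is \<open>1 + I k\<close>; the intersection with \<open>V\<close> lets the series start at \<open>W 0 = V\<close>.
\<close>

definition W where "W k = {u \<in> V. u \<oplus> \<one> \<in> I k}"

lemma W_subgroup: "subgroup (W k) VG"
proof (rule group.subgroupI[OF group_VG])
  show "W k \<subseteq> carrier VG" by (auto simp: W_def)
  have "\<one> \<in> W k" by (simp add: W_def aug_one I_zero)
  then show "W k \<noteq> {}" by blast
  fix u assume u: "u \<in> W k"
  then have uV: "u \<in> V" by (simp add: W_def)
  have "inv u \<oplus> \<one> = inv u \<otimes> (u \<oplus> \<one>)"
    using uV V_inv[OF uV] by (simp add: r_distr V_l_inv[OF uV] a_comm)
  then show "inv\<^bsub>VG\<^esub> u \<in> W k"
    using u V_inv[OF uV] by (simp add: W_def inv_VG[OF uV] I_left)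
  fix v assume v: "v \<in> W k"
  have "u \<otimes> v \<oplus> \<one> = u \<otimes> (v \<oplus> \<one>) \<oplus> (u \<oplus> \<one>)"
    using u v by (simp add: W_def r_distr a_ac)
  then show "u \<otimes>\<^bsub>VG\<^esub> v \<in> W k"
    using u v by (simp add: W_def V_mult aug_mult I_add I_left)
qed

lemma commutator_VG: "g \<in> V \<Longrightarrow> h \<in> V \<Longrightarrow> commutator VG g h = inv g \<otimes> inv h \<otimes> g \<otimes> h"
  by (simp add: commutator_def inv_VG)

text \<open>
  The link between the two kinds of commutators:
  \<open>g\<^sup>-\<^sup>1h\<^sup>-\<^sup>1gh = 1 + g\<^sup>-\<^sup>1h\<^sup>-\<^sup>1(gh + hg)\<close>.
\<close>

lemma commutator_in_W:
  assumes g: "g \<in> V" and h: "h \<in> V" and "comm g h \<in> I k"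
  shows "commutator VG g h \<in> W k"
proof -
  have [simp]: "inv g \<in> carrier R" "inv h \<in> carrier R" "g \<in> carrier R" "h \<in> carrier R"
    using V_inv g h by auto
  have "inv g \<otimes> inv h \<otimes> (h \<otimes> g) = inv g \<otimes> (inv h \<otimes> h) \<otimes> g"
    by (simp add: m_assoc)
  also have "\<dots> = \<one>"
    using g h by (simp add: V_l_inv)
  finally have "inv g \<otimes> inv h \<otimes> comm g h = inv g \<otimes> inv h \<otimes> (g \<otimes> h) \<oplus> \<one>"
    by (simp add: comm_def r_distr)
  also have "inv g \<otimes> inv h \<otimes> (g \<otimes> h) = commutator VG g h"
    using g h by (simp add: commutator_VG m_assoc)
  finally have "commutator VG g h \<oplus> \<one> \<in> I k"
    using assms(3) by (metis I_left m_closed \<open>inv g \<in> carrier R\<close> \<open>inv h \<in> carrier R\<close>)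
  moreover have "commutator VG g h \<in> V"
    using V_mult[OF V_mult[OF V_mult[OF V_inv[OF g] V_inv[OF h]] g] h]
    by (simp only: commutator_VG[OF g h])
  ultimately show ?thesis by (simp add: W_def)
qed

lemma comm_plus_one: "g \<in> carrier R \<Longrightarrow> h \<in> carrier R \<Longrightarrow> comm (g \<oplus> \<one>) h = comm g h"
  by (simp add: comm_def expand)

lemma W_8: "W 8 = {\<one>}"
  by (auto simp: W_def I_8 aug_one eq_iff_add_eq_zero)

text \<open>
  Each commutator moves two steps down the filtration; since \<open>I 8\<close> vanishes, the fifth term is trivial.
\<close>

lemma lower_central_W: "lower_central VG (Suc c) \<subseteq> W (2 * c)"
proof (induction c)
  case 0
  then show ?case by (auto simp: W_def I_0)
next
  case (Suc c)
  show ?case unfolding lower_central.simps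
  proof (rule group.generate_subgroup_incl[OF group_VG _ W_subgroup], safe)
    fix g h assume "g \<in> lower_central VG (Suc c)" "h \<in> carrier VG"
    then have g: "g \<in> V" "g \<oplus> \<one> \<in> I (2 * c)" and h: "h \<in> V"
      using Suc by (auto simp: W_def)
    have "comm g h \<in> I (2 * Suc c)"
      using comm_I[OF g(2), of h] g h by (simp add: comm_plus_one)
    then show "commutator VG g h \<in> W (2 * Suc c)"
      by (rule commutator_in_W[OF g(1) h])
  qed
qed

text \<open>
  With \<open>p = t\<^sup>4 + t\<^sup>6\<close> one has \<open>xt\<^sup>2 = (t\<^sup>2 + p)x\<close>, and \<open>(t\<^sup>2 + p)\<^sup>2 = t\<^sup>4\<close> because \<open>p\<^sup>2\<close> is divisible
  by \<open>t\<^sup>8\<close>. The filtration alone would only put the commutators of \<open>t\<^sup>4\<close> into \<open>I 6\<close>.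
\<close>

lemma t4_central:
  assumes "s \<in> carrier R"
  shows "t [^] (4::nat) \<otimes> s = s \<otimes> t [^] (4::nat)"
proof -
  define p where "p = t [^] (4::nat) \<oplus> t [^] (6::nat)"
  have p [simp]: "p \<in> carrier R" by (simp add: p_def)
  have D: "comm (t [^] (2::nat)) x = p \<otimes> x"
    unfolding comm_t2_x by (simp add: p_def nat_pow_mult l_distr r_distr flip: m_assoc)
  have "x \<otimes> t [^] (2::nat) = t [^] (2::nat) \<otimes> x \<oplus> comm (t [^] (2::nat)) x"
    by (simp add: comm_def)
  then have xt: "x \<otimes> t [^] (2::nat) = t [^] (2::nat) \<otimes> x \<oplus> p \<otimes> x" by (simp only: D)
  have big: "t [^] k = \<zero>" if "k \<ge> 8" for k :: nat
  proof -
    have "t [^] k = t [^] (8::nat) \<otimes> t [^] (k - 8)"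
      using that by (simp add: nat_pow_mult)
    then show ?thesis by (simp add: t8)
  qed
  have pp: "p \<otimes> p = \<zero>"
    by (simp add: p_def l_distr r_distr nat_pow_mult big)
  have pt: "t [^] (2::nat) \<otimes> p = p \<otimes> t [^] (2::nat)"
    by (simp add: p_def l_distr r_distr nat_pow_mult)
  have "comm (t [^] (4::nat)) x = comm (t [^] (2::nat) \<otimes> t [^] (2::nat)) x"
    by (simp add: nat_pow_mult)
  also have "\<dots> = t [^] (2::nat) \<otimes> (p \<otimes> x) \<oplus> p \<otimes> (x \<otimes> t [^] (2::nat))"
    by (simp only: comm_mult_left D t_closed x_closed nat_pow_closed m_assoc p)
  also have "\<dots> = t [^] (2::nat) \<otimes> p \<otimes> x \<oplus> (p \<otimes> t [^] (2::nat) \<otimes> x \<oplus> p \<otimes> p \<otimes> x)"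
    unfolding xt by (simp only: r_distr m_assoc t_closed x_closed nat_pow_closed p m_closed)
  also have "\<dots> = \<zero>"
    unfolding pt pp by simp
  finally have "comm (t [^] (4::nat)) x = \<zero>" .
  moreover have "comm (t [^] (4::nat)) t = \<zero>"
    unfolding comm_def by (metis double m_closed nat_pow_closed nat_pow_Suc nat_pow_Suc2 t_closed)
  ultimately have "comm (t [^] (4::nat)) s \<in> I 8"
    using assms by (intro comm_generated[of _ 8 s]) (simp_all add: I_zero)
  then show ?thesis
    using assms by (simp add: I_8 comm_def eq_iff_add_eq_zero)
qed

lemma (in group) commutator_eq_one:
  assumes "g \<in> carrier G" "h \<in> carrier G" "commutator G g h = \<one>"
  shows "g \<otimes> h = h \<otimes> g"
proof -
  have "inv (h \<otimes> g) \<otimes> (g \<otimes> h) = \<one>"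
    using assms by (simp add: commutator_def inv_mult_group m_assoc)
  then show ?thesis
    using assms by (metis inv_closed inv_comm inv_equality inv_inv m_closed)
qed

text \<open>
  The first commutator is \<open>(a, x) = a\<^sup>2\<close>. With \<open>h = 1 + a + x = t + x\<close> and \<open>D = t\<^sup>4a\<^sup>2x\<close>, the commutator
  of \<open>t\<^sup>2\<close> and \<open>x\<close>, conjugation of \<open>a\<^sup>2\<close> by \<open>h\<close> gives \<open>a\<^sup>2 + h\<^sup>-\<^sup>1D\<close>. So if \<open>((a, x), h)\<close> commuted with \<open>a\<close>,
  then so would \<open>h\<^sup>-\<^sup>1D\<close>; clearing \<open>h\<^sup>-\<^sup>1\<close>, which is possible because \<open>t\<^sup>4\<close> is central, leaves
  \<open>t\<^sup>4(a\<^sup>3h + ha) = t\<^sup>7a\<close>, which is not zero.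
\<close>

lemma lower_central_4: "lower_central VG 4 \<noteq> {\<one>}"
proof
  assume trivial: "lower_central VG 4 = {\<one>}"
  define a where "a = \<one> \<oplus> t"
  define h where "h = t \<oplus> x"
    have a: "a \<in> V" and h: "h \<in> V" and x: "x \<in> V"
    using one_t_in_V by (simp_all add: a_def h_def aug_add aug_t aug_x)
  note aR [simp] = a[THEN CollectD, THEN conjunct1] h[THEN CollectD, THEN conjunct1]
  have ai [simp]: "inv a \<in> carrier R" "inv h \<in> carrier R"
    using V_inv a h by auto
  have xa: "x \<otimes> a = a \<otimes> (a \<otimes> (a \<otimes> x))"
    unfolding a_def by (simp add: r_distr x_t) (simp add: expand numeral_eq_Suc)
  have xa': "x \<otimes> (a \<otimes> r) = a \<otimes> (a \<otimes> (a \<otimes> (x \<otimes> r)))" if "r \<in> carrier R" for r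
    using that by (metis xa m_assoc aR(1) x_closed m_closed)
  have inv_x: "inv x = x"
    using x_square by (simp add: inv_unique' inv_char)
  define c1 where "c1 = commutator VG a x"
  define c2 where "c2 = commutator VG c1 h"
  have "c1 = inv a \<otimes> (x \<otimes> a) \<otimes> x"
    by (simp add: c1_def commutator_VG[OF a x] inv_x m_assoc)
  also have "\<dots> = (inv a \<otimes> a) \<otimes> (a \<otimes> a) \<otimes> (x \<otimes> x)"
    by (simp add: xa m_assoc)
  finally have c1: "c1 = a \<otimes> a" by (simp add: x_square V_l_inv[OF a])
  have gen: "commutator VG g k \<in> lower_central VG (Suc (Suc c))"
    if "g \<in> lower_central VG (Suc c)" "k \<in> V" for g k c
    using that by (auto intro!: generate.incl)
  have mem: "commutator VG c2 a \<in> lower_central VG 4"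
    using gen[OF gen[OF gen[of a 0 x] h] a] a x by (simp add: c1_def c2_def numeral_eq_Suc)
  have c1V: "c1 \<in> V" using a by (simp add: c1 V_mult aug_mult)
  have c2V: "c2 \<in> V"
    unfolding c2_def commutator_VG[OF c1V h]
    by (intro V_mult V_inv c1V h)
  have comm2: "c2 \<otimes> a = a \<otimes> c2"
    using group.commutator_eq_one[OF group_VG, of c2 a] trivial mem c2V a by simp
  define D where "D = comm (t [^] (2::nat)) x"
  have D: "D = t [^] (4::nat) \<otimes> (a \<otimes> a \<otimes> x)"
  proof -
    have "\<one> \<oplus> t [^] (2::nat) = a \<otimes> a" by (simp add: a_def expand numeral_2_eq_2)
    then show ?thesis by (simp add: D_def comm_t2_x)
  qed
  have [simp]: "D \<in> carrier R" by (simp add: D_def)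
  have aa: "a \<otimes> a = \<one> \<oplus> t [^] (2::nat)" by (simp add: a_def expand numeral_2_eq_2)
  have t2h: "t [^] (2::nat) \<otimes> h = h \<otimes> t [^] (2::nat) \<oplus> D"
    by (simp add: h_def D_def comm_def expand numeral_2_eq_2)
  have "c1 \<otimes> c2 = inv h \<otimes> (c1 \<otimes> h)"
    using c1V V_inv[OF c1V] by (simp add: c2_def commutator_VG[OF c1V h] V_r_inv[OF c1V] flip: m_assoc)
  also have "c1 \<otimes> h = h \<oplus> (h \<otimes> t [^] (2::nat) \<oplus> D)"
    by (simp add: c1 aa l_distr t2h)
  also have "inv h \<otimes> \<dots> = a \<otimes> a \<oplus> inv h \<otimes> D"
    by (simp add: r_distr V_l_inv[OF h] aa a_assoc flip: m_assoc)
  finally have c12: "c1 \<otimes> c2 = a \<otimes> a \<oplus> inv h \<otimes> D" .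
  have "(c1 \<otimes> c2) \<otimes> a = a \<otimes> (c1 \<otimes> c2)"
    using comm2 c2V by (simp add: c1 m_assoc)
  then have "a \<otimes> (a \<otimes> a) \<oplus> inv h \<otimes> D \<otimes> a = a \<otimes> (a \<otimes> a) \<oplus> a \<otimes> (inv h \<otimes> D)"
    by (simp add: c12 l_distr r_distr m_assoc)
  then have Da: "inv h \<otimes> D \<otimes> a = a \<otimes> (inv h \<otimes> D)"
    by (simp add: add.l_cancel)
  let ?t4 = "t [^] (4::nat)"
  have "?t4 \<otimes> (inv h \<otimes> a \<otimes> a \<otimes> a) \<otimes> (a \<otimes> a \<otimes> x) = inv h \<otimes> D \<otimes> a"
    by (simp add: D m_assoc xa xa' t4_central)
  also have "\<dots> = ?t4 \<otimes> (a \<otimes> inv h) \<otimes> (a \<otimes> a \<otimes> x)"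
    unfolding Da by (simp add: D m_assoc t4_central)
  finally have "?t4 \<otimes> (inv h \<otimes> a \<otimes> a \<otimes> a) \<otimes> ((a \<otimes> a \<otimes> x) \<otimes> (x \<otimes> inv a \<otimes> inv a))
      = ?t4 \<otimes> (a \<otimes> inv h) \<otimes> ((a \<otimes> a \<otimes> x) \<otimes> (x \<otimes> inv a \<otimes> inv a))"
    by (simp flip: m_assoc)
  moreover have "(a \<otimes> a \<otimes> x) \<otimes> (x \<otimes> inv a \<otimes> inv a) = a \<otimes> (a \<otimes> (x \<otimes> x) \<otimes> inv a) \<otimes> inv a"
    by (simp add: m_assoc)
  ultimately have "?t4 \<otimes> (inv h \<otimes> a \<otimes> a \<otimes> a) = ?t4 \<otimes> (a \<otimes> inv h)"
    by (simp add: x_square V_r_inv[OF a])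
  then have "h \<otimes> (?t4 \<otimes> (inv h \<otimes> a \<otimes> a \<otimes> a)) \<otimes> h = h \<otimes> (?t4 \<otimes> (a \<otimes> inv h)) \<otimes> h"
    by simp
  moreover have "h \<otimes> (?t4 \<otimes> (inv h \<otimes> a \<otimes> a \<otimes> a)) \<otimes> h = ?t4 \<otimes> ((h \<otimes> inv h) \<otimes> (a \<otimes> a \<otimes> a \<otimes> h))"
    using t4_central[of h] by (simp flip: m_assoc)
  moreover have "h \<otimes> (?t4 \<otimes> (a \<otimes> inv h)) \<otimes> h = ?t4 \<otimes> (h \<otimes> a \<otimes> (inv h \<otimes> h))"
    using t4_central[of h] by (simp flip: m_assoc)
  ultimately have "?t4 \<otimes> (a \<otimes> a \<otimes> a \<otimes> h) = ?t4 \<otimes> (h \<otimes> a)"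
    by (simp add: V_r_inv[OF h] V_l_inv[OF h])
  then have "?t4 \<otimes> (a \<otimes> a \<otimes> a \<otimes> h \<oplus> h \<otimes> a) = \<zero>"
    by (simp add: r_distr)
  moreover have "a \<otimes> a \<otimes> a \<otimes> h \<oplus> h \<otimes> a = t [^] (3::nat) \<otimes> a"
  proof -
    have "h \<otimes> a = t \<otimes> a \<oplus> a \<otimes> (a \<otimes> (a \<otimes> x))" by (simp add: h_def l_distr xa)
    then have "a \<otimes> a \<otimes> a \<otimes> h \<oplus> h \<otimes> a = a \<otimes> (a \<otimes> (a \<otimes> t)) \<oplus> t \<otimes> a"
      by (simp add: h_def expand)
    also have "\<dots> = t [^] (3::nat) \<otimes> a"
      by (simp add: a_def expand numeral_eq_Suc)
    finally show ?thesis .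
  qed
  ultimately have "?t4 \<otimes> t [^] (3::nat) \<otimes> a = \<zero>"
    by (simp add: m_assoc)
  then have "?t4 \<otimes> t [^] (3::nat) \<otimes> (a \<otimes> inv a) = \<zero>"
    by (simp flip: m_assoc)
  then show False using t7 by (simp add: V_r_inv[OF a] nat_pow_mult)
qed

lemma nilpotent_VG: "nilpotent_of_class VG 4"
proof -
  have "lower_central VG (Suc 4) \<subseteq> {\<one>}"
    using lower_central_W[of 4] W_8 by simp
  moreover have "\<one> \<in> lower_central VG (Suc (Suc 3))"
    using generate.one[of VG] by (simp only: lower_central.simps VG_simps)
  ultimately show ?thesis
    unfolding nilpotent_of_class_def using lower_central_4 by auto
qed

text \<open>
  The derived subgroup is generated by the products \<open>ghg\<^sup>-\<^sup>1h\<^sup>-\<^sup>1\<close>, for which the additive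
  commutator is multiplied from the other side.
\<close>

lemma derived_subset_W:
  assumes H: "H \<subseteq> V" and "\<And>g h. g \<in> H \<Longrightarrow> h \<in> H \<Longrightarrow> comm g h \<in> I k"
  shows "derived VG H \<subseteq> W k"
  unfolding derived_def
proof (rule group.generate_subgroup_incl[OF group_VG _ W_subgroup], clarify)
  fix g h assume gh: "g \<in> H" "h \<in> H"
  then have V: "g \<in> V" "h \<in> V" using H by auto
  have [simp]: "inv g \<in> carrier R" "inv h \<in> carrier R" "g \<in> carrier R" "h \<in> carrier R"
    using V_inv V by auto
  have "h \<otimes> g \<otimes> (inv g \<otimes> inv h) = h \<otimes> (g \<otimes> inv g) \<otimes> inv h"
    by (simp add: m_assoc)
  also have "\<dots> = \<one>"
    by (simp add: V_r_inv[OF V(1)] V_r_inv[OF V(2)])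
  finally have "comm g h \<otimes> (inv g \<otimes> inv h) = g \<otimes> h \<otimes> inv g \<otimes> inv h \<oplus> \<one>"
    by (simp add: comm_def l_distr m_assoc)
  moreover have "comm g h \<otimes> (inv g \<otimes> inv h) \<in> I k"
    using assms(2)[OF gh] by (rule I_right) simp
  moreover have "g \<otimes> h \<otimes> inv g \<otimes> inv h \<in> V"
    by (intro V_mult V_inv V)
  ultimately have "g \<otimes> h \<otimes> inv g \<otimes> inv h \<in> W k"
    by (simp add: W_def)
  then show "g \<otimes>\<^bsub>VG\<^esub> h \<otimes>\<^bsub>VG\<^esub> inv\<^bsub>VG\<^esub> g \<otimes>\<^bsub>VG\<^esub> inv\<^bsub>VG\<^esub> h \<in> W k"
    using V by (simp add: inv_VG)
qed

lemma centrally_metabelian_VG: "centrally_metabelian VG"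
proof -
  have 1: "derived VG (carrier VG) \<subseteq> W 2"
    by (rule derived_subset_W) (auto intro: comm_I2)
  have "derived VG (derived VG (carrier VG)) \<subseteq> W 6"
  proof (rule derived_subset_W)
    show "derived VG (carrier VG) \<subseteq> V" using 1 by (auto simp: W_def)
    fix g h assume "g \<in> derived VG (carrier VG)" "h \<in> derived VG (carrier VG)"
    then have gh: "g \<in> W 2" "h \<in> W 2" using 1 by auto
    then have "comm (g \<oplus> \<one>) (h \<oplus> \<one>) \<in> I 6"
      by (intro comm_I2_I2) (auto simp: W_def)
    moreover have "comm (g \<oplus> \<one>) (h \<oplus> \<one>) = comm g h"
      using gh by (simp add: W_def comm_plus_one comm_sym[of g])
    ultimately show "comm g h \<in> I 6" by simp
  qed
  moreover have "W 6 \<subseteq> group_center VG"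
  proof
    fix u assume u: "u \<in> W 6"
    then have uR: "u \<in> carrier R" by (simp add: W_def)
    have "u \<otimes> s = s \<otimes> u" if s: "s \<in> carrier R" for s
    proof -
      have "u \<otimes> s \<oplus> s = s \<otimes> u \<oplus> s"
        using I6_central[of "u \<oplus> \<one>" s] u s by (simp add: W_def l_distr r_distr)
      then show ?thesis using uR s by simp
    qed
    then show "u \<in> group_center VG" using u by (simp add: group_center_def W_def)
  qed
  ultimately show ?thesis unfolding centrally_metabelian_def by blast
qed

end

section \<open>Square roots of -2 in finite fields\<close>

lemma (in group) cyclic_iso_integer_mod_group:
  assumes "finite (carrier G)" and g: "g \<in> carrier G" and gen: "carrier G = {g [^] i | i::nat. True}"
  shows "G \<cong> integer_mod_group (order G)"
proof -
  define n where "n = order G"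
  have n: "n > 0" and gn: "g [^] n = \<one>"
    using assms(1) g order_gt_0_iff_finite pow_order_eq_1 by (auto simp: n_def)
  have mod: "g [^] (i mod n) = g [^] i" for i
    using g gn by (rule nat_pow_mod_eq)
  let ?C = "integer_mod_group n" and ?f = "\<lambda>k. g [^] nat k"
  have carr: "carrier ?C = {0..<int n}" using n by (simp add: carrier_integer_mod_group)
  have hom: "?f \<in> hom ?C G"
  proof (rule homI)
    fix k l assume kl: "k \<in> carrier ?C" "l \<in> carrier ?C"
    have "nat ((k + l) mod int n) = (nat k + nat l) mod n"
      using kl n by (simp add: carr nat_mod_distrib nat_add_distrib)
    then show "?f (k \<otimes>\<^bsub>?C\<^esub> l) = ?f k \<otimes> ?f l"
      using g by (simp add: mod nat_pow_mult)
  qed (use g in simp)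
  have surj: "?f ` carrier ?C = carrier G"
  proof
    show "carrier G \<subseteq> ?f ` carrier ?C"
    proof
      fix h assume "h \<in> carrier G"
      then obtain i :: nat where "h = g [^] i" using gen by auto
      then have "h = ?f (int (i mod n))" by (simp add: mod)
      then show "h \<in> ?f ` carrier ?C" using n by (intro rev_image_eqI[of "int (i mod n)"]) (simp_all add: carr)
    qed
  qed (use g in auto)
  have "inj_on ?f (carrier ?C)"
  proof (rule eq_card_imp_inj_on)
    show "finite (carrier ?C)" unfolding carr by simp
    have "card (carrier ?C) = n" unfolding carr by simp
    then show "card (?f ` carrier ?C) = card (carrier ?C)"
      unfolding surj by (simp only: n_def Coset.order_def)
  qed
  then have "?C \<cong> G"
    using hom surj unfolding is_iso_def iso_def bij_betw_def by blast
  then show ?thesis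
    using group.iso_sym[OF group_integer_mod_group] by (simp add: n_def)
qed

lemma (in field) finite_units_generator:
  assumes "finite (carrier R)"
  obtains g where "g \<in> carrier R" "g \<noteq> \<zero>" "Units R = {g [^] i | i::nat. True}"
proof -
  obtain g where g: "g \<in> carrier (Multiplicative_Group.mult_of R)"
    and gen: "carrier (Multiplicative_Group.mult_of R) = {g [^] i | i::nat. i \<in> UNIV}"
    using finite_field_mult_group_has_gen[OF assms] by (rule bexE)
  show ?thesis
  proof (rule that)
    show "g \<in> carrier R" "g \<noteq> \<zero>" using g unfolding Multiplicative_Group.carrier_mult_of by simp_all
    show "Units R = {g [^] i | i::nat. True}" using gen unfolding field_Units Multiplicative_Group.carrier_mult_of by simp
  qed
qed

lemma pow_units_of: "g [^]\<^bsub>units_of R\<^esub> (i::nat) = g [^]\<^bsub>R\<^esub> i"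
  by (induction i) (simp_all add: units_of_def nat_pow_def)

lemma (in field) units_cyclic:
  assumes "finite (carrier R)"
  shows "units_of R \<cong> integer_mod_group (card (carrier R) - 1)"
proof -
  obtain g where g: "g \<in> carrier R" "g \<noteq> \<zero>" "Units R = {g [^] i | i::nat. True}"
    using finite_units_generator[OF assms] .
  interpret u: group "units_of R" by (rule units_group)
  have "units_of R \<cong> integer_mod_group (order (units_of R))"
  proof (rule u.cyclic_iso_integer_mod_group)
    show "finite (carrier (units_of R))" using assms by (simp add: units_of_carrier field_Units)
    show "g \<in> carrier (units_of R)" using g(1,2) by (simp add: units_of_carrier field_Units)
    show "carrier (units_of R) = {g [^]\<^bsub>units_of R\<^esub> i | i::nat. True}"
      unfolding units_of_carrier pow_units_of by (rule g(3))
  qed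
  moreover have "order (units_of R) = card (carrier R) - 1"
    using assms by (simp add: Coset.order_def units_of_carrier field_Units card_Diff_singleton)
  ultimately show ?thesis by simp
qed

lemma (in field) pow_card_minus_one:
  assumes "finite (carrier R)" "y \<in> carrier R" "y \<noteq> \<zero>"
  shows "y [^] (card (carrier R) - 1) = \<one>"
proof -
  interpret u: group "units_of R" by (rule units_group)
  have "y [^]\<^bsub>units_of R\<^esub> order (units_of R) = \<one>\<^bsub>units_of R\<^esub>"
    using assms by (intro u.pow_order_eq_1) (auto simp: units_of_carrier field_Units)
  moreover have "order (units_of R) = card (carrier R) - 1"
    using assms by (simp add: Coset.order_def units_of_carrier field_Units card_Diff_singleton)
  ultimately show ?thesis by (simp add: pow_units_of units_of_one)
qed

lemma (in field) pow_card:
  assumes "finite (carrier R)" "y \<in> carrier R"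
  shows "y [^] card (carrier R) = y"
proof -
  have c: "card (carrier R) > 0" using assms by (auto simp: card_gt_0_iff)
  show ?thesis
  proof (cases "y = \<zero>")
    case True
    then show ?thesis using c by (simp add: nat_pow_zero)
  next
    case False
    have "y [^] Suc (card (carrier R) - 1) = y"
      using pow_card_minus_one[OF assms False] assms by simp
    then show ?thesis using c by simp
  qed
qed

lemma (in ring) of_nat_add_pow: "\<guillemotleft>n\<guillemotright>\<^sub>\<nat> = [n] \<cdot> \<one>"
  by (induction n) (simp_all add: add.nat_pow_Suc a_comm)

lemma (in field) prime_eq_zero:
  assumes "finite (carrier R)" "card (carrier R) = p ^ n"
  shows "\<guillemotleft>int p\<guillemotright> = \<zero>"
proof -
  have "[order (add_monoid R)] \<cdot> \<one> = \<zero>"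
    using add.pow_order_eq_1[of \<one>] by simp
  then have "[(p ^ n)] \<cdot> \<one> = \<zero>" using assms by (simp add: Coset.order_def)
  then have "\<guillemotleft>int (p ^ n)\<guillemotright> = \<zero>"
    by (simp only: of_integer_def of_nat_add_pow nat_int of_nat_0_le_iff if_True)
  then have "\<guillemotleft>int p\<guillemotright> [^] n = \<zero>"
    by (simp flip: of_int_power)
  then show ?thesis by simp
qed

lemma (in field) two_neq_zero:
  assumes "finite (carrier R)" "card (carrier R) = p ^ n" "odd p"
  shows "\<guillemotleft>2\<guillemotright> \<noteq> \<zero>"
proof
  assume 2: "\<guillemotleft>2\<guillemotright> = \<zero>"
  obtain k where "int p = 2 * k + 1" using assms(3) by (metis oddE even_of_nat)
  then have "\<guillemotleft>int p\<guillemotright> = \<guillemotleft>2\<guillemotright> \<otimes> \<guillemotleft>k\<guillemotright> \<oplus> \<one>" by simp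
  then show False using 2 prime_eq_zero[OF assms(1,2)] by simp
qed

lemma (in field) minus_one_neq_one: "\<guillemotleft>2\<guillemotright> \<noteq> \<zero> \<Longrightarrow> \<ominus> \<one> \<noteq> \<one>"
  by (metis of_int_2 one_closed r_neg)

text \<open>
  If \<open>g\<close> generates the multiplicative group, of order \<open>2mk\<close>, then \<open>g\<^sup>m\<^sup>k\<close> is a square root of 1 other
  than 1, hence \<open>-1\<close>; the witness is \<open>g\<^sup>k\<close>.
\<close>

lemma (in field) exists_pow_eq_minus_one:
  assumes fin: "finite (carrier R)" and two: "\<guillemotleft>2\<guillemotright> \<noteq> \<zero>" and m: "card (carrier R) - 1 = 2 * m * k"
  obtains z where "z \<in> carrier R" "z [^] m = \<ominus> \<one>"
proof -
  obtain g where g: "g \<in> carrier R" "g \<noteq> \<zero>" "Units R = {g [^] i | i::nat. True}"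
    using finite_units_generator[OF fin] .
  let ?N = "card (carrier R) - 1"
  have one: "g [^] ?N = \<one>" by (rule pow_card_minus_one[OF fin g(1,2)])
  define y where "y = g [^] (m * k)"
  have y: "y \<in> carrier R" using g by (simp add: y_def)
  have "m * k * 2 = ?N" using m by simp
  then have "y [^] (2::nat) = \<one>" using one g by (simp only: y_def nat_pow_pow)
  then have "y \<otimes> y = \<one> \<otimes> \<one>" using y by (simp add: numeral_2_eq_2)
  then have yy: "y = \<one> \<or> y = \<ominus> \<one>"
    using square_eq_iff[of y \<one>] y by simp
  have "y \<noteq> \<one>"
  proof
    assume y1: "y = \<one>"
    have card_units: "card (Units R) = ?N"
      using fin by (simp add: field_Units card_Diff_singleton)
    have finite_units: "finite (Units R)" using fin by (simp add: field_Units)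
    then have "card (Units R) > 0" using Units_one_closed card_gt_0_iff by blast
    then have pos: "m * k > 0" using m card_units by (cases m; cases k) auto
    have "Units R \<subseteq> (\<lambda>i. g [^] i) ` {..<m * k}"
    proof
      fix u assume "u \<in> Units R"
      then obtain i :: nat where "u = g [^] i" using g(3) by auto
      also have "g [^] i = g [^] (i mod (m * k))"
        using g(1) y1 by (simp add: nat_pow_mod_eq y_def)
      finally show "u \<in> (\<lambda>i. g [^] i) ` {..<m * k}" using pos by auto
    qed
    then have "card (Units R) \<le> card ((\<lambda>i. g [^] i) ` {..<m * k})"
      by (intro card_mono) auto
    also have "\<dots> \<le> m * k" using card_image_le[of "{..<m * k}"] by simp
    finally show False using m pos card_units by simp
  qed
  then have "(g [^] k) [^] m = \<ominus> \<one>"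
    using yy g by (simp add: nat_pow_pow y_def mult.commute)
  then show ?thesis using that g by blast
qed

text \<open>
  For a primitive eighth root of unity \<open>z\<close>, one has \<open>(z + z\<^sup>3)\<^sup>2 = 2z\<^sup>4 + z\<^sup>2(1 + z\<^sup>4) = -2\<close>.
\<close>

lemma (in field) sqrt_minus_two_if_1_mod_8:
  assumes "finite (carrier R)" "\<guillemotleft>2\<guillemotright> \<noteq> \<zero>" "card (carrier R) mod 8 = 1"
  shows "\<exists>s\<in>carrier R. s \<otimes> s = \<ominus> \<guillemotleft>2\<guillemotright>"
proof -
  have "card (carrier R) - 1 = 2 * 4 * (card (carrier R) div 8)"
    using assms(3) mult_div_mod_eq[of 8 "card (carrier R)"] by simp
  then obtain z where z: "z \<in> carrier R" "z [^] (4::nat) = \<ominus> \<one>"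
    using exists_pow_eq_minus_one[OF assms(1,2)] by blast
  let ?s = "z \<oplus> z \<otimes> z \<otimes> z"
  have "?s \<otimes> ?s = \<guillemotleft>2\<guillemotright> \<otimes> z [^] (4::nat) \<oplus> z \<otimes> z \<otimes> (\<one> \<oplus> z [^] (4::nat))"
    unfolding of_int_2 using z(1) by (simp add: numeral_eq_Suc) algebra
  also have "\<dots> = \<ominus> \<guillemotleft>2\<guillemotright>"
    using z by (simp add: r_minus r_neg)
  finally show ?thesis using z by (intro bexI[of _ ?s]) auto
qed

lemma (in ring) of_int_cong_eq:
  assumes "\<guillemotleft>int p\<guillemotright> = \<zero>" "[k = l] (mod int p)"
  shows "\<guillemotleft>k\<guillemotright> = \<guillemotleft>l\<guillemotright>"
proof -
  have "int p dvd k - l" using assms(2) by (simp add: cong_iff_dvd_diff)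
  then obtain j where "k - l = int p * j" by (rule dvdE)
  then have "k = l + int p * j" by simp
  then show ?thesis using assms(1) by simp
qed

text \<open>
  By Gauss's lemma the Legendre symbol is the parity of the number of \<open>y \<le> (p - 1) / 2\<close> for which
  the residue of \<open>2y\<close> exceeds \<open>(p - 1) / 2\<close>. For \<open>p = 8k + 7\<close> these are the \<open>2k + 2\<close> numbers
  \<open>2k + 2, \<dots>, 4k + 3\<close>.
\<close>

lemma QuadRes_two_if_7_mod_8:
  assumes "Factorial_Ring.prime p" "p mod 8 = (7::nat)"
  shows "QuadRes (int p) 2"
proof -
  define k where "k = int p div 8"
  have p: "int p = 8 * k + 7"
    using assms(2) unfolding k_def by (metis div_mod_decomp_int mult.commute of_nat_mod of_nat_numeral)
  have k: "k \<ge> 0" by (simp add: k_def)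
  interpret GAUSS p 2
    using assms p k by unfold_locales (auto simp: cong_def)
  have half: "(int p - 1) div 2 = 4 * k + 3" using p by simp
  have C: "C = (\<lambda>y. 2 * y) ` {0 <.. 4 * k + 3}"
    unfolding C_def B_def A_def half image_image using p by (intro image_cong) auto
  have "E = (\<lambda>y. 2 * y) ` {2 * k + 2 .. 4 * k + 3}"
    unfolding E_def C half by auto
  then have "card E = card {2 * k + 2 .. 4 * k + 3}"
    by (simp add: card_image inj_on_def)
  also have "\<dots> = 2 * nat (k + 1)" using k by simp
  finally have "Legendre 2 (int p) = 1" using gauss_lemma by simp
  then show ?thesis by (auto simp: Legendre_def split: if_splits)
qed

text \<open>
  Gauss's lemma for the positive representative \<open>p - 2\<close> of \<open>-2\<close>: the residue of \<open>(p - 2)y\<close> is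
  \<open>p - 2y\<close>, and for \<open>p = 8k + 3\<close> it exceeds \<open>(p - 1) / 2\<close> for the \<open>2k\<close> numbers \<open>1, \<dots>, 2k\<close>.
\<close>

lemma QuadRes_minus_two_if_3_mod_8:
  assumes "Factorial_Ring.prime p" "p mod 8 = (3::nat)"
  shows "QuadRes (int p) (int p - 2)"
proof -
  define k where "k = int p div 8"
  have p: "int p = 8 * k + 3"
    using assms(2) unfolding k_def by (metis div_mod_decomp_int mult.commute of_nat_mod of_nat_numeral)
  have k: "k \<ge> 0" by (simp add: k_def)
  interpret GAUSS p "int p - 2"
    using assms p k by unfold_locales (auto simp: cong_def)
  have half: "(int p - 1) div 2 = 4 * k + 1" using p by simp
  have C: "C = (\<lambda>y. int p - 2 * y) ` {0 <.. 4 * k + 1}"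
  proof -
    have "y * (int p - 2) mod int p = int p - 2 * y" if "y \<in> {0 <.. 4 * k + 1}" for y
    proof -
      have "y * (int p - 2) = (int p - 2 * y) + int p * (y - 1)" by (simp add: algebra_simps)
      then have "y * (int p - 2) mod int p = (int p - 2 * y) mod int p" by (simp only: mod_mult_self2)
      also have "\<dots> = int p - 2 * y" using that p by (intro mod_pos_pos_trivial) auto
      finally show ?thesis .
    qed
    then show ?thesis unfolding C_def B_def A_def half image_image by (intro image_cong) auto
  qed
  have "E = (\<lambda>y. int p - 2 * y) ` {1 .. 2 * k}"
    unfolding E_def C half using p by auto
  then have "card E = card {1 .. 2 * k}"
    by (simp add: card_image inj_on_def)
  also have "\<dots> = 2 * nat k" using k by simp
  finally have "Legendre (int p - 2) (int p) = 1" using gauss_lemma by simp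
  then show ?thesis by (auto simp: Legendre_def split: if_splits)
qed

text \<open>
  Odd squares are 1 modulo 8, so the exponent has to be odd.
\<close>

lemma odd_prime_power_mod_8:
  assumes "odd p" "p ^ n mod 8 \<in> {3, 7::nat}"
  shows "p mod 8 = p ^ n mod 8"
proof -
  have "p mod 8 = 1 \<or> p mod 8 = 3 \<or> p mod 8 = 5 \<or> p mod 8 = 7"
    using assms(1) by presburger
  then have sq: "(p mod 8) ^ 2 mod 8 = 1" by auto
  have "p ^ n mod 8 = (p mod 8) ^ n mod 8" by (simp add: power_mod)
  also have "\<dots> = (p mod 8) ^ (2 * (n div 2) + n mod 2) mod 8" by simp
  also have "\<dots> = ((p mod 8) ^ 2 mod 8) ^ (n div 2) * (p mod 8) ^ (n mod 2) mod 8"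
    by (simp only: power_add power_mult power_mod mod_mult_left_eq)
      (metis mod_mult_left_eq power_mod)
  also have "\<dots> = (p mod 8) ^ (n mod 2) mod 8" by (simp add: sq)
  finally have e: "p ^ n mod 8 = (p mod 8) ^ (n mod 2) mod 8" .
  have "n mod 2 = 1"
  proof (rule ccontr)
    assume "n mod 2 \<noteq> 1"
    then have "n mod 2 = 0" by simp
    then show False using e assms(2) by simp
  qed
  then show ?thesis using e by simp
qed

lemma (in ring) of_int_square:
  assumes "\<guillemotleft>int p\<guillemotright> = \<zero>" "QuadRes (int p) k"
  shows "\<exists>s\<in>carrier R. s \<otimes> s = \<guillemotleft>k\<guillemotright>"
proof -
  obtain y where "[y\<^sup>2 = k] (mod int p)" using assms(2) by (auto simp: QuadRes_def)
  then have "\<guillemotleft>y\<guillemotright> \<otimes> \<guillemotleft>y\<guillemotright> = \<guillemotleft>k\<guillemotright>"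
    using of_int_cong_eq[OF assms(1), of "y\<^sup>2" k] by (simp add: Power.power2_eq_square)
  then show ?thesis by (rule bexI) simp
qed

lemma (in field) sqrt_minus_two_if_1_3_mod_8:
  assumes "Factorial_Ring.prime p" "odd p" "finite (carrier R)" "card (carrier R) = p ^ n"
    and "card (carrier R) mod 8 = 1 \<or> card (carrier R) mod 8 = 3"
  shows "\<exists>s\<in>carrier R. s \<otimes> s = \<ominus> \<guillemotleft>2\<guillemotright>"
  using assms(5)
proof
  assume "card (carrier R) mod 8 = 1"
  then show ?thesis
    using sqrt_minus_two_if_1_mod_8[OF assms(3) two_neq_zero[OF assms(3,4,2)]] by simp
next
  assume 3: "card (carrier R) mod 8 = 3"
  then have "p mod 8 = 3" using odd_prime_power_mod_8[of p n] assms by simp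
  then show ?thesis
    using of_int_square[OF prime_eq_zero[OF assms(3,4)] QuadRes_minus_two_if_3_mod_8[OF assms(1)]]
      prime_eq_zero[OF assms(3,4)] by simp
qed

text \<open>
  Suppose \<open>s\<^sup>2 = -2\<close>. If \<open>q \<equiv> 5\<close>, there is \<open>i\<close> with \<open>i\<^sup>2 = -1\<close>, and \<open>(1 + i)\<^sup>4 = -4 = -s\<^sup>4\<close>; raising this to
  the odd power \<open>(q - 1) / 4\<close> gives \<open>1 = -1\<close>. If \<open>q \<equiv> 7\<close>, then \<open>2 = t\<^sup>2\<close> is a square, \<open>s\<^sup>2 = -t\<^sup>2\<close>, and the
  odd power \<open>(q - 1) / 2\<close> gives the same contradiction.
\<close>

lemma (in field) no_sqrt_minus_two_if_5_7_mod_8: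
  assumes "Factorial_Ring.prime p" "odd p" and fin: "finite (carrier R)" and card: "card (carrier R) = p ^ n"
    and q: "card (carrier R) mod 8 = 5 \<or> card (carrier R) mod 8 = 7" and s: "s \<in> carrier R"
  shows "s \<otimes> s \<noteq> \<ominus> \<guillemotleft>2\<guillemotright>"
proof
  assume ss: "s \<otimes> s = \<ominus> \<guillemotleft>2\<guillemotright>"
  have two: "\<guillemotleft>2\<guillemotright> \<noteq> \<zero>" using two_neq_zero[OF fin card assms(2)] .
  then have neg_two: "\<ominus> \<guillemotleft>2\<guillemotright> \<noteq> \<zero>"
    by (metis minus_minus minus_zero of_int_closed)
  have "s \<noteq> \<zero>"
  proof
    assume "s = \<zero>"
    then show False using ss neg_two s by (metis r_null)
  qed
  let ?q = "card (carrier R)"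
  have neg_pow: "(\<ominus> y) [^] Suc (2 * j) = \<ominus> (y [^] Suc (2 * j))" if "y \<in> carrier R" for y and j :: nat
  proof -
    have "(\<ominus> y) [^] (2::nat) = y [^] (2::nat)" using that by (simp add: numeral_2_eq_2 l_minus r_minus)
    then have "(\<ominus> y) [^] (2 * j) = y [^] (2 * j)"
      using that by (simp flip: nat_pow_pow)
    then show ?thesis using that by (simp add: r_minus)
  qed
  from q show False
  proof
    assume 5: "?q mod 8 = 5"
    define k where "k = ?q div 8"
    have k: "?q - 1 = 2 * 2 * (2 * k + 1)" "?q - 1 = 4 * Suc (2 * k)"
      using 5 mult_div_mod_eq[of 8 ?q] by (simp_all add: k_def)
    obtain i where i: "i \<in> carrier R" "i [^] (2::nat) = \<ominus> \<one>"
      using exists_pow_eq_minus_one[OF fin two k(1)] .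
    then have ii: "i \<otimes> i = \<ominus> \<one>" by (simp add: numeral_2_eq_2)
    let ?y = "\<one> \<oplus> i"
    have y: "?y \<in> carrier R" using i by simp
    have four: "\<guillemotleft>4\<guillemotright> = \<guillemotleft>2\<guillemotright> \<otimes> \<guillemotleft>2\<guillemotright>" using of_int_mult[of 2 2] by simp
    have "?y \<otimes> ?y = \<one> \<oplus> i \<otimes> i \<oplus> \<guillemotleft>2\<guillemotright> \<otimes> i"
      unfolding of_int_2 using i(1) by algebra
    then have yy: "?y \<otimes> ?y = \<guillemotleft>2\<guillemotright> \<otimes> i" using i(1) ii by (simp add: r_neg)
    have "?y [^] (4::nat) = (?y \<otimes> ?y) \<otimes> (?y \<otimes> ?y)"
      using i(1) by (simp add: numeral_eq_Suc m_assoc)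
    also have "\<dots> = \<guillemotleft>2\<guillemotright> \<otimes> \<guillemotleft>2\<guillemotright> \<otimes> (i \<otimes> i)" unfolding yy using i(1) by (simp add: m_ac)
    also have "\<dots> = \<ominus> \<guillemotleft>4\<guillemotright>" unfolding ii four by (simp add: r_minus)
    finally have y4: "?y [^] (4::nat) = \<ominus> \<guillemotleft>4\<guillemotright>" .
    have "s [^] (4::nat) = (s \<otimes> s) \<otimes> (s \<otimes> s)" using s by (simp add: numeral_eq_Suc m_assoc)
    also have "\<dots> = \<guillemotleft>4\<guillemotright>" unfolding ss four by (simp add: l_minus r_minus)
    finally have s4: "s [^] (4::nat) = \<ominus> (?y [^] (4::nat))" by (simp add: y4)
    have nz: "s \<noteq> \<zero>" "?y \<noteq> \<zero>"
    proof -
      have 4: "\<guillemotleft>4\<guillemotright> \<noteq> \<zero>" unfolding four using two by (simp add: integral_iff)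
      show "s \<noteq> \<zero>" by fact
      show "?y \<noteq> \<zero>"
      proof
        assume "?y = \<zero>"
        then have "\<ominus> \<guillemotleft>4\<guillemotright> = \<zero>" using y4 by (simp only:) (simp add: nat_pow_zero)
        then show False using 4 by (metis minus_minus minus_zero of_int_closed)
      qed
    qed
    have "\<one> = s [^] (?q - 1)" using pow_card_minus_one[OF fin s nz(1)] by simp
    also have "\<dots> = (s [^] (4::nat)) [^] Suc (2 * k)" using s by (simp only: k(2) nat_pow_pow)
    also have "\<dots> = \<ominus> ((?y [^] (4::nat)) [^] Suc (2 * k))" unfolding s4 using y by (intro neg_pow) simp
    also have "(?y [^] (4::nat)) [^] Suc (2 * k) = ?y [^] (?q - 1)" using y by (simp only: k(2) nat_pow_pow)
    also have "\<dots> = \<one>" using pow_card_minus_one[OF fin y nz(2)] .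
    finally show False using minus_one_neq_one[OF two] by simp
  next
    assume 7: "?q mod 8 = 7"
    define k where "k = ?q div 8"
    have k: "?q - 1 = 2 * Suc (2 * (2 * k + 1))"
      using 7 mult_div_mod_eq[of 8 ?q] by (simp add: k_def)
    have "p mod 8 = 7" using odd_prime_power_mod_8[of p n] assms 7 by simp
    from of_int_square[OF prime_eq_zero[OF fin card] QuadRes_two_if_7_mod_8[OF assms(1) this]]
    obtain t where t: "t \<in> carrier R" "t \<otimes> t = \<guillemotleft>2\<guillemotright>" by (rule bexE)
    have nz: "s \<noteq> \<zero>" "t \<noteq> \<zero>"
      using \<open>s \<noteq> \<zero>\<close> t two r_null by metis+
    have "\<one> = s [^] (?q - 1)" using pow_card_minus_one[OF fin s nz(1)] by simp
    also have "\<dots> = (s \<otimes> s) [^] Suc (2 * (2 * k + 1))" using s by (simp only: k flip: nat_pow_pow) (simp add: numeral_2_eq_2)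
    also have "\<dots> = \<ominus> ((t \<otimes> t) [^] Suc (2 * (2 * k + 1)))" unfolding ss t(2) by (rule neg_pow) simp
    also have "(t \<otimes> t) [^] Suc (2 * (2 * k + 1)) = t [^] (?q - 1)" using t(1) by (simp only: k flip: nat_pow_pow) (simp add: numeral_2_eq_2)
    also have "\<dots> = \<one>" using pow_card_minus_one[OF fin t(1) nz(2)] .
    finally show False using minus_one_neq_one[OF two] by simp
  qed
qed

section \<open>Embeddings of finite fields\<close>

text \<open>
  Evaluation of an integer polynomial through the canonical map from the integers. Integer
  coefficients let one polynomial be evaluated in two fields of different types.
\<close>

definition eval_int_poly :: "('r, 'm) ring_scheme \<Rightarrow> 'r \<Rightarrow> int poly \<Rightarrow> 'r"
  where "eval_int_poly K b f = Polynomial.fold_coeffs (\<lambda>c y. \<guillemotleft>c\<guillemotright>\<^bsub>K\<^esub> \<oplus>\<^bsub>K\<^esub> b \<otimes>\<^bsub>K\<^esub> y) f \<zero>\<^bsub>K\<^esub>"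

context cring
begin

abbreviation (input) ev where "ev \<equiv> eval_int_poly R"

lemma ev_0 [simp]: "ev b 0 = \<zero>"
  by (simp add: eval_int_poly_def)

lemma ev_pCons [simp]: "b \<in> carrier R \<Longrightarrow> ev b (pCons c f) = \<guillemotleft>c\<guillemotright> \<oplus> b \<otimes> ev b f"
  by (cases "c = 0 \<and> f = 0") (auto simp: eval_int_poly_def)

lemma ev_closed [simp]: "b \<in> carrier R \<Longrightarrow> ev b f \<in> carrier R"
  by (induction f) simp_all

lemma ev_add: "b \<in> carrier R \<Longrightarrow> ev b (f + g) = ev b f \<oplus> ev b g"
  by (induction f g rule: poly_induct2) (simp_all add: r_distr a_ac)

lemma ev_smult: "b \<in> carrier R \<Longrightarrow> ev b (Polynomial.smult c f) = \<guillemotleft>c\<guillemotright> \<otimes> ev b f"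
  by (induction f) (simp_all add: r_distr m_lcomm)

lemma ev_mult: "b \<in> carrier R \<Longrightarrow> ev b (f * g) = ev b f \<otimes> ev b g"
  by (induction f) (simp_all add: l_distr ev_add ev_smult m_assoc)

lemma ev_monom: "b \<in> carrier R \<Longrightarrow> ev b (Polynomial.monom c n) = \<guillemotleft>c\<guillemotright> \<otimes> b [^] n"
  by (induction n) (simp_all add: monom_0 monom_Suc m_ac)

lemma ev_diff:
  assumes "b \<in> carrier R"
  shows "ev b (f - g) = ev b f \<ominus> ev b g"
proof -
  have "ev b (f + Polynomial.smult (- 1) g) = ev b f \<oplus> \<guillemotleft>- 1\<guillemotright> \<otimes> ev b g"
    by (simp only: ev_add ev_smult assms)
  moreover have "f + Polynomial.smult (- 1) g = f - g" by simp
  ultimately show ?thesis using assms by (simp add: l_minus a_minus_def)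
qed

lemma ev_one: "b \<in> carrier R \<Longrightarrow> ev b 1 = \<one>"
  using ev_monom[of b 1 0] by (simp add: monom_0 one_pCons)

lemma ev_const_dvd:
  assumes "b \<in> carrier R" "\<guillemotleft>c\<guillemotright> = \<zero>" "[:c:] dvd f"
  shows "ev b f = \<zero>"
proof -
  obtain g where "f = Polynomial.smult c g" using assms(3) by (auto elim: dvdE)
  then show ?thesis using assms by (simp add: ev_smult)
qed

lemma ev_finsum:
  assumes b: "b \<in> carrier R" and "Polynomial.degree f \<le> n"
  shows "ev b f = (\<Oplus>i\<in>{..n}. \<guillemotleft>Polynomial.coeff f i\<guillemotright> \<otimes> b [^] i)"
  using assms(2)
proof (induction f arbitrary: n)
  case 0
  then show ?case using b by simp
next
  case (pCons c f)
  show ?case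
  proof (cases n)
    case 0
    then have "f = 0" using pCons by (simp split: if_splits)
    then show ?thesis using b 0 by simp
  next
    case (Suc k)
    have "(\<Oplus>i\<in>{..Suc k}. \<guillemotleft>Polynomial.coeff (pCons c f) i\<guillemotright> \<otimes> b [^] i)
        = (\<Oplus>i\<in>{..k}. \<guillemotleft>Polynomial.coeff f i\<guillemotright> \<otimes> b [^] Suc i) \<oplus> \<guillemotleft>c\<guillemotright>"
      using b by (subst finsum_Suc2) simp_all
    also have "(\<Oplus>i\<in>{..k}. \<guillemotleft>Polynomial.coeff f i\<guillemotright> \<otimes> b [^] Suc i)
        = b \<otimes> (\<Oplus>i\<in>{..k}. \<guillemotleft>Polynomial.coeff f i\<guillemotright> \<otimes> b [^] i)"
      using b by (subst finsum_rdistr) (auto intro!: finsum_cong' simp: m_ac)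
    also have "(\<Oplus>i\<in>{..k}. \<guillemotleft>Polynomial.coeff f i\<guillemotright> \<otimes> b [^] i) = ev b f"
    proof (rule pCons.IH[symmetric])
      show "Polynomial.degree f \<le> k"
        using pCons.prems Suc by (cases "f = 0") simp_all
    qed
    finally show ?thesis using b Suc by (simp add: a_comm)
  qed
qed

end

lemma (in field) card_roots_int_poly:
  assumes fin: "finite (carrier R)" and lc: "Polynomial.coeff h n = 1" and deg: "Polynomial.degree h = n"
  shows "card {b \<in> carrier R. eval_int_poly R b h = \<zero>} \<le> n"
proof -
  interpret P: UP_domain R "UP R" by unfold_locales
  define H where "H = (\<lambda>i. \<guillemotleft>Polynomial.coeff h i\<guillemotright>)"
  have H: "H \<in> up R"
  proof (rule mem_upI)
    show "\<exists>n. bound \<zero> n H"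
      by (rule exI[of _ n], rule bound.intro) (simp add: H_def coeff_eq_0 deg)
  qed (simp add: H_def)
  have up: "H \<in> carrier (UP R)" using H unfolding UP_def by simp
  have coeff: "UnivPoly.coeff (UP R) H i = H i" for i
    using H unfolding UP_def by simp
  have d: "deg R H = n"
  proof (rule antisym)
    show "deg R H \<le> n"
      by (rule P.deg_aboveI[OF _ up]) (simp only: coeff, simp add: H_def coeff_eq_0 deg)
    show "n \<le> deg R H"
      by (rule P.deg_belowI[OF _ up]) (simp only: coeff, simp add: H_def lc)
  qed
  have nz: "H \<noteq> \<zero>\<^bsub>UP R\<^esub>"
  proof
    assume "H = \<zero>\<^bsub>UP R\<^esub>"
    then have "H n = \<zero>" unfolding UP_def by simp
    then show False by (simp add: H_def lc)
  qed
  have "UnivPoly.eval R R id b H = eval_int_poly R b h" if "b \<in> carrier R" for b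
    using that ev_finsum[OF that, of h n] deg
    by (simp add: P.eval_on_carrier[OF up] d coeff) (simp add: H_def)
  then have "{b \<in> carrier R. UnivPoly.eval R R id b H = \<zero>} = {b \<in> carrier R. eval_int_poly R b h = \<zero>}"
    by auto
  then show ?thesis using P.roots_bound[OF up nz fin] by (simp add: d)
qed

text \<open>
  Let \<open>m\<close> be a monic integer polynomial of least degree that vanishes at the generator \<open>\<theta>\<close>. Up to
  multiples of \<open>p\<close>, the integer polynomials vanishing at \<open>\<theta>\<close> are the multiples of \<open>m\<close>; in particular
  \<open>m\<close> divides \<open>X\<^sup>N - X\<close> modulo \<open>p\<close>, where \<open>N\<close> is the order of \<open>L\<close>. All \<open>N\<close> elements of \<open>L\<close> are roots of
  \<open>X\<^sup>N - X\<close> and the cofactor has fewer than \<open>N\<close> of them, so \<open>m\<close> has a root \<open>b\<close> in \<open>L\<close>. Then \<open>f(\<theta>) \<mapsto> f(b)\<close> is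
  well defined and a homomorphism.
\<close>

lemma finite_field_embedding:
  fixes K :: "('k, 'm) ring_scheme" and L :: "('l, 'n) ring_scheme" and p :: nat
  assumes "field K" "finite (carrier K)" "field L" "finite (carrier L)"
    and p: "Factorial_Ring.prime p" and pK: "\<guillemotleft>int p\<guillemotright>\<^bsub>K\<^esub> = \<zero>\<^bsub>K\<^esub>" and pL: "\<guillemotleft>int p\<guillemotright>\<^bsub>L\<^esub> = \<zero>\<^bsub>L\<^esub>"
    and gen: "\<theta> \<in> carrier K" "\<And>y. y \<in> carrier K \<Longrightarrow> y \<noteq> \<zero>\<^bsub>K\<^esub> \<Longrightarrow> \<exists>i::nat. y = \<theta> [^]\<^bsub>K\<^esub> i"
    and frob: "\<theta> [^]\<^bsub>K\<^esub> card (carrier L) = \<theta>"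
    and frobL: "\<And>b. b \<in> carrier L \<Longrightarrow> b [^]\<^bsub>L\<^esub> card (carrier L) = b"
  shows "\<exists>\<phi>. \<phi> \<in> ring_hom K L"
proof -
  interpret K: field K by fact
  interpret L: field L by fact
  let ?eK = "eval_int_poly K \<theta>" and ?eL = "eval_int_poly L"
  define N where "N = card (carrier L)"
  have N: "N \<ge> 2"
  proof -
    have "card {\<zero>\<^bsub>L\<^esub>, \<one>\<^bsub>L\<^esub>} \<le> N"
      unfolding N_def using assms(4) by (intro card_mono) auto
    then show ?thesis by simp
  qed
  define W where "W = Polynomial.monom (1::int) N - Polynomial.monom 1 1"
  have cW: "Polynomial.coeff W i = (if i = N then 1 else if i = 1 then - 1 else 0)" for i
    using N by (auto simp: W_def)
  have dW: "Polynomial.degree W = N"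
  proof (rule antisym)
    show "Polynomial.degree W \<le> N" using N by (intro degree_le) (simp add: cW)
    show "N \<le> Polynomial.degree W" by (rule le_degree) (simp add: cW)
  qed
  have eW: "?eK W = \<zero>\<^bsub>K\<^esub>"
    using gen(1) frob by (simp add: W_def K.ev_diff K.ev_monom N_def)
  define Q where "Q m \<longleftrightarrow> lead_coeff m = 1 \<and> ?eK m = \<zero>\<^bsub>K\<^esub>" for m
  have "Q W" using N by (simp add: Q_def dW cW eW)
  define m where "m = arg_min Polynomial.degree Q"
  have Qm: "Q m" and min: "Q r \<Longrightarrow> Polynomial.degree m \<le> Polynomial.degree r" for r
    unfolding m_def using arg_min_nat_lemma[of Q W Polynomial.degree] \<open>Q W\<close> by auto
  let ?d = "Polynomial.degree m"
  have lm: "lead_coeff m = 1" and em: "?eK m = \<zero>\<^bsub>K\<^esub>" using Qm by (auto simp: Q_def)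
  \<comment> \<open>By minimality of \<open>m\<close>: were the leading coefficient of \<open>r\<close> invertible modulo \<open>p\<close>, it could be
    normalised to 1, giving a monic polynomial of smaller degree.\<close>
  have small: "[:int p:] dvd r" if "r = 0 \<or> Polynomial.degree r < ?d" "?eK r = \<zero>\<^bsub>K\<^esub>" for r
    using that
  proof (induction "Polynomial.degree r" arbitrary: r rule: less_induct)
    case less
    show ?case
    proof (cases "r = 0")
      case False
      define n where "n = Polynomial.degree r"
      define c where "c = lead_coeff r"
      have n: "n < ?d" using less False by (simp add: n_def)
      show ?thesis
      proof (cases "int p dvd c")
        case True
        have mono: "[:int p:] dvd Polynomial.monom c n"
          using True by (simp add: const_poly_dvd_iff)
        define r0 where "r0 = r - Polynomial.monom c n"
        have e0: "?eK r0 = \<zero>\<^bsub>K\<^esub>"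
          using gen(1) less K.ev_const_dvd[OF gen(1) pK mono] by (simp add: r0_def K.ev_diff)
        have "[:int p:] dvd r0"
        proof (cases "r0 = 0")
          case nz: False
          have "Polynomial.degree r0 < n"
            by (rule degree_lessI) (use nz in \<open>auto simp: r0_def c_def n_def coeff_eq_0 le_less\<close>)
          then show ?thesis using less.hyps[of r0] e0 n by (simp add: n_def)
        qed simp
        then show ?thesis using mono by (simp add: r0_def dvd_diff_left_iff)
      next
        case False
        then have "coprime c (int p)"
          using p by (metis coprime_commute prime_imp_coprime prime_nat_int_transfer)
        then obtain u where u: "[c * u = 1] (mod int p)" using cong_solve_coprime_int by blast
        then have "int p dvd c * u - 1" by (simp add: cong_iff_dvd_diff)
        then have mono: "[:int p:] dvd Polynomial.monom (c * u - 1) n" by (simp add: const_poly_dvd_iff)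
        define r' where "r' = Polynomial.smult u r - Polynomial.monom (c * u - 1) n"
        have c': "Polynomial.coeff r' n = 1" by (simp add: r'_def n_def c_def algebra_simps)
        have d': "Polynomial.degree r' = n"
        proof (rule antisym)
          show "Polynomial.degree r' \<le> n"
            by (rule degree_le) (auto simp: r'_def n_def coeff_eq_0)
          show "n \<le> Polynomial.degree r'" by (rule le_degree) (simp add: c')
        qed
        have "?eK r' = \<zero>\<^bsub>K\<^esub>"
          using gen(1) less K.ev_const_dvd[OF gen(1) pK mono] by (simp add: r'_def K.ev_diff K.ev_smult)
        then have "Q r'" by (simp add: Q_def d' c')
        then show ?thesis using min[of r'] n d' by simp
      qed
    qed simp
  qed
  have divide: "\<exists>h r. f = m * h + r \<and> (r = 0 \<or> Polynomial.degree r < ?d) \<and> [:int p:] dvd r"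
    if "?eK f = \<zero>\<^bsub>K\<^esub>" for f
  proof -
    obtain h r where hr: "pseudo_divmod f m = (h, r)" by fastforce
    have m0: "m \<noteq> 0" using lm by auto
    have f: "f = m * h + r" "r = 0 \<or> Polynomial.degree r < ?d"
      using pseudo_divmod[OF m0 hr] lm by simp_all
    have "?eK r = \<zero>\<^bsub>K\<^esub>"
      using that gen(1) em unfolding f(1) by (simp add: K.ev_add K.ev_mult)
    then show ?thesis using f small by blast
  qed
  have "?d \<noteq> 0"
  proof
    assume d0: "?d = 0"
    then obtain c where "m = [:c:]" by (rule degree_eq_zeroE)
    then have "m = 1" using lm by (simp add: one_pCons)
    then show False using em gen(1) by (simp add: K.ev_one)
  qed
  obtain h r where W: "W = m * h + r" and r: "r = 0 \<or> Polynomial.degree r < ?d" "[:int p:] dvd r"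
    using divide[OF eW] by blast
  have dN: "?d \<le> N" using min[OF \<open>Q W\<close>] dW by simp
  have rN: "Polynomial.coeff r i = 0" if "i \<ge> N" for i
    using r(1) dN that by (auto intro: coeff_eq_0)
  have mh: "m * h = W - r" using W by simp
  have cmh: "Polynomial.coeff (m * h) N = 1" by (simp add: mh cW rN)
  have dmh: "Polynomial.degree (m * h) = N"
  proof (rule antisym)
    show "Polynomial.degree (m * h) \<le> N"
      by (rule degree_le) (use N in \<open>auto simp: mh cW rN\<close>)
    show "N \<le> Polynomial.degree (m * h)" by (rule le_degree) (simp add: cmh)
  qed
  have "h \<noteq> 0" "m \<noteq> 0" using cmh by auto
  then have dh: "Polynomial.degree h = N - ?d" using dmh by (simp add: degree_mult_eq)
  have lh: "Polynomial.coeff h (N - ?d) = 1"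
    using lead_coeff_mult[of m h] lm cmh dmh dh by simp
  have "\<exists>b\<in>carrier L. ?eL b m = \<zero>\<^bsub>L\<^esub>"
  proof (rule ccontr)
    assume none: "\<not> ?thesis"
    have "?eL b h = \<zero>\<^bsub>L\<^esub>" if b: "b \<in> carrier L" for b
    proof -
      have "?eL b W = \<zero>\<^bsub>L\<^esub>"
        using b frobL by (simp add: W_def L.ev_diff L.ev_monom N_def)
      moreover have "?eL b r = \<zero>\<^bsub>L\<^esub>" using L.ev_const_dvd[OF b pL r(2)] .
      ultimately have "?eL b m \<otimes>\<^bsub>L\<^esub> ?eL b h = \<zero>\<^bsub>L\<^esub>"
        using b by (simp add: W L.ev_add L.ev_mult)
      then show ?thesis using none b by (simp add: L.integral_iff)
    qed
    then have "{b \<in> carrier L. ?eL b h = \<zero>\<^bsub>L\<^esub>} = carrier L" by blast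
    then have "N \<le> N - ?d"
      using L.card_roots_int_poly[OF assms(4) lh dh] by (simp add: N_def)
    then show False using \<open>?d \<noteq> 0\<close> dN by simp
  qed
  then obtain b where b: "b \<in> carrier L" "?eL b m = \<zero>\<^bsub>L\<^esub>" by blast
  have kernel: "?eL b f = \<zero>\<^bsub>L\<^esub>" if f: "?eK f = \<zero>\<^bsub>K\<^esub>" for f
  proof -
    obtain h r where "f = m * h + r" "[:int p:] dvd r" using divide[OF f] by blast
    then show ?thesis using b L.ev_const_dvd[OF b(1) pL] by (simp add: L.ev_add L.ev_mult)
  qed
  have wd: "?eL b f = ?eL b g" if "?eK f = ?eK g" for f g
  proof -
    have "?eL b (f - g) = \<zero>\<^bsub>L\<^esub>"
      using that gen(1) by (intro kernel) (simp add: K.ev_diff)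
    then show ?thesis using b by (simp add: L.ev_diff)
  qed
  have surj: "\<exists>f. ?eK f = y" if y: "y \<in> carrier K" for y
  proof (cases "y = \<zero>\<^bsub>K\<^esub>")
    case True
    then show ?thesis using K.ev_0 by blast
  next
    case False
    then obtain i :: nat where "y = \<theta> [^]\<^bsub>K\<^esub> i" using gen(2)[OF y] by blast
    then have "?eK (Polynomial.monom 1 i) = y" using gen(1) by (simp add: K.ev_monom)
    then show ?thesis by blast
  qed
  define \<phi> where "\<phi> y = ?eL b (SOME f. ?eK f = y)" for y
  have \<phi>: "\<phi> (?eK f) = ?eL b f" for f
    unfolding \<phi>_def by (rule wd) (rule someI_ex, blast)
  have "\<phi> \<in> ring_hom K L"
  proof (rule ring_hom_memI)
    fix y assume "y \<in> carrier K"
    then obtain f where f: "?eK f = y" using surj by blast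
    show "\<phi> y \<in> carrier L" using b \<phi>[of f] f by simp
    fix z assume "z \<in> carrier K"
    then obtain g where g: "?eK g = z" using surj by blast
    show "\<phi> (y \<otimes>\<^bsub>K\<^esub> z) = \<phi> y \<otimes>\<^bsub>L\<^esub> \<phi> z"
      using \<phi>[of "f * g"] \<phi>[of f] \<phi>[of g] f g gen(1) b by (simp add: K.ev_mult L.ev_mult)
    show "\<phi> (y \<oplus>\<^bsub>K\<^esub> z) = \<phi> y \<oplus>\<^bsub>L\<^esub> \<phi> z"
      using \<phi>[of "f + g"] \<phi>[of f] \<phi>[of g] f g gen(1) b by (simp add: K.ev_add L.ev_add)
  next
    show "\<phi> \<one>\<^bsub>K\<^esub> = \<one>\<^bsub>L\<^esub>"
      using \<phi>[of 1] gen(1) b by (simp add: K.ev_one L.ev_one)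
  qed
  then show ?thesis by blast
qed

section \<open>Matrix monoids, characters and generators of the group algebra\<close>

lemma (in cring) monoid_mat_monoid: "monoid (mat_monoid n R)"
proof (rule monoidI)
  let ?M = "mat_monoid n R"
  have app: "A (i, j) \<in> carrier R" if "A \<in> carrier ?M" "i < n" "j < n" for A i j
    using that by (auto simp: carrier_mat_monoid)
  have eqI: "A = B" if "A \<in> carrier ?M" "B \<in> carrier ?M" "\<And>i j. i < n \<Longrightarrow> j < n \<Longrightarrow> A (i, j) = B (i, j)" for A B
    using that(1,2) unfolding carrier_mat_monoid by (rule PiE_ext) (use that(3) in auto)
  show closed: "A \<otimes>\<^bsub>?M\<^esub> B \<in> carrier ?M" if "A \<in> carrier ?M" "B \<in> carrier ?M" for A B
    using app[OF that(1)] app[OF that(2)] by (auto simp: mat_monoid_def intro!: finsum_closed)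
  show one: "\<one>\<^bsub>?M\<^esub> \<in> carrier ?M" by (auto simp: mat_monoid_def)
  have one_app: "\<one>\<^bsub>?M\<^esub> (i, j) = (if i = j then \<one> else \<zero>)" if "i < n" "j < n" for i j
    using that by (simp add: mat_monoid_def)
  show "\<one>\<^bsub>?M\<^esub> \<otimes>\<^bsub>?M\<^esub> A = A" if A: "A \<in> carrier ?M" for A
  proof (rule eqI[OF closed[OF one A] A])
    fix i j assume ij: "i < n" "j < n"
    have "(\<one>\<^bsub>?M\<^esub> \<otimes>\<^bsub>?M\<^esub> A) (i, j) = (\<Oplus>k\<in>{..<n}. if i = k then A (k, j) else \<zero>)"
      using ij app[OF A] by (simp add: mat_monoid_app) (intro finsum_cong', auto simp: one_app)
    also have "\<dots> = A (i, j)" using ij app[OF A] by (intro finsum_singleton) auto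
    finally show "(\<one>\<^bsub>?M\<^esub> \<otimes>\<^bsub>?M\<^esub> A) (i, j) = A (i, j)" .
  qed
  show "A \<otimes>\<^bsub>?M\<^esub> \<one>\<^bsub>?M\<^esub> = A" if A: "A \<in> carrier ?M" for A
  proof (rule eqI[OF closed[OF A one] A])
    fix i j assume ij: "i < n" "j < n"
    have "(A \<otimes>\<^bsub>?M\<^esub> \<one>\<^bsub>?M\<^esub>) (i, j) = (\<Oplus>k\<in>{..<n}. if j = k then A (i, k) else \<zero>)"
      using ij app[OF A] by (simp add: mat_monoid_app) (intro finsum_cong', auto simp: one_app)
    also have "\<dots> = A (i, j)" using ij app[OF A] by (intro finsum_singleton) auto
    finally show "(A \<otimes>\<^bsub>?M\<^esub> \<one>\<^bsub>?M\<^esub>) (i, j) = A (i, j)" .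
  qed
  show "A \<otimes>\<^bsub>?M\<^esub> B \<otimes>\<^bsub>?M\<^esub> C = A \<otimes>\<^bsub>?M\<^esub> (B \<otimes>\<^bsub>?M\<^esub> C)"
    if A: "A \<in> carrier ?M" and B: "B \<in> carrier ?M" and C: "C \<in> carrier ?M" for A B C
  proof (rule eqI)
    fix i j assume ij: "i < n" "j < n"
    note app = app[OF A] app[OF B] app[OF C]
    have "(A \<otimes>\<^bsub>?M\<^esub> B \<otimes>\<^bsub>?M\<^esub> C) (i, j)
        = (\<Oplus>k\<in>{..<n}. (\<Oplus>l\<in>{..<n}. A (i, l) \<otimes> B (l, k)) \<otimes> C (k, j))"
      using ij app by (simp add: mat_monoid_app) (intro finsum_cong', auto simp: mat_monoid_app intro!: finsum_closed)
    also have "\<dots> = (\<Oplus>k\<in>{..<n}. \<Oplus>l\<in>{..<n}. A (i, l) \<otimes> B (l, k) \<otimes> C (k, j))"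
      using ij app by (intro finsum_cong') (auto intro!: finsum_closed finsum_ldistr)
    also have "\<dots> = (\<Oplus>l\<in>{..<n}. \<Oplus>k\<in>{..<n}. A (i, l) \<otimes> B (l, k) \<otimes> C (k, j))"
      using ij app by (intro finsum_swap) auto
    also have "\<dots> = (\<Oplus>l\<in>{..<n}. \<Oplus>k\<in>{..<n}. A (i, l) \<otimes> (B (l, k) \<otimes> C (k, j)))"
      using ij app by (intro finsum_cong') (auto intro!: finsum_closed finsum_cong' simp: m_assoc)
    also have "\<dots> = (\<Oplus>l\<in>{..<n}. A (i, l) \<otimes> (\<Oplus>k\<in>{..<n}. B (l, k) \<otimes> C (k, j)))"
      using ij app by (intro finsum_cong') (auto intro!: finsum_closed finsum_rdistr[symmetric])
    also have "\<dots> = (A \<otimes>\<^bsub>?M\<^esub> (B \<otimes>\<^bsub>?M\<^esub> C)) (i, j)"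
      using ij app by (simp add: mat_monoid_app) (intro finsum_cong', auto simp: mat_monoid_app intro!: finsum_closed)
    finally show "(A \<otimes>\<^bsub>?M\<^esub> B \<otimes>\<^bsub>?M\<^esub> C) (i, j) = (A \<otimes>\<^bsub>?M\<^esub> (B \<otimes>\<^bsub>?M\<^esub> C)) (i, j)" .
  qed (use A B C closed in auto)
qed

context finite_group_algebra
begin

text \<open>
  The extension of a linear character. It is the representation of dimension one, but with values in
  the ring rather than in one-by-one matrices.
\<close>

definition char_ext :: "('c \<Rightarrow> 'a) \<Rightarrow> ('c \<Rightarrow> 'a) \<Rightarrow> 'a"
  where "char_ext \<chi> f = (\<Oplus>y\<in>carrier G. f y \<otimes> \<chi> y)"

lemma char_ext_ring_hom:
  assumes "cring R" and \<chi>: "\<chi> \<in> hom G R" "\<chi> \<one>\<^bsub>G\<^esub> = \<one>"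
  shows "char_ext \<chi> \<in> ring_hom KG R"
proof -
  let ?\<rho> = "\<lambda>y. \<lambda>(i, j)\<in>{..<1::nat} \<times> {..<1::nat}. \<chi> y"
  have closed: "\<chi> y \<in> carrier R" if "y \<in> carrier G" for y
    using \<chi>(1) that unfolding hom_def by auto
  interpret E: finite_group_matrix_rep R G R id 1 ?\<rho>
  proof (intro finite_group_matrix_rep.intro finite_group_matrix_rep_axioms.intro)
    show "finite_group_algebra R G" by (rule finite_group_algebra_axioms)
    show "cring R" by fact
    show "id \<in> ring_hom R R" by (auto simp: ring_hom_def)
    show "?\<rho> \<in> hom G (mat_monoid 1 R)"
    proof (rule homI)
      show "?\<rho> y \<in> carrier (mat_monoid 1 R)" if "y \<in> carrier G" for y
        using closed[OF that] unfolding carrier_mat_monoid by auto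
      show "?\<rho> (y \<otimes>\<^bsub>G\<^esub> z) = ?\<rho> y \<otimes>\<^bsub>mat_monoid 1 R\<^esub> ?\<rho> z" if yz: "y \<in> carrier G" "z \<in> carrier G" for y z
        using closed[OF yz(1)] closed[OF yz(2)] hom_mult[OF \<chi>(1) yz]
        by (simp add: mat_monoid_def fun_eq_iff restrict_def lessThan_Suc)
    qed
    show "?\<rho> \<one>\<^bsub>G\<^esub> = \<one>\<^bsub>mat_monoid 1 R\<^esub>"
      using \<chi>(2) by (auto simp: mat_monoid_def fun_eq_iff restrict_def)
  qed
  have ext: "E.ext f (0, 0) = char_ext \<chi> f" for f
    unfolding char_ext_def by (subst E.ext_app) simp_all
  show ?thesis
  proof (rule ring_hom_memI)
    fix f assume f: "f \<in> carrier KG"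
    show "char_ext \<chi> f \<in> carrier R"
      unfolding char_ext_def using f closed by (intro R.finsum_closed) auto
    fix h assume h: "h \<in> carrier KG"
    have "E.ext h (0, 0) \<in> carrier R" "E.ext f (0, 0) \<in> carrier R"
      using E.ext_closed[OF h] E.ext_closed[OF f] unfolding carrier_mat_monoid by auto
    then show "char_ext \<chi> (f \<otimes>\<^bsub>KG\<^esub> h) = char_ext \<chi> f \<otimes> char_ext \<chi> h"
      unfolding ext[symmetric] E.ext_mult[OF f h] by (simp add: mat_monoid_app lessThan_Suc)
    show "char_ext \<chi> (f \<oplus>\<^bsub>KG\<^esub> h) = char_ext \<chi> f \<oplus> char_ext \<chi> h"
      unfolding ext[symmetric] by (rule E.ext_add_app[OF f h]) simp_all
  next
    show "char_ext \<chi> \<one>\<^bsub>KG\<^esub> = \<one>"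
      unfolding ext[symmetric] E.ext_one by (simp add: mat_monoid_def)
  qed
qed

lemma mult_scalar_app:
  assumes "c \<in> carrier R" "h \<in> carrier KG" "z \<in> carrier G"
  shows "(h \<otimes>\<^bsub>KG\<^esub> scalar c) z = h z \<otimes> c"
proof -
  have "inv\<^bsub>G\<^esub> y \<otimes>\<^bsub>G\<^esub> z = \<one>\<^bsub>G\<^esub> \<longleftrightarrow> y = z" if "y \<in> carrier G" for y
    using that assms(3) by (metis G.inv_closed G.inv_equality G.inv_inv G.l_inv)
  then have "(h \<otimes>\<^bsub>KG\<^esub> scalar c) z = (\<Oplus>y\<in>carrier G. if y = z then h y \<otimes> c else \<zero>)"
    using assms by (simp add: mult_KG_app) (intro R.finsum_cong', auto simp: scalar_def)
  also have "\<dots> = h z \<otimes> c"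
    using assms finite_group by (subst finsum_delta) auto
  finally show ?thesis .
qed

lemma scalar_ring_hom: "scalar \<in> ring_hom R KG"
proof (rule ring_hom_memI)
  fix c assume c: "c \<in> carrier R"
  show "scalar c \<in> carrier KG" using c by (rule scalar_closed)
  fix d assume d: "d \<in> carrier R"
  show "scalar (c \<otimes> d) = scalar c \<otimes>\<^bsub>KG\<^esub> scalar d"
    by (rule KG_eqI) (use c d in \<open>simp_all add: scalar_mult_app\<close>, simp add: scalar_def)
  show "scalar (c \<oplus> d) = scalar c \<oplus>\<^bsub>KG\<^esub> scalar d"
    by (rule KG_eqI) (use c d in \<open>simp_all add: add_KG_app add_KG_closed\<close>, simp add: scalar_def)
next
  show "scalar \<one> = \<one>\<^bsub>KG\<^esub>" by (simp add: scalar_def group_algebra_def)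
qed

text \<open>
  A function on a finite group is a sum of scalar multiples of basis elements, built up one group
  element at a time.
\<close>

lemma KG_generated:
  assumes "scalar ` carrier R \<subseteq> P" "basis ` carrier G \<subseteq> P"
    and "\<And>f h. f \<in> P \<Longrightarrow> h \<in> P \<Longrightarrow> f \<oplus>\<^bsub>KG\<^esub> h \<in> P" "\<And>f h. f \<in> P \<Longrightarrow> h \<in> P \<Longrightarrow> f \<otimes>\<^bsub>KG\<^esub> h \<in> P"
  shows "carrier KG \<subseteq> P"
proof
  fix f assume f: "f \<in> carrier KG"
  let ?cut = "\<lambda>A. \<lambda>z\<in>carrier G. if z \<in> A then f z else \<zero>"
  have cut: "?cut A \<in> carrier KG" for A
    using KG_app[OF f] unfolding carrier_KG by auto
  have "?cut A \<in> P" if "finite A" "A \<subseteq> carrier G" for A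
    using that
  proof (induction A rule: finite_induct)
    case empty
    have "?cut {} = scalar \<zero>" by (auto simp: scalar_def fun_eq_iff restrict_def)
    then show ?case using assms(1) by auto
  next
    case (insert g A)
    have g: "g \<in> carrier G" using insert by simp
    have fg: "f g \<in> carrier R" using KG_app[OF f g] .
    have "?cut (insert g A) = ?cut A \<oplus>\<^bsub>KG\<^esub> scalar (f g) \<otimes>\<^bsub>KG\<^esub> basis g"
    proof (rule KG_eqI)
      fix z assume z: "z \<in> carrier G"
      show "?cut (insert g A) z = (?cut A \<oplus>\<^bsub>KG\<^esub> scalar (f g) \<otimes>\<^bsub>KG\<^esub> basis g) z"
        using z insert fg KG_app[OF f z]
        by (simp add: add_KG_app scalar_mult_app) (simp add: basis_def)
    next
      show "?cut (insert g A) \<in> carrier KG" by (rule cut)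
      show "?cut A \<oplus>\<^bsub>KG\<^esub> scalar (f g) \<otimes>\<^bsub>KG\<^esub> basis g \<in> carrier KG"
        by (intro add_KG_closed cut mult_KG_closed scalar_closed basis_closed fg)
    qed
    moreover have "scalar (f g) \<in> P" "basis g \<in> P" using assms(1,2) fg g by blast+
    moreover have "?cut A \<in> P" by (rule insert.IH) (use insert.prems in simp)
    ultimately show ?case using assms(3)[OF _ assms(4)] by (simp only:)
  qed
  from this[OF finite_group] have "?cut (carrier G) \<in> P" by simp
  moreover have "?cut (carrier G) = f"
    by (rule KG_eqI) (use f cut in auto)
  ultimately show "f \<in> P" by simp
qed

lemma basis_pow: "g \<in> carrier G \<Longrightarrow> basis g [^]\<^bsub>KG\<^esub> (n::nat) = basis (g [^]\<^bsub>G\<^esub> n)"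
  by (induction n) (simp_all add: basis_one basis_mult)

end

section \<open>The group algebra of the quasidihedral group in characteristic two\<close>

lemma (in cring) trivial_character_QD16: "(\<lambda>_. \<one>) \<in> hom QD16 R"
  by (auto intro: homI)

text \<open>
  Repeated squaring in characteristic two gives \<open>t\<^sup>8 = 1 + a\<^sup>8 = 0\<close>. As a ring the group algebra is generated by
  scalars, \<open>a = 1 + t\<close> and \<open>x\<close>, because the basis elements are the normal forms.
\<close>

lemma qd_char2_QD16:
  assumes "field F" and two: "\<one>\<^bsub>F\<^esub> \<oplus>\<^bsub>F\<^esub> \<one>\<^bsub>F\<^esub> = \<zero>\<^bsub>F\<^esub>"
  defines "R \<equiv> group_algebra F QD16"
  shows "\<exists>\<iota> \<epsilon> t x. qd_char2 R F \<iota> \<epsilon> t x"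
proof -
  interpret F: field F by fact
  interpret A: finite_group_algebra F QD16
    by (intro finite_group_algebra.intro finite_group_algebra_axioms.intro F.ring_axioms QD.group_axioms finite_QD16)
  interpret R: ring R unfolding R_def by (rule A.ring_KG)
  define a where "a = A.basis qd_a"
  define x where "x = A.basis qd_x"
  define t where "t = \<one>\<^bsub>R\<^esub> \<oplus>\<^bsub>R\<^esub> a"
  define \<epsilon> where "\<epsilon> = A.char_ext (\<lambda>_. \<one>\<^bsub>F\<^esub>)"
  have \<iota>: "A.scalar \<in> ring_hom F R" unfolding R_def by (rule A.scalar_ring_hom)
  have \<epsilon>: "\<epsilon> \<in> ring_hom R F"
    unfolding \<epsilon>_def R_def
    by (rule A.char_ext_ring_hom[OF F.cring_axioms F.trivial_character_QD16]) simp
  have [simp]: "a \<in> carrier R" "x \<in> carrier R"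
    unfolding a_def x_def R_def by (rule A.basis_closed)+
  then have [simp]: "t \<in> carrier R" by (simp add: t_def)
  have one_one: "\<one>\<^bsub>R\<^esub> \<oplus>\<^bsub>R\<^esub> \<one>\<^bsub>R\<^esub> = \<zero>\<^bsub>R\<^esub>"
    unfolding R_def
    by (rule A.KG_eqI)
       (simp_all add: A.add_KG_closed A.one_KG_closed A.zero_KG_closed A.add_KG_app A.one_KG_app A.zero_KG_app two)
  have double [simp]: "r \<oplus>\<^bsub>R\<^esub> r = \<zero>\<^bsub>R\<^esub>" if "r \<in> carrier R" for r
    using one_one that by (metis R.l_distr R.l_null R.l_one R.one_closed)
  have cancel [simp]: "r \<oplus>\<^bsub>R\<^esub> (r \<oplus>\<^bsub>R\<^esub> s) = s" if "r \<in> carrier R" "s \<in> carrier R" for r s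
    using that by (simp flip: R.a_assoc)
  have a_pow: "a [^]\<^bsub>R\<^esub> i = A.basis (qd_elt i 0)" for i :: nat
    unfolding a_def R_def by (simp add: A.basis_pow qd_elt_def)
  have a_eq: "a = \<one>\<^bsub>R\<^esub> \<oplus>\<^bsub>R\<^esub> t" by (simp add: t_def)
  have xx: "x \<otimes>\<^bsub>R\<^esub> x = \<one>\<^bsub>R\<^esub>"
    unfolding x_def R_def using qd_relations(2) by (simp add: A.basis_mult A.basis_one numeral_2_eq_2)
  have xa: "x \<otimes>\<^bsub>R\<^esub> a = a [^]\<^bsub>R\<^esub> (3::nat) \<otimes>\<^bsub>R\<^esub> x"
  proof -
    have "qd_x \<otimes>\<^bsub>QD16\<^esub> qd_a = qd_elt 0 1 \<otimes>\<^bsub>QD16\<^esub> qd_elt 1 0"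
      by (simp add: qd_elt_def)
    also have "\<dots> = qd_a [^]\<^bsub>QD16\<^esub> (3::nat) \<otimes>\<^bsub>QD16\<^esub> qd_x"
      unfolding qd_elt_mult by (simp add: qd_elt_def)
    finally show ?thesis
      unfolding a_def x_def R_def by (simp add: A.basis_pow A.basis_mult)
  qed
  note ring_expand = R.l_distr R.r_distr R.m_assoc R.a_ac
  have x_t: "x \<otimes>\<^bsub>R\<^esub> t = (t \<oplus>\<^bsub>R\<^esub> t [^]\<^bsub>R\<^esub> (2::nat) \<oplus>\<^bsub>R\<^esub> t [^]\<^bsub>R\<^esub> (3::nat)) \<otimes>\<^bsub>R\<^esub> x"
  proof -
    have "t \<oplus>\<^bsub>R\<^esub> t [^]\<^bsub>R\<^esub> (2::nat) \<oplus>\<^bsub>R\<^esub> t [^]\<^bsub>R\<^esub> (3::nat) = \<one>\<^bsub>R\<^esub> \<oplus>\<^bsub>R\<^esub> a [^]\<^bsub>R\<^esub> (3::nat)"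
      unfolding a_eq by (simp add: ring_expand numeral_eq_Suc)
    then show ?thesis by (simp add: t_def R.r_distr R.l_distr xa)
  qed
  have sq: "(\<one>\<^bsub>R\<^esub> \<oplus>\<^bsub>R\<^esub> v) \<otimes>\<^bsub>R\<^esub> (\<one>\<^bsub>R\<^esub> \<oplus>\<^bsub>R\<^esub> v) = \<one>\<^bsub>R\<^esub> \<oplus>\<^bsub>R\<^esub> v \<otimes>\<^bsub>R\<^esub> v" if "v \<in> carrier R" for v
    using that by (simp add: ring_expand)
  have t2: "t [^]\<^bsub>R\<^esub> (2::nat) = \<one>\<^bsub>R\<^esub> \<oplus>\<^bsub>R\<^esub> a [^]\<^bsub>R\<^esub> (2::nat)"
    by (simp add: numeral_2_eq_2 t_def sq)
  have t4: "t [^]\<^bsub>R\<^esub> (4::nat) = \<one>\<^bsub>R\<^esub> \<oplus>\<^bsub>R\<^esub> a [^]\<^bsub>R\<^esub> (4::nat)"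
    using sq[of "a [^]\<^bsub>R\<^esub> (2::nat)"] R.nat_pow_mult[of t 2 2] R.nat_pow_mult[of a 2 2] by (simp add: t2)
  have t8: "t [^]\<^bsub>R\<^esub> (8::nat) = \<zero>\<^bsub>R\<^esub>"
  proof -
    have "t [^]\<^bsub>R\<^esub> (8::nat) = \<one>\<^bsub>R\<^esub> \<oplus>\<^bsub>R\<^esub> a [^]\<^bsub>R\<^esub> (8::nat)"
      using sq[of "a [^]\<^bsub>R\<^esub> (4::nat)"] R.nat_pow_mult[of t 4 4] R.nat_pow_mult[of a 4 4] by (simp add: t4)
    also have "a [^]\<^bsub>R\<^esub> (8::nat) = \<one>\<^bsub>R\<^esub>"
      unfolding a_def R_def by (simp add: A.basis_pow qd_relations A.basis_one)
    finally show ?thesis by (simp add: one_one)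
  qed
  have t7: "t [^]\<^bsub>R\<^esub> (7::nat) \<noteq> \<zero>\<^bsub>R\<^esub>"
  proof
    assume zero: "t [^]\<^bsub>R\<^esub> (7::nat) = \<zero>\<^bsub>R\<^esub>"
    \<comment> \<open>The power \<open>t\<^sup>7 = (1 + a\<^sup>4)(1 + a\<^sup>2)(1 + a)\<close> is the sum of all \<open>a\<^sup>i\<close>, so its coefficient at the
      identity is 1.\<close>
    have "t [^]\<^bsub>R\<^esub> (7::nat) = t [^]\<^bsub>R\<^esub> (4::nat) \<otimes>\<^bsub>R\<^esub> (t [^]\<^bsub>R\<^esub> (2::nat) \<otimes>\<^bsub>R\<^esub> t)"
      using R.nat_pow_mult[of t 4 3] R.nat_pow_mult[of t 2 1] by simp
    also have "\<dots> = (\<one>\<^bsub>R\<^esub> \<oplus>\<^bsub>R\<^esub> a [^]\<^bsub>R\<^esub> (4::nat)) \<otimes>\<^bsub>R\<^esub> ((\<one>\<^bsub>R\<^esub> \<oplus>\<^bsub>R\<^esub> a [^]\<^bsub>R\<^esub> (2::nat)) \<otimes>\<^bsub>R\<^esub> (\<one>\<^bsub>R\<^esub> \<oplus>\<^bsub>R\<^esub> a [^]\<^bsub>R\<^esub> (1::nat)))"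
      by (simp only: t2 t4) (simp add: t_def)
    also have "\<dots> = a [^]\<^bsub>R\<^esub> (0::nat) \<oplus>\<^bsub>R\<^esub> (a [^]\<^bsub>R\<^esub> (1::nat) \<oplus>\<^bsub>R\<^esub> (a [^]\<^bsub>R\<^esub> (2::nat) \<oplus>\<^bsub>R\<^esub> (a [^]\<^bsub>R\<^esub> (3::nat)
        \<oplus>\<^bsub>R\<^esub> (a [^]\<^bsub>R\<^esub> (4::nat) \<oplus>\<^bsub>R\<^esub> (a [^]\<^bsub>R\<^esub> (5::nat) \<oplus>\<^bsub>R\<^esub> (a [^]\<^bsub>R\<^esub> (6::nat) \<oplus>\<^bsub>R\<^esub> a [^]\<^bsub>R\<^esub> (7::nat)))))))"
      using R.nat_pow_mult[of a 4 1] R.nat_pow_mult[of a 4 2] R.nat_pow_mult[of a 2 1] R.nat_pow_mult[of a 4 3]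
      by (simp add: R.l_distr R.r_distr R.a_ac)
    finally have "\<dots> (qd_elt 0 0) = \<zero>\<^bsub>R\<^esub> (qd_elt 0 0)" using zero by simp
    moreover have "A.basis (qd_elt i 0) (qd_elt 0 0) = (if i = 0 then \<one>\<^bsub>F\<^esub> else \<zero>\<^bsub>F\<^esub>)" if "i < 8" for i
      using that qd_elt_inj[of 0 0 i 0] by (auto simp: A.basis_def)
    ultimately show False unfolding a_pow unfolding R_def by (simp add: A.add_KG_app A.zero_KG_app)
  qed
  have \<epsilon>_basis: "\<epsilon> (A.basis g) = \<one>\<^bsub>F\<^esub>" if "g \<in> carrier QD16" for g
  proof -
    have "\<epsilon> (A.basis g) = (\<Oplus>\<^bsub>F\<^esub>y\<in>carrier QD16. if y = g then \<one>\<^bsub>F\<^esub> else \<zero>\<^bsub>F\<^esub>)"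
      unfolding \<epsilon>_def A.char_ext_def by (intro F.finsum_cong') (auto simp: A.basis_def)
    then show ?thesis using that finite_QD16 A.finsum_delta[of g "carrier QD16" "\<lambda>_. \<one>\<^bsub>F\<^esub>"] by simp
  qed
  have \<epsilon>_scalar: "\<epsilon> (A.scalar c) = c" if c: "c \<in> carrier F" for c
  proof -
    have "\<epsilon> (A.scalar c) = (\<Oplus>\<^bsub>F\<^esub>y\<in>carrier QD16. if y = \<one>\<^bsub>QD16\<^esub> then c else \<zero>\<^bsub>F\<^esub>)"
      unfolding \<epsilon>_def A.char_ext_def using c by (intro F.finsum_cong') (auto simp: A.scalar_def)
    then show ?thesis using c finite_QD16 A.finsum_delta[of "\<one>\<^bsub>QD16\<^esub>" "carrier QD16" "\<lambda>_. c"] by simp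
  qed
  have central: "A.scalar c \<otimes>\<^bsub>R\<^esub> r = r \<otimes>\<^bsub>R\<^esub> A.scalar c" if "c \<in> carrier F" "r \<in> carrier R" for c r
    using that unfolding R_def
    by (intro A.KG_eqI) (auto simp: A.scalar_mult_app A.mult_scalar_app F.m_comm)
  have gen: "carrier R \<subseteq> P"
    if P: "A.scalar ` carrier F \<subseteq> P" "t \<in> P" "x \<in> P"
      "\<And>r s. r \<in> P \<Longrightarrow> s \<in> P \<Longrightarrow> r \<oplus>\<^bsub>R\<^esub> s \<in> P" "\<And>r s. r \<in> P \<Longrightarrow> s \<in> P \<Longrightarrow> r \<otimes>\<^bsub>R\<^esub> s \<in> P" for P
  proof -
    have "A.scalar \<one>\<^bsub>F\<^esub> = \<one>\<^bsub>R\<^esub>" using \<iota> by (auto simp: ring_hom_def)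
    then have one: "\<one>\<^bsub>R\<^esub> \<in> P" using P(1) F.one_closed by (metis image_subset_iff)
    then have aP: "a \<in> P" using P(2,4) by (simp add: a_eq)
    have pow: "r [^]\<^bsub>R\<^esub> (i::nat) \<in> P" if "r \<in> P" for r i
      by (induction i) (simp_all add: one P(5) that)
    have "A.basis g \<in> P" if g: "g \<in> carrier QD16" for g
    proof -
      obtain i j where "g = qd_elt i j" using g word_class_in_qd_elt unfolding carrier_QD16 by blast
      then have "A.basis g = a [^]\<^bsub>R\<^esub> i \<otimes>\<^bsub>R\<^esub> x [^]\<^bsub>R\<^esub> j"
        unfolding a_def x_def R_def by (simp add: A.basis_pow A.basis_mult qd_elt_def)
      then show ?thesis using pow aP P(3,5) by simp
    qed
    then show ?thesis
      unfolding R_def by (intro A.KG_generated) (use P in \<open>auto simp: R_def\<close>)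
  qed
  have "\<epsilon> t = \<zero>\<^bsub>F\<^esub>"
  proof -
    have "\<epsilon> t = \<epsilon> \<one>\<^bsub>R\<^esub> \<oplus>\<^bsub>F\<^esub> \<epsilon> a" using \<epsilon> by (simp add: t_def ring_hom_def)
    also have "\<dots> = \<one>\<^bsub>F\<^esub> \<oplus>\<^bsub>F\<^esub> \<one>\<^bsub>F\<^esub>" using \<epsilon> \<epsilon>_basis by (simp add: a_def ring_hom_def)
    finally show ?thesis using two by simp
  qed
  moreover have "\<epsilon> x = \<one>\<^bsub>F\<^esub>" unfolding x_def by (rule \<epsilon>_basis) simp
  ultimately have "qd_char2 R F A.scalar \<epsilon> t x"
    by (intro qd_char2.intro qd_char2_axioms.intro R.ring_axioms F.field_axioms)
       (use one_one \<iota> central xx x_t t8 t7 gen \<epsilon> \<epsilon>_scalar in simp_all)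
  then show ?thesis by blast
qed

section \<open>Representations of the quasidihedral group and their traces\<close>


definition mat2 :: "'a \<Rightarrow> 'a \<Rightarrow> 'a \<Rightarrow> 'a \<Rightarrow> nat \<times> nat \<Rightarrow> 'a"
  where "mat2 a b c d = (\<lambda>(i, j)\<in>{..<2} \<times> {..<2}.
    if i = 0 then (if j = 0 then a else b) else (if j = 0 then c else d))"

lemma mat2_app [simp]:
  "mat2 a b c d (0, 0) = a" "mat2 a b c d (0, Suc 0) = b"
  "mat2 a b c d (Suc 0, 0) = c" "mat2 a b c d (Suc 0, Suc 0) = d"
  by (simp_all add: mat2_def)

lemma mat2_eqI:
  assumes "A \<in> carrier (mat_monoid 2 K)" "B \<in> carrier (mat_monoid 2 K)"
    and "A (0, 0) = B (0, 0)" "A (0, 1) = B (0, 1)" "A (1, 0) = B (1, 0)" "A (1, 1) = B (1, 1)"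
  shows "A = B"
  using assms(1,2) unfolding carrier_mat_monoid
proof (rule PiE_ext)
  fix ij :: "nat \<times> nat" assume "ij \<in> {..<2} \<times> {..<2}"
  then have "ij = (0, 0) \<or> ij = (0, 1) \<or> ij = (1, 0) \<or> ij = (1, 1)"
    by (auto simp: less_2_cases_iff)
  then show "A ij = B ij" using assms(3-6) by auto
qed

context cring
begin

lemma mat2_closed [simp]:
  "a \<in> carrier R \<Longrightarrow> b \<in> carrier R \<Longrightarrow> c \<in> carrier R \<Longrightarrow> d \<in> carrier R \<Longrightarrow>
    mat2 a b c d \<in> carrier (mat_monoid 2 R)"
  unfolding carrier_mat_monoid mat2_def by auto

lemma mat2_one: "\<one>\<^bsub>mat_monoid 2 R\<^esub> = mat2 \<one> \<zero> \<zero> \<one>"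
proof (rule mat2_eqI[of _ R])
  show "\<one>\<^bsub>mat_monoid 2 R\<^esub> \<in> carrier (mat_monoid 2 R)"
    by (rule monoid.one_closed[OF monoid_mat_monoid])
  show "mat2 \<one> \<zero> \<zero> \<one> \<in> carrier (mat_monoid 2 R)" by simp
qed (simp_all add: mat_monoid_def)

lemma finsum_lessThan_2:
  assumes "f 0 \<in> carrier R" "f (Suc 0) \<in> carrier R"
  shows "(\<Oplus>k\<in>{..<2}. f k) = f 0 \<oplus> f (Suc 0)"
proof -
  have "{..<2} = {0, Suc 0}" by auto
  then show ?thesis using assms by simp
qed

lemma mat2_mult:
  assumes "a \<in> carrier R" "b \<in> carrier R" "c \<in> carrier R" "d \<in> carrier R"
    and "a' \<in> carrier R" "b' \<in> carrier R" "c' \<in> carrier R" "d' \<in> carrier R"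
  shows "mat2 a b c d \<otimes>\<^bsub>mat_monoid 2 R\<^esub> mat2 a' b' c' d'
    = mat2 (a \<otimes> a' \<oplus> b \<otimes> c') (a \<otimes> b' \<oplus> b \<otimes> d') (c \<otimes> a' \<oplus> d \<otimes> c') (c \<otimes> b' \<oplus> d \<otimes> d')"
proof (rule mat2_eqI[of _ R])
  show "mat2 a b c d \<otimes>\<^bsub>mat_monoid 2 R\<^esub> mat2 a' b' c' d' \<in> carrier (mat_monoid 2 R)"
    using assms by (intro monoid.m_closed[OF monoid_mat_monoid] mat2_closed)
qed (use assms in \<open>simp_all add: mat_monoid_app finsum_lessThan_2\<close>)

lemma finsum_QD16_fold:
  assumes f: "\<And>k l. f (qd_elt k l) \<in> carrier R"
  shows "(\<Oplus>g\<in>carrier QD16. f g) =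
    (\<Oplus>k\<in>{..<4}. f (qd_elt k 0) \<oplus> f (qd_elt (4 + k) 0)) \<oplus> (\<Oplus>k\<in>{..<4}. f (qd_elt k 1) \<oplus> f (qd_elt (4 + k) 1))"
proof -
  have fold: "(\<Oplus>k\<in>{..<8}. f (qd_elt k l)) = (\<Oplus>k\<in>{..<4}. f (qd_elt k l) \<oplus> f (qd_elt (4 + k) l))" for l
  proof -
    have "{..<8} = {..<4} \<union> (\<lambda>k. 4 + k) ` {..<4::nat}"
    proof (intro equalityI subsetI)
      fix k :: nat assume "k \<in> {..<8}"
      then have "k < 4 \<or> k = 4 + (k - 4) \<and> k - 4 < 4" by auto
      then show "k \<in> {..<4} \<union> (\<lambda>k. 4 + k) ` {..<4}" by blast
    qed auto
    then have "(\<Oplus>k\<in>{..<8}. f (qd_elt k l))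
        = (\<Oplus>k\<in>{..<4}. f (qd_elt k l)) \<oplus> (\<Oplus>k\<in>(\<lambda>k. 4 + k) ` {..<4}. f (qd_elt k l))"
      by (simp only:) (rule finsum_Un_disjoint, use f in auto)
    also have "(\<Oplus>k\<in>(\<lambda>k. 4 + k) ` {..<4}. f (qd_elt k l)) = (\<Oplus>k\<in>{..<4}. f (qd_elt (4 + k) l))"
      by (rule finsum_reindex) (use f in auto)
    finally show ?thesis using f by (simp add: finsum_addf)
  qed
  have "f g \<in> carrier R" if "g \<in> carrier QD16" for g
    using that f word_class_in_qd_elt unfolding carrier_QD16 by (metis imageE)
  then show ?thesis by (simp add: finsum_QD16 fold del: One_nat_def)
qed

lemma finsum_lessThan_4:
  assumes "\<And>k::nat. f k \<in> carrier R"
  shows "(\<Oplus>k\<in>{..<4}. f k) = f 0 \<oplus> f 1 \<oplus> f 2 \<oplus> f 3"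
proof -
  have "{..<4} = {0, 1, 2, 3::nat}" by auto
  then show ?thesis using assms by (simp add: a_ac)
qed

lemma finsum_lessThan_8:
  fixes f :: "nat \<Rightarrow> 'a"
  assumes f: "\<And>k. k < 8 \<Longrightarrow> f k \<in> carrier R"
  shows "(\<Oplus>k\<in>{..<8}. f k) = f 0 \<oplus> f 1 \<oplus> f 2 \<oplus> f 3 \<oplus> f 4 \<oplus> f 5 \<oplus> f 6 \<oplus> f 7"
proof -
  have c: "f 0 \<in> carrier R" "f 1 \<in> carrier R" "f 2 \<in> carrier R" "f 3 \<in> carrier R"
    "f 4 \<in> carrier R" "f 5 \<in> carrier R" "f 6 \<in> carrier R" "f 7 \<in> carrier R"
    by (simp_all add: f)
  have "{..<8} = {0, 1, 2, 3, 4, 5, 6, 7::nat}" by auto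
  then show ?thesis using c by (simp add: a_ac)
qed

end

lemma finite_group_algebra_QD16: "ring F \<Longrightarrow> finite_group_algebra F QD16"
  by (intro finite_group_algebra.intro finite_group_algebra_axioms.intro QD.group_axioms finite_QD16)

lemma (in finite_group_algebra) translate_app:
  "g \<in> carrier G \<Longrightarrow> f \<in> carrier KG \<Longrightarrow> z \<in> carrier G \<Longrightarrow>
    (basis (inv\<^bsub>G\<^esub> g) \<otimes>\<^bsub>KG\<^esub> f) z = f (g \<otimes>\<^bsub>G\<^esub> z)"
  by (simp add: basis_mult_app)

text \<open>
  If the extension vanishes on an element, it vanishes on all left translates of it. Taking traces, a
  representation turns into linear relations between the coefficients around an arbitrary \<open>g\<close>.
\<close>

lemma (in finite_group_matrix_rep) ext_kernel_translate:
  assumes f: "f \<in> carrier KG" and h: "h \<in> carrier KG" and eq: "ext f = ext h"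
    and g: "g \<in> carrier G" and ij: "i < n" "j < n"
  shows "(\<Oplus>\<^bsub>K\<^esub>y\<in>carrier G. \<phi> ((f \<ominus>\<^bsub>KG\<^esub> h) (g \<otimes>\<^bsub>G\<^esub> y)) \<otimes>\<^bsub>K\<^esub> \<rho> y (i, j)) = \<zero>\<^bsub>K\<^esub>"
proof -
  interpret A: ring KG by (rule ring_KG)
  let ?b = "basis (inv\<^bsub>G\<^esub> g)"
  have "f = (f \<ominus>\<^bsub>KG\<^esub> h) \<oplus>\<^bsub>KG\<^esub> h"
    using f h by (simp add: A.minus_eq A.a_assoc A.l_neg)
  then have "?b \<otimes>\<^bsub>KG\<^esub> f = ?b \<otimes>\<^bsub>KG\<^esub> (f \<ominus>\<^bsub>KG\<^esub> h) \<oplus>\<^bsub>KG\<^esub> ?b \<otimes>\<^bsub>KG\<^esub> h"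
    using f h by (metis A.minus_closed A.r_distr basis_closed)
  moreover have "ext (?b \<otimes>\<^bsub>KG\<^esub> f) = ext (?b \<otimes>\<^bsub>KG\<^esub> h)"
    using f h eq by (simp add: ext_mult)
  ultimately have "ext (?b \<otimes>\<^bsub>KG\<^esub> h) (i, j)
      = ext (?b \<otimes>\<^bsub>KG\<^esub> (f \<ominus>\<^bsub>KG\<^esub> h)) (i, j) \<oplus>\<^bsub>K\<^esub> ext (?b \<otimes>\<^bsub>KG\<^esub> h) (i, j)"
    using ext_add_app[of "?b \<otimes>\<^bsub>KG\<^esub> (f \<ominus>\<^bsub>KG\<^esub> h)" "?b \<otimes>\<^bsub>KG\<^esub> h" i j] f h ij by simp
  moreover have "ext k (i, j) \<in> carrier K" if "k \<in> carrier KG" for k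
    using ext_closed[OF that] ij unfolding carrier_mat_monoid by auto
  ultimately have "ext (?b \<otimes>\<^bsub>KG\<^esub> (f \<ominus>\<^bsub>KG\<^esub> h)) (i, j) = \<zero>\<^bsub>K\<^esub>"
    using f h by (metis A.minus_closed A.m_closed K.add.r_cancel_one' basis_closed)
  moreover have "ext (?b \<otimes>\<^bsub>KG\<^esub> (f \<ominus>\<^bsub>KG\<^esub> h)) (i, j)
      = (\<Oplus>\<^bsub>K\<^esub>y\<in>carrier G. \<phi> ((f \<ominus>\<^bsub>KG\<^esub> h) (g \<otimes>\<^bsub>G\<^esub> y)) \<otimes>\<^bsub>K\<^esub> \<rho> y (i, j))"
    unfolding ext_app[OF ij] using f h g ij by (intro K.finsum_cong') (auto simp: translate_app)
  ultimately show ?thesis by simp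
qed

lemma (in finite_group_algebra) char_ext_kernel_translate:
  assumes "cring R" and \<chi>: "\<chi> \<in> hom G R" "\<chi> \<one>\<^bsub>G\<^esub> = \<one>"
    and f: "f \<in> carrier KG" and h: "h \<in> carrier KG" and eq: "char_ext \<chi> f = char_ext \<chi> h"
    and g: "g \<in> carrier G"
  shows "(\<Oplus>y\<in>carrier G. (f \<ominus>\<^bsub>KG\<^esub> h) (g \<otimes>\<^bsub>G\<^esub> y) \<otimes> \<chi> y) = \<zero>"
proof -
  interpret A: ring KG by (rule ring_KG)
  interpret X: ring_hom_ring KG R "char_ext \<chi>"
    by (rule ring_hom_ringI2[OF ring_KG R.ring_axioms char_ext_ring_hom[OF assms(1) \<chi>]])
  have c: "y \<in> carrier G \<Longrightarrow> \<chi> y \<in> carrier R" for y using \<chi>(1) by (auto simp: hom_def)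
  have "(\<Oplus>y\<in>carrier G. (f \<ominus>\<^bsub>KG\<^esub> h) (g \<otimes>\<^bsub>G\<^esub> y) \<otimes> \<chi> y)
      = char_ext \<chi> (basis (inv\<^bsub>G\<^esub> g) \<otimes>\<^bsub>KG\<^esub> (f \<ominus>\<^bsub>KG\<^esub> h))"
    unfolding char_ext_def using f h g c KG_app[OF A.minus_closed[OF f h]]
    by (intro R.finsum_cong') (auto simp: translate_app)
  also have "\<dots> = \<zero>"
    using f h eq by (simp add: A.minus_eq R.r_neg)
  finally show ?thesis .
qed

lemma (in domain) sum_diff_zero:
  assumes two: "\<guillemotleft>2\<guillemotright> \<noteq> \<zero>" and yz [simp]: "y \<in> carrier R" "z \<in> carrier R"
    and e: "y \<oplus> z = \<zero>" "y \<ominus> z = \<zero>"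
  shows "y = \<zero> \<and> z = \<zero>"
proof -
  have "\<guillemotleft>2\<guillemotright> \<otimes> y = (y \<oplus> z) \<oplus> (y \<ominus> z)"
    unfolding of_int_2 using yz by algebra
  also have "\<dots> = \<zero>" unfolding e by simp
  finally have "y = \<zero>" using two by (simp add: integral_iff)
  then show ?thesis using e(1) by simp
qed

lemma (in domain) double_zero:
  "\<guillemotleft>2\<guillemotright> \<noteq> \<zero> \<Longrightarrow> y \<in> carrier R \<Longrightarrow> y \<oplus> y = \<zero> \<Longrightarrow> y = \<zero>"
  using integral_iff[of "\<guillemotleft>2\<guillemotright>" y] by (simp add: of_int_2 l_distr)

text \<open>
  In the irreducible representations of degree two, \<open>a\<^sup>4\<close> is a scalar \<open>e = \<plusminus>1\<close> and the elements \<open>a\<^sup>k x\<close> have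
  trace zero. Hence the trace relation involves the coefficients at \<open>g a\<^sup>k\<close> only, and those at \<open>g a\<^sup>k\<close> and
  \<open>g a\<^sup>k\<^sup>+\<^sup>4\<close> occur in the combination \<open>m k\<close>.
\<close>

lemma (in cring) QD16_matrix_rep:
  assumes F: "cring F" and \<phi>: "\<phi> \<in> ring_hom F R" and e: "e \<in> carrier R" "e \<otimes> e = \<one>"
  defines "M \<equiv> mat_monoid 2 R" and "A \<equiv> group_algebra F QD16"
  assumes a: "a \<in> carrier M" and x: "x \<in> carrier M" and a4: "a [^]\<^bsub>M\<^esub> (4::nat) = mat2 e \<zero> \<zero> e"
    and x2: "x \<otimes>\<^bsub>M\<^esub> x = \<one>\<^bsub>M\<^esub>" and rel: "x \<otimes>\<^bsub>M\<^esub> a \<otimes>\<^bsub>M\<^esub> x = a [^]\<^bsub>M\<^esub> (3::nat)"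
    and reflection: "\<And>k::nat. k < 4 \<Longrightarrow> (a [^]\<^bsub>M\<^esub> k \<otimes>\<^bsub>M\<^esub> x) (0, 0) \<oplus> (a [^]\<^bsub>M\<^esub> k \<otimes>\<^bsub>M\<^esub> x) (1, 1) = \<zero>"
  obtains \<Phi> where "\<Phi> \<in> hom A M" "\<Phi> \<one>\<^bsub>A\<^esub> = \<one>\<^bsub>M\<^esub>"
    "\<And>f h g. f \<in> carrier A \<Longrightarrow> h \<in> carrier A \<Longrightarrow> \<Phi> f = \<Phi> h \<Longrightarrow> g \<in> carrier QD16 \<Longrightarrow>
      (let m = \<lambda>k. \<phi> ((f \<ominus>\<^bsub>A\<^esub> h) (g \<otimes>\<^bsub>QD16\<^esub> qd_elt k 0)) \<oplus> e \<otimes> \<phi> ((f \<ominus>\<^bsub>A\<^esub> h) (g \<otimes>\<^bsub>QD16\<^esub> qd_elt (4 + k) 0));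
           tr = \<lambda>k::nat. (a [^]\<^bsub>M\<^esub> k) (0, 0) \<oplus> (a [^]\<^bsub>M\<^esub> k) (1, 1)
       in m 0 \<otimes> tr 0 \<oplus> m 1 \<otimes> tr 1 \<oplus> m 2 \<otimes> tr 2 \<oplus> m 3 \<otimes> tr 3 = \<zero>)"
proof -
  interpret M: monoid M unfolding M_def by (rule monoid_mat_monoid)
  have "a [^]\<^bsub>M\<^esub> (8::nat) = mat2 e \<zero> \<zero> e \<otimes>\<^bsub>M\<^esub> mat2 e \<zero> \<zero> e"
    using M.nat_pow_mult[OF a, of 4 4] by (simp add: a4)
  also have "\<dots> = \<one>\<^bsub>M\<^esub>" using e by (simp add: M_def mat2_mult mat2_one)
  finally have a8: "a [^]\<^bsub>M\<^esub> (8::nat) = \<one>\<^bsub>M\<^esub>" .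
  have x2': "x [^]\<^bsub>M\<^esub> (2::nat) = \<one>\<^bsub>M\<^esub>" using x x2 by (simp add: numeral_2_eq_2)
  obtain \<rho> where hom: "\<rho> \<in> hom QD16 M" and \<rho>: "\<And>i j. \<rho> (qd_elt i j) = a [^]\<^bsub>M\<^esub> i \<otimes>\<^bsub>M\<^esub> x [^]\<^bsub>M\<^esub> j"
    using M.QD16_rep_exists[OF a x a8 x2' rel] by blast
  interpret E: finite_group_matrix_rep F QD16 R \<phi> 2 \<rho>
  proof (intro finite_group_matrix_rep.intro finite_group_matrix_rep_axioms.intro finite_group_algebra_QD16)
    show "\<rho> \<one>\<^bsub>QD16\<^esub> = \<one>\<^bsub>mat_monoid 2 R\<^esub>"
      using \<rho>[of 0 0] by (simp add: qd_elt_def M_def[symmetric])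
    show "\<rho> \<in> hom QD16 (mat_monoid 2 R)" using hom by (simp add: M_def)
  qed (use F \<phi> cring.axioms(1) cring_axioms in auto)
  interpret A: ring A unfolding A_def by (rule E.ring_KG)
  let ?tr = "\<lambda>y. \<rho> y (0, 0) \<oplus> \<rho> y (1, 1)"
  have tr [simp]: "?tr y \<in> carrier R" if "y \<in> carrier QD16" for y using that by simp
  have period: "?tr (qd_elt (4 + k) l) = e \<otimes> ?tr (qd_elt k l)" for k l
  proof -
    have "\<rho> (qd_elt (4 + k) l) = mat2 e \<zero> \<zero> e \<otimes>\<^bsub>M\<^esub> \<rho> (qd_elt k l)"
      unfolding \<rho> a4[symmetric] using a x by (simp add: M.m_assoc[symmetric] M.nat_pow_mult)
    moreover have "\<rho> (qd_elt k l) (i, j) \<in> carrier R" if "i < 2" "j < 2" for i j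
      using that by simp
    ultimately show ?thesis
      using e(1) by (simp add: M_def mat_monoid_app finsum_lessThan_2 r_distr)
  qed
  have tr0: "?tr (qd_elt k 0) = (a [^]\<^bsub>M\<^esub> k) (0, 0) \<oplus> (a [^]\<^bsub>M\<^esub> k) (1, 1)" for k
    using a by (simp add: \<rho>)
  have tr1: "?tr (qd_elt k 1) = \<zero>" if "k < 4" for k
    using reflection[OF that] x by (simp add: \<rho>)
  show ?thesis
  proof (rule that[of E.ext])
    show "E.ext \<in> hom A M"
      using E.ext_closed E.ext_mult by (intro homI) (simp_all add: A_def M_def)
    show "E.ext \<one>\<^bsub>A\<^esub> = \<one>\<^bsub>M\<^esub>" using E.ext_one by (simp only: A_def M_def)
    fix f h g
    assume f: "f \<in> carrier A" and h: "h \<in> carrier A" and eq: "E.ext f = E.ext h" and g: "g \<in> carrier QD16"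
    define d where "d y = \<phi> ((f \<ominus>\<^bsub>A\<^esub> h) (g \<otimes>\<^bsub>QD16\<^esub> y))" for y
    have d [simp]: "d y \<in> carrier R" if "y \<in> carrier QD16" for y
      unfolding d_def using f h g that E.KG_app[of "f \<ominus>\<^bsub>A\<^esub> h"] by (intro E.hom_closed) (simp add: A_def[symmetric])
    have entry: "(\<Oplus>y\<in>carrier QD16. d y \<otimes> \<rho> y (i, i)) = \<zero>" if "i < 2" for i
      using E.ext_kernel_translate[of f h g i i] f h eq g that by (simp add: A_def d_def)
    have "(\<Oplus>y\<in>carrier QD16. d y \<otimes> ?tr y)
        = (\<Oplus>y\<in>carrier QD16. d y \<otimes> \<rho> y (0, 0) \<oplus> d y \<otimes> \<rho> y (1, 1))"
      by (rule finsum_cong') (auto simp: r_distr)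
    also have "\<dots> = (\<Oplus>y\<in>carrier QD16. d y \<otimes> \<rho> y (0, 0)) \<oplus> (\<Oplus>y\<in>carrier QD16. d y \<otimes> \<rho> y (1, 1))"
      by (rule finsum_addf) auto
    finally have "(\<Oplus>y\<in>carrier QD16. d y \<otimes> ?tr y) = \<zero>" using entry by simp
    then have sum: "(\<Oplus>k\<in>{..<4}. d (qd_elt k 0) \<otimes> ?tr (qd_elt k 0) \<oplus> d (qd_elt (4 + k) 0) \<otimes> ?tr (qd_elt (4 + k) 0))
        \<oplus> (\<Oplus>k\<in>{..<4}. d (qd_elt k 1) \<otimes> ?tr (qd_elt k 1) \<oplus> d (qd_elt (4 + k) 1) \<otimes> ?tr (qd_elt (4 + k) 1)) = \<zero>"
      by (subst (asm) finsum_QD16_fold) simp_all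
    have z: "(\<Oplus>k\<in>{..<4}. d (qd_elt k 1) \<otimes> ?tr (qd_elt k 1) \<oplus> d (qd_elt (4 + k) 1) \<otimes> ?tr (qd_elt (4 + k) 1))
        = (\<Oplus>k\<in>{..<4::nat}. \<zero>)"
      by (rule finsum_cong') (use e(1) in \<open>simp_all only: period tr1 lessThan_iff, simp_all\<close>)
    have c: "d (qd_elt k 0) \<otimes> ?tr (qd_elt k 0) \<oplus> d (qd_elt (4 + k) 0) \<otimes> ?tr (qd_elt (4 + k) 0)
        = (d (qd_elt k 0) \<oplus> e \<otimes> d (qd_elt (4 + k) 0)) \<otimes> ?tr (qd_elt k 0)" for k
      unfolding period using e(1) tr[of "qd_elt k 0"] by (simp add: l_distr m_ac del: tr)
    have "(\<Oplus>k\<in>{..<4}. (d (qd_elt k 0) \<oplus> e \<otimes> d (qd_elt (4 + k) 0)) \<otimes> ?tr (qd_elt k 0)) = \<zero>"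
      using sum unfolding z c using e(1) by (simp del: finsum_addf)
    then show "let m = \<lambda>k. \<phi> ((f \<ominus>\<^bsub>A\<^esub> h) (g \<otimes>\<^bsub>QD16\<^esub> qd_elt k 0)) \<oplus> e \<otimes> \<phi> ((f \<ominus>\<^bsub>A\<^esub> h) (g \<otimes>\<^bsub>QD16\<^esub> qd_elt (4 + k) 0));
           tr = \<lambda>k::nat. (a [^]\<^bsub>M\<^esub> k) (0, 0) \<oplus> (a [^]\<^bsub>M\<^esub> k) (1, 1)
       in m 0 \<otimes> tr 0 \<oplus> m 1 \<otimes> tr 1 \<oplus> m 2 \<otimes> tr 2 \<oplus> m 3 \<otimes> tr 3 = \<zero>"
      unfolding Let_def d_def[symmetric] tr0[symmetric] using e(1) by (subst (asm) finsum_lessThan_4) simp_all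
  qed
qed

lemma (in monoid) nat_pow_step:
  assumes "a \<in> carrier G"
  shows "a [^] (2::nat) = a \<otimes> a" "a [^] (3::nat) = a [^] (2::nat) \<otimes> a" "a [^] (4::nat) = a [^] (3::nat) \<otimes> a"
  using assms by (simp_all add: numeral_eq_Suc)

lemma (in cring) nat_pow_mat2:
  assumes "a \<in> carrier (mat_monoid 2 R)"
  shows "a [^]\<^bsub>mat_monoid 2 R\<^esub> (0::nat) = mat2 \<one> \<zero> \<zero> \<one>" "a [^]\<^bsub>mat_monoid 2 R\<^esub> (1::nat) = a"
    "a [^]\<^bsub>mat_monoid 2 R\<^esub> (2::nat) = a \<otimes>\<^bsub>mat_monoid 2 R\<^esub> a"
    "a [^]\<^bsub>mat_monoid 2 R\<^esub> (3::nat) = a [^]\<^bsub>mat_monoid 2 R\<^esub> (2::nat) \<otimes>\<^bsub>mat_monoid 2 R\<^esub> a"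
    "a [^]\<^bsub>mat_monoid 2 R\<^esub> (4::nat) = a [^]\<^bsub>mat_monoid 2 R\<^esub> (3::nat) \<otimes>\<^bsub>mat_monoid 2 R\<^esub> a"
  using monoid.nat_pow_step[OF monoid_mat_monoid assms] monoid.nat_pow_eone[OF monoid_mat_monoid assms]
  by (simp_all add: mat2_one)

text \<open>
  The matrix \<open>a\<close> is the companion matrix of \<open>X\<^sup>2 - sX - 1\<close>, whose roots in an extension field are primitive
  eighth roots of unity \<open>z\<close> and \<open>z\<^sup>3\<close> with \<open>z + z\<^sup>3 = s\<close>; the involution \<open>x\<close> interchanges the eigenspaces. The traces of
  \<open>1, a, a\<^sup>2, a\<^sup>3\<close> are \<open>2, s, 0, s\<close> and \<open>a\<^sup>4 = -1\<close>.
\<close>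

lemma (in cring) faithful_rep:
  assumes F: "cring F" and \<phi>: "\<phi> \<in> ring_hom F R" and s: "s \<in> carrier R" "s \<otimes> s = \<ominus> \<guillemotleft>2\<guillemotright>"
  defines "M \<equiv> mat_monoid 2 R" and "A \<equiv> group_algebra F QD16"
  obtains \<Phi> where "\<Phi> \<in> hom A M" "\<Phi> \<one>\<^bsub>A\<^esub> = \<one>\<^bsub>M\<^esub>"
    "\<And>f h g. f \<in> carrier A \<Longrightarrow> h \<in> carrier A \<Longrightarrow> \<Phi> f = \<Phi> h \<Longrightarrow> g \<in> carrier QD16 \<Longrightarrow>
      (let d = \<lambda>k. (f \<ominus>\<^bsub>A\<^esub> h) (g \<otimes>\<^bsub>QD16\<^esub> qd_elt k 0) in
        \<phi> ((d 0 \<ominus>\<^bsub>F\<^esub> d 4) \<oplus>\<^bsub>F\<^esub> (d 0 \<ominus>\<^bsub>F\<^esub> d 4)) \<oplus> s \<otimes> \<phi> ((d 1 \<ominus>\<^bsub>F\<^esub> d 5) \<oplus>\<^bsub>F\<^esub> (d 3 \<ominus>\<^bsub>F\<^esub> d 7)) = \<zero>)"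
proof -
  interpret F: cring F by fact
  interpret \<phi>: ring_hom_ring F R \<phi> by (rule ring_hom_ringI2[OF F.ring_axioms ring_axioms \<phi>])
  define a where "a = mat2 \<zero> \<one> \<one> s"
  define x where "x = mat2 \<one> s \<zero> (\<ominus> \<one>)"
  have cl [simp]: "a \<in> carrier M" "x \<in> carrier M" using s(1) by (simp_all add: a_def x_def M_def)
  have ss1: "\<one> \<oplus> s \<otimes> s = \<ominus> \<one>" unfolding s(2) of_int_2 by algebra
  then have ss2: "s \<otimes> s \<oplus> \<one> = \<ominus> \<one>" using s(1) by (simp add: a_comm)
  have ss3: "\<ominus> (s \<otimes> s) \<oplus> \<ominus> \<one> = \<one>" unfolding s(2) of_int_2 by algebra
  note ss = ss1 ss2 ss3
  note compute = M_def mat2_mult l_minus r_minus l_neg r_neg ss s(1)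
  note pow = nat_pow_mat2[of a, folded M_def, OF cl(1)]
  have a2: "a [^]\<^bsub>M\<^esub> (2::nat) = mat2 \<one> s s (\<ominus> \<one>)" unfolding pow by (simp add: a_def compute)
  have a3: "a [^]\<^bsub>M\<^esub> (3::nat) = mat2 s (\<ominus> \<one>) (\<ominus> \<one>) \<zero>" unfolding pow(4) a2 by (simp add: a_def compute)
  obtain \<Phi> where \<Phi>: "\<Phi> \<in> hom A M" "\<Phi> \<one>\<^bsub>A\<^esub> = \<one>\<^bsub>M\<^esub>" and
    ker: "\<And>f h g. f \<in> carrier A \<Longrightarrow> h \<in> carrier A \<Longrightarrow> \<Phi> f = \<Phi> h \<Longrightarrow> g \<in> carrier QD16 \<Longrightarrow>
      (let m = \<lambda>k. \<phi> ((f \<ominus>\<^bsub>A\<^esub> h) (g \<otimes>\<^bsub>QD16\<^esub> qd_elt k 0)) \<oplus> \<ominus> \<one> \<otimes> \<phi> ((f \<ominus>\<^bsub>A\<^esub> h) (g \<otimes>\<^bsub>QD16\<^esub> qd_elt (4 + k) 0));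
           tr = \<lambda>k::nat. (a [^]\<^bsub>M\<^esub> k) (0, 0) \<oplus> (a [^]\<^bsub>M\<^esub> k) (1, 1)
       in m 0 \<otimes> tr 0 \<oplus> m 1 \<otimes> tr 1 \<oplus> m 2 \<otimes> tr 2 \<oplus> m 3 \<otimes> tr 3 = \<zero>)"
  proof (rule QD16_matrix_rep[OF F \<phi>, of "\<ominus> \<one>" a x, folded M_def A_def])
    show "a [^]\<^bsub>M\<^esub> (4::nat) = mat2 (\<ominus> \<one>) \<zero> \<zero> (\<ominus> \<one>)" unfolding pow(5) a3 by (simp add: a_def compute)
    show "x \<otimes>\<^bsub>M\<^esub> x = \<one>\<^bsub>M\<^esub>" by (simp add: x_def compute mat2_one)
    show "x \<otimes>\<^bsub>M\<^esub> a \<otimes>\<^bsub>M\<^esub> x = a [^]\<^bsub>M\<^esub> (3::nat)" unfolding a3 by (simp add: a_def x_def compute)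
    fix k :: nat assume "k < 4"
    then have "k = 0 \<or> k = 1 \<or> k = 2 \<or> k = 3" by auto
    then show "(a [^]\<^bsub>M\<^esub> k \<otimes>\<^bsub>M\<^esub> x) (0, 0) \<oplus> (a [^]\<^bsub>M\<^esub> k \<otimes>\<^bsub>M\<^esub> x) (1, 1) = \<zero>"
      by (elim disjE; simp only: pow(1,2) a2 a3; simp add: a_def x_def compute)
  qed (simp_all add: l_minus)
  show ?thesis
  proof (rule that[OF \<Phi>])
    fix f h g assume fhg: "f \<in> carrier A" "h \<in> carrier A" "\<Phi> f = \<Phi> h" "g \<in> carrier QD16"
    define d where "d k = (f \<ominus>\<^bsub>A\<^esub> h) (g \<otimes>\<^bsub>QD16\<^esub> qd_elt k 0)" for k
    interpret E: finite_group_algebra F QD16 by (rule finite_group_algebra_QD16[OF F.ring_axioms])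
    interpret A: ring A unfolding A_def by (rule E.ring_KG)
    have d [simp]: "d k \<in> carrier F" for k
      unfolding d_def using E.KG_app[of "f \<ominus>\<^bsub>A\<^esub> h"] fhg by (simp add: A_def[symmetric])
    have "(\<phi> (d 0) \<oplus> \<ominus> \<one> \<otimes> \<phi> (d 4)) \<otimes> (\<one> \<oplus> \<one>) \<oplus> (\<phi> (d 1) \<oplus> \<ominus> \<one> \<otimes> \<phi> (d 5)) \<otimes> s
        \<oplus> (\<phi> (d 3) \<oplus> \<ominus> \<one> \<otimes> \<phi> (d 7)) \<otimes> s = \<zero>"
      using ker[OF fhg, folded d_def] s(1) unfolding Let_def a2 a3 pow(1,2) by (simp add: a_def r_neg)
    then have "\<phi> ((d 0 \<ominus>\<^bsub>F\<^esub> d 4) \<oplus>\<^bsub>F\<^esub> (d 0 \<ominus>\<^bsub>F\<^esub> d 4)) \<oplus> s \<otimes> \<phi> ((d 1 \<ominus>\<^bsub>F\<^esub> d 5) \<oplus>\<^bsub>F\<^esub> (d 3 \<ominus>\<^bsub>F\<^esub> d 7)) = \<zero>"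
      using s(1) by (simp add: F.minus_eq l_distr r_distr a_ac m_ac l_minus r_minus minus_add)
    then show "let d = \<lambda>k. (f \<ominus>\<^bsub>A\<^esub> h) (g \<otimes>\<^bsub>QD16\<^esub> qd_elt k 0) in
        \<phi> ((d 0 \<ominus>\<^bsub>F\<^esub> d 4) \<oplus>\<^bsub>F\<^esub> (d 0 \<ominus>\<^bsub>F\<^esub> d 4)) \<oplus> s \<otimes> \<phi> ((d 1 \<ominus>\<^bsub>F\<^esub> d 5) \<oplus>\<^bsub>F\<^esub> (d 3 \<ominus>\<^bsub>F\<^esub> d 7)) = \<zero>"
      unfolding Let_def d_def .
  qed
qed

text \<open>
  The quotient by \<open>a\<^sup>4\<close> is the dihedral group of order 8, acting on the plane by a quarter turn and a
  reflection. The traces of \<open>1, a, a\<^sup>2, a\<^sup>3\<close> are \<open>2, 0, -2, 0\<close>.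
\<close>

lemma (in domain) dihedral_rep:
  assumes two: "\<guillemotleft>2\<guillemotright> \<noteq> \<zero>"
  defines "M \<equiv> mat_monoid 2 R" and "A \<equiv> group_algebra R QD16"
  obtains \<Phi> where "\<Phi> \<in> hom A M" "\<Phi> \<one>\<^bsub>A\<^esub> = \<one>\<^bsub>M\<^esub>"
    "\<And>f h g. f \<in> carrier A \<Longrightarrow> h \<in> carrier A \<Longrightarrow> \<Phi> f = \<Phi> h \<Longrightarrow> g \<in> carrier QD16 \<Longrightarrow>
      (let d = \<lambda>k. (f \<ominus>\<^bsub>A\<^esub> h) (g \<otimes>\<^bsub>QD16\<^esub> qd_elt k 0) in (d 0 \<oplus> d 4) \<ominus> (d 2 \<oplus> d 6) = \<zero>)"
proof -
  define a where "a = mat2 \<zero> \<one> (\<ominus> \<one>) \<zero>"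
  define x where "x = mat2 \<one> \<zero> \<zero> (\<ominus> \<one>)"
  have cl [simp]: "a \<in> carrier M" "x \<in> carrier M" by (simp_all add: a_def x_def M_def)
  note compute = M_def mat2_mult l_minus r_minus l_neg r_neg
  note pow = nat_pow_mat2[of a, folded M_def, OF cl(1)]
  have a2: "a [^]\<^bsub>M\<^esub> (2::nat) = mat2 (\<ominus> \<one>) \<zero> \<zero> (\<ominus> \<one>)" unfolding pow by (simp add: a_def compute)
  have a3: "a [^]\<^bsub>M\<^esub> (3::nat) = mat2 \<zero> (\<ominus> \<one>) \<one> \<zero>" unfolding pow(4) a2 by (simp add: a_def compute)
  obtain \<Phi> where \<Phi>: "\<Phi> \<in> hom A M" "\<Phi> \<one>\<^bsub>A\<^esub> = \<one>\<^bsub>M\<^esub>" and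
    ker: "\<And>f h g. f \<in> carrier A \<Longrightarrow> h \<in> carrier A \<Longrightarrow> \<Phi> f = \<Phi> h \<Longrightarrow> g \<in> carrier QD16 \<Longrightarrow>
      (let m = \<lambda>k. id ((f \<ominus>\<^bsub>A\<^esub> h) (g \<otimes>\<^bsub>QD16\<^esub> qd_elt k 0)) \<oplus> \<one> \<otimes> id ((f \<ominus>\<^bsub>A\<^esub> h) (g \<otimes>\<^bsub>QD16\<^esub> qd_elt (4 + k) 0));
           tr = \<lambda>k::nat. (a [^]\<^bsub>M\<^esub> k) (0, 0) \<oplus> (a [^]\<^bsub>M\<^esub> k) (1, 1)
       in m 0 \<otimes> tr 0 \<oplus> m 1 \<otimes> tr 1 \<oplus> m 2 \<otimes> tr 2 \<oplus> m 3 \<otimes> tr 3 = \<zero>)"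
  proof (rule QD16_matrix_rep[OF cring_axioms, of id "\<one>" a x, folded M_def A_def])
    show "id \<in> ring_hom R R" by (simp add: ring_hom_def)
    show "a [^]\<^bsub>M\<^esub> (4::nat) = mat2 \<one> \<zero> \<zero> \<one>" unfolding pow(5) a3 by (simp add: a_def compute)
    show "x \<otimes>\<^bsub>M\<^esub> x = \<one>\<^bsub>M\<^esub>" by (simp add: x_def compute mat2_one)
    show "x \<otimes>\<^bsub>M\<^esub> a \<otimes>\<^bsub>M\<^esub> x = a [^]\<^bsub>M\<^esub> (3::nat)" unfolding a3 by (simp add: a_def x_def compute)
    fix k :: nat assume "k < 4"
    then have "k = 0 \<or> k = 1 \<or> k = 2 \<or> k = 3" by auto
    then show "(a [^]\<^bsub>M\<^esub> k \<otimes>\<^bsub>M\<^esub> x) (0, 0) \<oplus> (a [^]\<^bsub>M\<^esub> k \<otimes>\<^bsub>M\<^esub> x) (1, 1) = \<zero>"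
      by (elim disjE; simp only: pow(1,2) a2 a3; simp add: a_def x_def compute)
  qed simp_all
  show ?thesis
  proof (rule that[OF \<Phi>])
    fix f h g assume fhg: "f \<in> carrier A" "h \<in> carrier A" "\<Phi> f = \<Phi> h" "g \<in> carrier QD16"
    define d where "d k = (f \<ominus>\<^bsub>A\<^esub> h) (g \<otimes>\<^bsub>QD16\<^esub> qd_elt k 0)" for k
    interpret E: finite_group_algebra R QD16 by (rule finite_group_algebra_QD16[OF ring_axioms])
    interpret A: ring A unfolding A_def by (rule E.ring_KG)
    have d [simp]: "d k \<in> carrier R" for k
      unfolding d_def using E.KG_app[of "f \<ominus>\<^bsub>A\<^esub> h"] fhg by (simp add: A_def[symmetric])
    have "(d 0 \<oplus> d 4) \<otimes> (\<one> \<oplus> \<one>) \<oplus> (d 2 \<oplus> d 6) \<otimes> (\<ominus> \<one> \<oplus> \<ominus> \<one>) = \<zero>"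
      using ker[OF fhg, folded d_def] unfolding Let_def a2 a3 pow(1,2) by (simp add: a_def)
    then have "\<guillemotleft>2\<guillemotright> \<otimes> ((d 0 \<oplus> d 4) \<ominus> (d 2 \<oplus> d 6)) = \<zero>"
      by (simp add: of_int_2 l_distr r_distr a_ac m_ac l_minus r_minus minus_add a_minus_def)
    then have "(d 0 \<oplus> d 4) \<ominus> (d 2 \<oplus> d 6) = \<zero>" using two by (simp add: integral_iff)
    then show "let d = \<lambda>k. (f \<ominus>\<^bsub>A\<^esub> h) (g \<otimes>\<^bsub>QD16\<^esub> qd_elt k 0) in (d 0 \<oplus> d 4) \<ominus> (d 2 \<oplus> d 6) = \<zero>"
      unfolding Let_def d_def .
  qed
qed

text \<open>
  The characters send \<open>a\<close> and \<open>x\<close> to \<open>1\<close> or \<open>-1\<close> independently. Their sum is 4 on the even powers of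
  \<open>a\<close> and 0 elsewhere; combining the four relations in pairs isolates the even powers.
\<close>

lemma (in domain) four_characters:
  assumes two: "\<guillemotleft>2\<guillemotright> \<noteq> \<zero>"
  defines "A \<equiv> group_algebra R QD16"
  obtains \<chi> :: "nat \<Rightarrow> _" where "\<And>i. \<chi> i \<in> hom A R" "\<And>i. \<chi> i \<one>\<^bsub>A\<^esub> = \<one>"
    "\<And>f h g. f \<in> carrier A \<Longrightarrow> h \<in> carrier A \<Longrightarrow> \<forall>i<4. \<chi> i f = \<chi> i h \<Longrightarrow> g \<in> carrier QD16 \<Longrightarrow>
      (let d = \<lambda>k. (f \<ominus>\<^bsub>A\<^esub> h) (g \<otimes>\<^bsub>QD16\<^esub> qd_elt k 0) in (d 0 \<oplus> d 4) \<oplus> (d 2 \<oplus> d 6) = \<zero>)"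
proof -
  interpret E: finite_group_algebra R QD16 by (rule finite_group_algebra_QD16[OF ring_axioms])
  interpret A: ring A unfolding A_def by (rule E.ring_KG)
  define u where "u i = (if i < 2 then \<one> else \<ominus> \<one>)" for i :: nat
  define v where "v i = (if even i then \<one> else \<ominus> \<one>)" for i :: nat
  have uv [simp]: "u i \<in> carrier R" "v i \<in> carrier R" "u i \<otimes> u i = \<one>" "v i \<otimes> v i = \<one>" for i
    by (simp_all add: u_def v_def l_minus r_minus)
  have u_pow: "u i [^] k = (if even k then \<one> else u i)" for i k :: nat
    by (induction k) auto
  have "\<exists>\<chi>. \<chi> \<in> hom QD16 R \<and> (\<forall>k l. \<chi> (qd_elt k l) = u i [^] k \<otimes> v i [^] l)" for i
  proof -
    have "v i [^] (2::nat) = \<one>" by (simp add: numeral_2_eq_2)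
    moreover have "v i \<otimes> u i \<otimes> v i = u i [^] (3::nat)"
      using m_lcomm[of "v i" "u i" "v i"] by (simp add: u_pow m_assoc)
    ultimately show ?thesis
      using QD16_rep_exists[of "u i" "v i"] by (metis u_pow uv(1,2) even_numeral)
  qed
  then obtain \<xi> :: "nat \<Rightarrow> _" where \<xi>: "\<And>i. \<xi> i \<in> hom QD16 R" "\<And>i k l. \<xi> i (qd_elt k l) = u i [^] k \<otimes> v i [^] l"
    by metis
  have "\<one>\<^bsub>QD16\<^esub> = qd_elt 0 0" by (simp add: qd_elt_def)
  then have one: "\<xi> i \<one>\<^bsub>QD16\<^esub> = \<one>" for i by (simp add: \<xi>(2))
  have X: "E.char_ext (\<xi> i) \<in> ring_hom A R" for i
    using E.char_ext_ring_hom[OF cring_axioms \<xi>(1) one] by (simp only: A_def)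
  show ?thesis
  proof (rule that[of "\<lambda>i. E.char_ext (\<xi> i)"])
    show "E.char_ext (\<xi> i) \<in> hom A R" "E.char_ext (\<xi> i) \<one>\<^bsub>A\<^esub> = \<one>" for i
      using X by (auto simp: ring_hom_def hom_def)
    fix f h g assume f: "f \<in> carrier A" and h: "h \<in> carrier A" and g: "g \<in> carrier QD16"
      and eq: "\<forall>i<4. E.char_ext (\<xi> i) f = E.char_ext (\<xi> i) h"
    define d where "d k l = (f \<ominus>\<^bsub>A\<^esub> h) (g \<otimes>\<^bsub>QD16\<^esub> qd_elt k l)" for k l
    have d [simp]: "d k l \<in> carrier R" for k l
      unfolding d_def using E.KG_app[of "f \<ominus>\<^bsub>A\<^esub> h"] f h g by (simp add: A_def[symmetric])
    let ?S = "\<lambda>w l. \<Oplus>k\<in>{..<8}. d k l \<otimes> w [^] k"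
    have S: "?S (u i) 0 \<oplus> v i \<otimes> ?S (u i) 1 = \<zero>" if "i < 4" for i
    proof -
      have "(\<Oplus>y\<in>carrier QD16. (f \<ominus>\<^bsub>A\<^esub> h) (g \<otimes>\<^bsub>QD16\<^esub> y) \<otimes> \<xi> i y) = \<zero>"
        using E.char_ext_kernel_translate[OF cring_axioms \<xi>(1) one, of f h i g] f h g eq that
        by (simp add: A_def)
      moreover have "\<xi> i y \<in> carrier R" if "y \<in> carrier QD16" for y
        using \<xi>(1)[of i] that by (auto simp: hom_def)
      ultimately have "(\<Oplus>k\<in>{..<8}. d k 0 \<otimes> u i [^] k) \<oplus> (\<Oplus>k\<in>{..<8}. d k 1 \<otimes> (u i [^] k \<otimes> v i)) = \<zero>"
        using f h g E.KG_app[of "f \<ominus>\<^bsub>A\<^esub> h"]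
        by (subst (asm) finsum_QD16) (simp_all add: \<xi>(2) A_def[symmetric] d_def)
      moreover have "v i \<otimes> ?S (u i) 1 = (\<Oplus>k\<in>{..<8}. d k 1 \<otimes> (u i [^] k \<otimes> v i))"
        by (subst finsum_rdistr) (auto intro!: finsum_cong' simp: m_ac)
      ultimately show ?thesis by simp
    qed
    have "?S \<one> 0 = \<zero> \<and> ?S \<one> 1 = \<zero>"
      using S[of 0] S[of 1] by (intro sum_diff_zero[OF two]) (simp_all add: u_def v_def l_minus a_minus_def)
    moreover have "?S (\<ominus> \<one>) 0 = \<zero> \<and> ?S (\<ominus> \<one>) 1 = \<zero>"
      using S[of 2] S[of 3] by (intro sum_diff_zero[OF two]) (simp_all add: u_def v_def l_minus a_minus_def)
    moreover have "?S (u i) 0 = ((d 0 0 \<oplus> d 4 0) \<oplus> (d 2 0 \<oplus> d 6 0)) \<oplus> u i \<otimes> ((d 1 0 \<oplus> d 5 0) \<oplus> (d 3 0 \<oplus> d 7 0))" for i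
    proof -
      have "?S (u i) 0 = d 0 0 \<otimes> u i [^] (0::nat) \<oplus> d 1 0 \<otimes> u i [^] (1::nat) \<oplus> d 2 0 \<otimes> u i [^] (2::nat)
          \<oplus> d 3 0 \<otimes> u i [^] (3::nat) \<oplus> d 4 0 \<otimes> u i [^] (4::nat) \<oplus> d 5 0 \<otimes> u i [^] (5::nat)
          \<oplus> d 6 0 \<otimes> u i [^] (6::nat) \<oplus> d 7 0 \<otimes> u i [^] (7::nat)"
        by (rule finsum_lessThan_8) simp
      also have "\<dots> = d 0 0 \<oplus> d 1 0 \<otimes> u i \<oplus> d 2 0 \<oplus> d 3 0 \<otimes> u i \<oplus> d 4 0 \<oplus> d 5 0 \<otimes> u i \<oplus> d 6 0 \<oplus> d 7 0 \<otimes> u i"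
        unfolding u_pow by simp
      also have "\<dots> = ((d 0 0 \<oplus> d 4 0) \<oplus> (d 2 0 \<oplus> d 6 0)) \<oplus> u i \<otimes> ((d 1 0 \<oplus> d 5 0) \<oplus> (d 3 0 \<oplus> d 7 0))"
        using d[of _ 0] uv(1)[of i] by (simp add: r_distr a_ac m_ac)
      finally show ?thesis .
    qed
    from this[of 0] this[of 2] have "(d 0 0 \<oplus> d 4 0) \<oplus> (d 2 0 \<oplus> d 6 0) = \<zero>
        \<and> (d 1 0 \<oplus> d 5 0) \<oplus> (d 3 0 \<oplus> d 7 0) = \<zero>"
      using calculation by (intro sum_diff_zero[OF two]) (simp_all add: u_def l_minus a_minus_def)
    then show "let d = \<lambda>k. (f \<ominus>\<^bsub>A\<^esub> h) (g \<otimes>\<^bsub>QD16\<^esub> qd_elt k 0) in (d 0 \<oplus> d 4) \<oplus> (d 2 \<oplus> d 6) = \<zero>"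
      by (simp add: d_def)
  qed
qed

section \<open>The structure of the unit group\<close>


lemma units_of_DirProd: "units_of (G \<times>\<times> H) = units_of G \<times>\<times> units_of H"
proof -
  have "Units (G \<times>\<times> H) = Units G \<times> Units H"
    unfolding Units_def by (auto simp: DirProd_def)
  then show ?thesis by (simp add: units_of_def DirProd_def)
qed

text \<open>
  Inverses in a product are chosen componentwise.
\<close>

lemma units_of_product_group: "units_of (product_group I G) = product_group I (\<lambda>i. units_of (G i))"
proof -
  have "Units (product_group I G) = (\<Pi>\<^sub>E i\<in>I. Units (G i))" (is "?L = ?R")
  proof
    show "?L \<subseteq> ?R"
    proof
      fix y assume "y \<in> ?L"
      then obtain z where z: "y \<in> (\<Pi>\<^sub>E i\<in>I. carrier (G i))" "z \<in> (\<Pi>\<^sub>E i\<in>I. carrier (G i))"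
        "(\<lambda>i\<in>I. z i \<otimes>\<^bsub>G i\<^esub> y i) = (\<lambda>i\<in>I. \<one>\<^bsub>G i\<^esub>)" "(\<lambda>i\<in>I. y i \<otimes>\<^bsub>G i\<^esub> z i) = (\<lambda>i\<in>I. \<one>\<^bsub>G i\<^esub>)"
        unfolding Units_def by auto
      have "y i \<in> Units (G i)" if i: "i \<in> I" for i
        using z(1,2) fun_cong[OF z(3), of i] fun_cong[OF z(4), of i] i
        unfolding Units_def by (auto simp: PiE_iff intro!: bexI[of _ "z i"])
      then show "y \<in> ?R" using z(1) by (auto simp: PiE_iff)
    qed
    show "?R \<subseteq> ?L"
    proof
      fix y assume y: "y \<in> ?R"
      then have "\<forall>i\<in>I. \<exists>z\<in>carrier (G i). z \<otimes>\<^bsub>G i\<^esub> y i = \<one>\<^bsub>G i\<^esub> \<and> y i \<otimes>\<^bsub>G i\<^esub> z = \<one>\<^bsub>G i\<^esub>"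
        by (auto simp: PiE_iff Units_def)
      then obtain z where z: "\<And>i. i \<in> I \<Longrightarrow> z i \<in> carrier (G i) \<and> z i \<otimes>\<^bsub>G i\<^esub> y i = \<one>\<^bsub>G i\<^esub> \<and> y i \<otimes>\<^bsub>G i\<^esub> z i = \<one>\<^bsub>G i\<^esub>"
        by metis
      have "restrict z I \<in> (\<Pi>\<^sub>E i\<in>I. carrier (G i))" using z by auto
      moreover have "(\<lambda>i\<in>I. restrict z I i \<otimes>\<^bsub>G i\<^esub> y i) = (\<lambda>i\<in>I. \<one>\<^bsub>G i\<^esub>)" "(\<lambda>i\<in>I. y i \<otimes>\<^bsub>G i\<^esub> restrict z I i) = (\<lambda>i\<in>I. \<one>\<^bsub>G i\<^esub>)"
        using z by (auto simp: fun_eq_iff)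
      moreover have "y \<in> (\<Pi>\<^sub>E i\<in>I. carrier (G i))" using y by (auto simp: PiE_iff Units_def)
      ultimately show "y \<in> ?L"
        unfolding Units_def mem_Collect_eq carrier_product_group mult_product_group one_product_group
        by blast
    qed
  qed
  then show ?thesis by (simp add: units_of_def product_group_def)
qed

text \<open>
  Counting shows that the homomorphism is bijective, so inverses can be pulled back.
\<close>

lemma units_iso_of_injective_hom:
  assumes h: "h \<in> hom G M" "h \<one>\<^bsub>G\<^esub> = \<one>\<^bsub>M\<^esub>" and inj: "inj_on h (carrier G)"
    and fin: "finite (carrier M)" and card: "card (carrier G) = card (carrier M)"
    and one: "\<one>\<^bsub>G\<^esub> \<in> carrier G" and mult: "\<And>y z. y \<in> carrier G \<Longrightarrow> z \<in> carrier G \<Longrightarrow> y \<otimes>\<^bsub>G\<^esub> z \<in> carrier G"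
  shows "units_of G \<cong> units_of M"
proof -
  have cl: "y \<in> carrier G \<Longrightarrow> h y \<in> carrier M" for y using h(1) by (auto simp: hom_def)
  have hm: "y \<in> carrier G \<Longrightarrow> z \<in> carrier G \<Longrightarrow> h (y \<otimes>\<^bsub>G\<^esub> z) = h y \<otimes>\<^bsub>M\<^esub> h z" for y z
    using h(1) by (auto simp: hom_def)
  have surj: "h ` carrier G = carrier M"
    using cl card card_image[OF inj] fin by (intro card_subset_eq) auto
  have "h ` Units G = Units M"
  proof
    show "h ` Units G \<subseteq> Units M"
    proof
      fix m assume "m \<in> h ` Units G"
      then obtain y z where "y \<in> carrier G" "z \<in> carrier G" "z \<otimes>\<^bsub>G\<^esub> y = \<one>\<^bsub>G\<^esub>" "y \<otimes>\<^bsub>G\<^esub> z = \<one>\<^bsub>G\<^esub>" "m = h y"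
        unfolding Units_def by auto
      then show "m \<in> Units M"
        unfolding Units_def using cl hm[of y z] hm[of z y] h(2) by (auto intro!: bexI[of _ "h z"])
    qed
    show "Units M \<subseteq> h ` Units G"
    proof
      fix m assume "m \<in> Units M"
      then obtain k where m: "m \<in> carrier M" "k \<in> carrier M" "k \<otimes>\<^bsub>M\<^esub> m = \<one>\<^bsub>M\<^esub>" "m \<otimes>\<^bsub>M\<^esub> k = \<one>\<^bsub>M\<^esub>"
        unfolding Units_def by auto
      obtain y z where yz: "y \<in> carrier G" "z \<in> carrier G" "m = h y" "k = h z"
        using m(1,2) surj by blast
      have "h (z \<otimes>\<^bsub>G\<^esub> y) = h \<one>\<^bsub>G\<^esub>" "h (y \<otimes>\<^bsub>G\<^esub> z) = h \<one>\<^bsub>G\<^esub>"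
        using m yz hm h(2) by simp_all
      then have "z \<otimes>\<^bsub>G\<^esub> y = \<one>\<^bsub>G\<^esub>" "y \<otimes>\<^bsub>G\<^esub> z = \<one>\<^bsub>G\<^esub>"
        using inj mult one yz by (auto dest: inj_onD)
      then show "m \<in> h ` Units G" using yz unfolding Units_def by auto
    qed
  qed
  moreover have "inj_on h (Units G)" using inj by (rule inj_on_subset) (auto simp: Units_def)
  moreover have "h (y \<otimes>\<^bsub>G\<^esub> z) = h y \<otimes>\<^bsub>M\<^esub> h z" if "y \<in> Units G" "z \<in> Units G" for y z
    using that hm by (auto simp: Units_def)
  ultimately have "h \<in> iso (units_of G) (units_of M)"
    unfolding iso_def hom_def bij_betw_def by (auto simp: units_of_def)
  then show ?thesis unfolding is_iso_def by blast
qed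

lemma card_group_algebra_QD16:
  assumes "ring F"
  shows "card (carrier (group_algebra F QD16)) = card (carrier F) ^ 16"
proof -
  interpret E: finite_group_algebra F QD16 by (rule finite_group_algebra_QD16[OF assms])
  show ?thesis
    unfolding E.carrier_KG by (simp add: card_funcsetE finite_QD16 card_QD16)
qed

lemma card_mat_monoid_2: "card (carrier (mat_monoid 2 K)) = card (carrier K) ^ 4"
  unfolding carrier_mat_monoid by (simp add: card_funcsetE card_cartesian_product)

lemma finite_mat_monoid: "finite (carrier K) \<Longrightarrow> finite (carrier (mat_monoid n K))"
  unfolding carrier_mat_monoid by (intro finite_PiE) auto

lemma product_group_units_cyclic:
  assumes "field F" "finite (carrier F)"
  shows "product_group I (\<lambda>_. units_of F) \<cong> product_group I (\<lambda>_. integer_mod_group (card (carrier F) - 1))"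
proof -
  interpret F: field F by fact
  show ?thesis
    by (rule iso_product_groupI) (rule F.units_cyclic[OF assms(2)], rule F.units_group, simp)
qed

lemma hom_into_product:
  assumes "\<And>i. i \<in> I \<Longrightarrow> \<chi> i \<in> hom A (G i)"
  shows "(\<lambda>f. \<lambda>i\<in>I. \<chi> i f) \<in> hom A (product_group I G)"
  using assms by (intro homI) (auto simp: hom_def Pi_def fun_eq_iff)

lemma hom_into_DirProd:
  assumes "\<chi> \<in> hom A G" "\<psi> \<in> hom A H"
  shows "(\<lambda>f. (\<chi> f, \<psi> f)) \<in> hom A (G \<times>\<times> H)"
  using assms by (intro homI) (auto simp: hom_def)


text \<open>
  The four characters together with \<open>\<Psi>\<close> are injective: the two equations assumed of the kernel of \<open>\<Psi>\<close> and the
  one supplied by the characters leave only \<open>\<delta>(g) = 0\<close>. The exponents \<open>4 + 12 = 16\<close> make source and target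
  equally large.
\<close>

lemma units_QD16:
  assumes "field F" and fin: "finite (carrier F)" and two: "\<guillemotleft>2\<guillemotright>\<^bsub>F\<^esub> \<noteq> \<zero>\<^bsub>F\<^esub>"
  defines "A \<equiv> group_algebra F QD16"
  assumes N: "finite (carrier N)" "card (carrier N) = card (carrier F) ^ 12"
    and \<Psi>: "\<Psi> \<in> hom A N" "\<Psi> \<one>\<^bsub>A\<^esub> = \<one>\<^bsub>N\<^esub>"
    and kernel: "\<And>f h g. f \<in> carrier A \<Longrightarrow> h \<in> carrier A \<Longrightarrow> \<Psi> f = \<Psi> h \<Longrightarrow> g \<in> carrier QD16 \<Longrightarrow>
      (let d = \<lambda>k. (f \<ominus>\<^bsub>A\<^esub> h) (g \<otimes>\<^bsub>QD16\<^esub> qd_elt k 0) in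
        d 0 \<ominus>\<^bsub>F\<^esub> d 4 = \<zero>\<^bsub>F\<^esub> \<and> (d 0 \<oplus>\<^bsub>F\<^esub> d 4) \<ominus>\<^bsub>F\<^esub> (d 2 \<oplus>\<^bsub>F\<^esub> d 6) = \<zero>\<^bsub>F\<^esub>)"
  shows "units_of A \<cong> product_group {..<4::nat} (\<lambda>_. integer_mod_group (card (carrier F) - 1)) \<times>\<times> units_of N"
proof -
  interpret F: field F by fact
  interpret E: finite_group_algebra F QD16 by (rule finite_group_algebra_QD16[OF F.ring_axioms])
  interpret A: ring A unfolding A_def by (rule E.ring_KG)
  obtain \<chi> :: "nat \<Rightarrow> _" where \<chi>: "\<And>i. \<chi> i \<in> hom A F" "\<And>i. \<chi> i \<one>\<^bsub>A\<^esub> = \<one>\<^bsub>F\<^esub>" and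
    \<chi>_kernel: "\<And>f h g. f \<in> carrier A \<Longrightarrow> h \<in> carrier A \<Longrightarrow> \<forall>i<4. \<chi> i f = \<chi> i h \<Longrightarrow> g \<in> carrier QD16 \<Longrightarrow>
      (let d = \<lambda>k. (f \<ominus>\<^bsub>A\<^esub> h) (g \<otimes>\<^bsub>QD16\<^esub> qd_elt k 0) in (d 0 \<oplus>\<^bsub>F\<^esub> d 4) \<oplus>\<^bsub>F\<^esub> (d 2 \<oplus>\<^bsub>F\<^esub> d 6) = \<zero>\<^bsub>F\<^esub>)"
    using F.four_characters[OF two, folded A_def] by blast
  define M where "M = product_group {..<4::nat} (\<lambda>_. F) \<times>\<times> N"
  define \<Theta> where "\<Theta> f = ((\<lambda>i\<in>{..<4::nat}. \<chi> i f), \<Psi> f)" for f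
  have "units_of A \<cong> units_of M"
  proof (rule units_iso_of_injective_hom)
    show "\<Theta> \<in> hom A M"
      unfolding M_def \<Theta>_def by (intro hom_into_DirProd hom_into_product \<chi>(1) \<Psi>(1))
    show "\<Theta> \<one>\<^bsub>A\<^esub> = \<one>\<^bsub>M\<^esub>"
      using \<chi>(2) \<Psi>(2) by (auto simp: M_def \<Theta>_def fun_eq_iff)
    show "inj_on \<Theta> (carrier A)"
    proof (rule inj_onI)
      fix f h assume f: "f \<in> carrier A" and h: "h \<in> carrier A" and eq: "\<Theta> f = \<Theta> h"
      have eqs: "\<forall>i<4. \<chi> i f = \<chi> i h" "\<Psi> f = \<Psi> h"
        using eq unfolding \<Theta>_def by (metis (no_types, lifting) Pair_inject lessThan_iff restrict_apply')+
      have \<delta>: "f \<ominus>\<^bsub>A\<^esub> h \<in> carrier A" using f h by simp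
      have "(f \<ominus>\<^bsub>A\<^esub> h) g = \<zero>\<^bsub>F\<^esub>" if g: "g \<in> carrier QD16" for g
      proof -
        define d where "d k = (f \<ominus>\<^bsub>A\<^esub> h) (g \<otimes>\<^bsub>QD16\<^esub> qd_elt k 0)" for k
        have d [simp]: "d k \<in> carrier F" for k
          unfolding d_def using E.KG_app[of "f \<ominus>\<^bsub>A\<^esub> h"] \<delta> g by (simp add: A_def[symmetric])
        have "(d 0 \<oplus>\<^bsub>F\<^esub> d 4) \<oplus>\<^bsub>F\<^esub> (d 2 \<oplus>\<^bsub>F\<^esub> d 6) = \<zero>\<^bsub>F\<^esub>" "(d 0 \<oplus>\<^bsub>F\<^esub> d 4) \<ominus>\<^bsub>F\<^esub> (d 2 \<oplus>\<^bsub>F\<^esub> d 6) = \<zero>\<^bsub>F\<^esub>"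
          and "d 0 \<ominus>\<^bsub>F\<^esub> d 4 = \<zero>\<^bsub>F\<^esub>"
          using \<chi>_kernel[OF f h eqs(1) g] kernel[OF f h eqs(2) g] unfolding Let_def d_def by auto
        then have "d 0 \<oplus>\<^bsub>F\<^esub> d 4 = \<zero>\<^bsub>F\<^esub>" "d 0 \<ominus>\<^bsub>F\<^esub> d 4 = \<zero>\<^bsub>F\<^esub>"
          using F.sum_diff_zero[OF two, of "d 0 \<oplus>\<^bsub>F\<^esub> d 4" "d 2 \<oplus>\<^bsub>F\<^esub> d 6"] by simp_all
        then have "d 0 = \<zero>\<^bsub>F\<^esub>" using F.sum_diff_zero[OF two, of "d 0" "d 4"] by simp
        then show ?thesis using g by (simp add: d_def qd_elt_def)
      qed
      then have "f \<ominus>\<^bsub>A\<^esub> h = \<zero>\<^bsub>A\<^esub>"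
        using \<delta> E.zero_KG_app E.zero_KG_closed unfolding A_def by (intro E.KG_eqI) auto
      then show "f = h" using f h by simp
    qed
    show "finite (carrier M)"
      unfolding M_def using fin N(1) by (auto intro!: finite_PiE)
    show "card (carrier A) = card (carrier M)"
      unfolding M_def A_def
      by (simp add: card_group_algebra_QD16[OF F.ring_axioms] card_cartesian_product card_PiE N(2) flip: power_add)
  qed simp_all
  also have "units_of M = product_group {..<4} (\<lambda>_. units_of F) \<times>\<times> units_of N"
    unfolding M_def units_of_DirProd units_of_product_group ..
  also have "\<dots> \<cong> product_group {..<4::nat} (\<lambda>_. integer_mod_group (card (carrier F) - 1)) \<times>\<times> units_of N"
    by (rule group.DirProd_iso_trans[OF _ product_group_units_cyclic[OF assms(1) fin] iso_refl])
       (simp add: F.units_group)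
  finally (iso_trans) show ?thesis .
qed

text \<open>
  The faithful representations for \<open>s\<close> and \<open>-s\<close> give \<open>y + sz = 0 = y - sz\<close>, hence \<open>y = 0\<close>, where
  \<open>y = 2(\<delta>(g) - \<delta>(ga\<^sup>4))\<close>.
\<close>

lemma units_QD16_split:
  assumes "field F" and fin: "finite (carrier F)" and two: "\<guillemotleft>2\<guillemotright>\<^bsub>F\<^esub> \<noteq> \<zero>\<^bsub>F\<^esub>"
    and s: "s \<in> carrier F" "s \<otimes>\<^bsub>F\<^esub> s = \<ominus>\<^bsub>F\<^esub> \<guillemotleft>2\<guillemotright>\<^bsub>F\<^esub>"
  shows "units_of (group_algebra F QD16) \<cong>
    product_group {..<4::nat} (\<lambda>_. integer_mod_group (card (carrier F) - 1)) \<times>\<times> product_group {..<3::nat} (\<lambda>_. GL 2 F)"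
proof -
  interpret F: field F by fact
  define A where "A = group_algebra F QD16"
  interpret E: finite_group_algebra F QD16 by (rule finite_group_algebra_QD16[OF F.ring_axioms])
  interpret A: ring A unfolding A_def by (rule E.ring_KG)
  let ?M2 = "mat_monoid 2 F"
  have id: "id \<in> ring_hom F F" by (simp add: ring_hom_def)
  have s': "\<ominus>\<^bsub>F\<^esub> s \<in> carrier F" "\<ominus>\<^bsub>F\<^esub> s \<otimes>\<^bsub>F\<^esub> \<ominus>\<^bsub>F\<^esub> s = \<ominus>\<^bsub>F\<^esub> \<guillemotleft>2\<guillemotright>\<^bsub>F\<^esub>"
    using s by (simp_all add: F.l_minus F.r_minus)
  note D = F.dihedral_rep[OF two, folded A_def]
  note P = F.faithful_rep[OF F.cring_axioms id s, folded A_def]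
  note N = F.faithful_rep[OF F.cring_axioms id s', folded A_def]
  show ?thesis
  proof (rule D, rule P, rule N)
    fix D P N
    assume D: "D \<in> hom A ?M2" "D \<one>\<^bsub>A\<^esub> = \<one>\<^bsub>?M2\<^esub>" and P: "P \<in> hom A ?M2" "P \<one>\<^bsub>A\<^esub> = \<one>\<^bsub>?M2\<^esub>"
      and N: "N \<in> hom A ?M2" "N \<one>\<^bsub>A\<^esub> = \<one>\<^bsub>?M2\<^esub>"
    assume kerD: "\<And>f h g. f \<in> carrier A \<Longrightarrow> h \<in> carrier A \<Longrightarrow> D f = D h \<Longrightarrow> g \<in> carrier QD16 \<Longrightarrow>
        (let d = \<lambda>k. (f \<ominus>\<^bsub>A\<^esub> h) (g \<otimes>\<^bsub>QD16\<^esub> qd_elt k 0) in (d 0 \<oplus>\<^bsub>F\<^esub> d 4) \<ominus>\<^bsub>F\<^esub> (d 2 \<oplus>\<^bsub>F\<^esub> d 6) = \<zero>\<^bsub>F\<^esub>)"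
      and kerP: "\<And>f h g. f \<in> carrier A \<Longrightarrow> h \<in> carrier A \<Longrightarrow> P f = P h \<Longrightarrow> g \<in> carrier QD16 \<Longrightarrow>
        (let d = \<lambda>k. (f \<ominus>\<^bsub>A\<^esub> h) (g \<otimes>\<^bsub>QD16\<^esub> qd_elt k 0) in
          id ((d 0 \<ominus>\<^bsub>F\<^esub> d 4) \<oplus>\<^bsub>F\<^esub> (d 0 \<ominus>\<^bsub>F\<^esub> d 4)) \<oplus>\<^bsub>F\<^esub> s \<otimes>\<^bsub>F\<^esub> id ((d 1 \<ominus>\<^bsub>F\<^esub> d 5) \<oplus>\<^bsub>F\<^esub> (d 3 \<ominus>\<^bsub>F\<^esub> d 7)) = \<zero>\<^bsub>F\<^esub>)"
      and kerN: "\<And>f h g. f \<in> carrier A \<Longrightarrow> h \<in> carrier A \<Longrightarrow> N f = N h \<Longrightarrow> g \<in> carrier QD16 \<Longrightarrow>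
        (let d = \<lambda>k. (f \<ominus>\<^bsub>A\<^esub> h) (g \<otimes>\<^bsub>QD16\<^esub> qd_elt k 0) in
          id ((d 0 \<ominus>\<^bsub>F\<^esub> d 4) \<oplus>\<^bsub>F\<^esub> (d 0 \<ominus>\<^bsub>F\<^esub> d 4)) \<oplus>\<^bsub>F\<^esub> \<ominus>\<^bsub>F\<^esub> s \<otimes>\<^bsub>F\<^esub> id ((d 1 \<ominus>\<^bsub>F\<^esub> d 5) \<oplus>\<^bsub>F\<^esub> (d 3 \<ominus>\<^bsub>F\<^esub> d 7)) = \<zero>\<^bsub>F\<^esub>)"
    define \<rho> where "\<rho> k = (if k = 0 then D else if k = 1 then P else N)" for k :: nat
    have "units_of A \<cong> product_group {..<4::nat} (\<lambda>_. integer_mod_group (card (carrier F) - 1))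
        \<times>\<times> units_of (product_group {..<3::nat} (\<lambda>_. ?M2))"
    proof (rule units_QD16[OF assms(1) fin two, folded A_def])
      show "(\<lambda>f. \<lambda>k\<in>{..<3}. \<rho> k f) \<in> hom A (product_group {..<3::nat} (\<lambda>_. ?M2))"
        by (rule hom_into_product) (simp add: \<rho>_def D P N)
      show "(\<lambda>k\<in>{..<3}. \<rho> k \<one>\<^bsub>A\<^esub>) = \<one>\<^bsub>product_group {..<3::nat} (\<lambda>_. ?M2)\<^esub>"
        by (auto simp: \<rho>_def D P N fun_eq_iff)
      show "finite (carrier (product_group {..<3::nat} (\<lambda>_. ?M2)))"
        using finite_mat_monoid[OF fin] by (auto intro!: finite_PiE)
      show "card (carrier (product_group {..<3::nat} (\<lambda>_. ?M2))) = card (carrier F) ^ 12"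
        by (simp add: card_PiE card_mat_monoid_2 flip: power_mult)
      fix f h g assume f: "f \<in> carrier A" and h: "h \<in> carrier A" and g: "g \<in> carrier QD16"
        and eq: "(\<lambda>k\<in>{..<3}. \<rho> k f) = (\<lambda>k\<in>{..<3}. \<rho> k h)"
      have "\<rho> k f = \<rho> k h" if "k < 3" for k using fun_cong[OF eq, of k] that by simp
      from this[of 0] this[of 1] this[of 2] have eqs: "D f = D h" "P f = P h" "N f = N h"
        by (simp_all add: \<rho>_def)
      define d where "d k = (f \<ominus>\<^bsub>A\<^esub> h) (g \<otimes>\<^bsub>QD16\<^esub> qd_elt k 0)" for k
      have d [simp]: "d k \<in> carrier F" for k
        unfolding d_def using E.KG_app[of "f \<ominus>\<^bsub>A\<^esub> h"] f h g by (simp add: A_def[symmetric])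
      let ?y = "(d 0 \<ominus>\<^bsub>F\<^esub> d 4) \<oplus>\<^bsub>F\<^esub> (d 0 \<ominus>\<^bsub>F\<^esub> d 4)" and ?z = "(d 1 \<ominus>\<^bsub>F\<^esub> d 5) \<oplus>\<^bsub>F\<^esub> (d 3 \<ominus>\<^bsub>F\<^esub> d 7)"
      have "?y \<oplus>\<^bsub>F\<^esub> s \<otimes>\<^bsub>F\<^esub> ?z = \<zero>\<^bsub>F\<^esub>" "?y \<oplus>\<^bsub>F\<^esub> \<ominus>\<^bsub>F\<^esub> s \<otimes>\<^bsub>F\<^esub> ?z = \<zero>\<^bsub>F\<^esub>"
        using kerP[OF f h eqs(2) g] kerN[OF f h eqs(3) g] unfolding Let_def d_def[symmetric] by simp_all
      then have y: "?y = \<zero>\<^bsub>F\<^esub> \<and> s \<otimes>\<^bsub>F\<^esub> ?z = \<zero>\<^bsub>F\<^esub>"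
        using s(1) by (intro F.sum_diff_zero[OF two]) (simp_all add: F.l_minus a_minus_def)
      have "d 0 \<ominus>\<^bsub>F\<^esub> d 4 = \<zero>\<^bsub>F\<^esub>" by (rule F.double_zero[OF two _ conjunct1[OF y]]) simp
      then show "let d = \<lambda>k. (f \<ominus>\<^bsub>A\<^esub> h) (g \<otimes>\<^bsub>QD16\<^esub> qd_elt k 0) in
          d 0 \<ominus>\<^bsub>F\<^esub> d 4 = \<zero>\<^bsub>F\<^esub> \<and> (d 0 \<oplus>\<^bsub>F\<^esub> d 4) \<ominus>\<^bsub>F\<^esub> (d 2 \<oplus>\<^bsub>F\<^esub> d 6) = \<zero>\<^bsub>F\<^esub>"
        using kerD[OF f h eqs(1) g] unfolding Let_def d_def by blast
    qed
    then show ?thesis by (simp only: A_def units_of_product_group GL_def)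
  qed
qed

text \<open>
  If \<open>z\<close> were not zero, then \<open>-y/z\<close> would be a square root of \<open>-2\<close> in \<open>F\<close>.
\<close>

lemma sqrt_independent:
  assumes "field F" "field L" and \<phi>: "\<phi> \<in> ring_hom F L"
    and t: "t \<in> carrier L" "t \<otimes>\<^bsub>L\<^esub> t = \<ominus>\<^bsub>L\<^esub> \<guillemotleft>2\<guillemotright>\<^bsub>L\<^esub>"
    and nonsquare: "\<And>y. y \<in> carrier F \<Longrightarrow> y \<otimes>\<^bsub>F\<^esub> y \<noteq> \<ominus>\<^bsub>F\<^esub> \<guillemotleft>2\<guillemotright>\<^bsub>F\<^esub>"
    and yz [simp]: "y \<in> carrier F" "z \<in> carrier F" and e: "\<phi> y \<oplus>\<^bsub>L\<^esub> t \<otimes>\<^bsub>L\<^esub> \<phi> z = \<zero>\<^bsub>L\<^esub>"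
  shows "y = \<zero>\<^bsub>F\<^esub>"
proof (cases "z = \<zero>\<^bsub>F\<^esub>")
  interpret F: field F by fact
  interpret L: field L by fact
  interpret \<phi>: ring_hom_ring F L \<phi> by (rule ring_hom_ringI2[OF F.ring_axioms L.ring_axioms \<phi>])
  have inj: "inj_on \<phi> (carrier F)" by (rule non_trivial_field_hom_is_inj[OF \<phi> assms(1,2)])
  {
    case True
    then have "\<phi> y = \<phi> \<zero>\<^bsub>F\<^esub>" using e t(1) by simp
    then show ?thesis by (rule inj_onD[OF inj]) simp_all
  next
    case False
    then have "z \<in> Units F" by (simp add: F.field_Units)
    then have iz: "inv\<^bsub>F\<^esub> z \<in> carrier F" "z \<otimes>\<^bsub>F\<^esub> inv\<^bsub>F\<^esub> z = \<one>\<^bsub>F\<^esub>" by simp_all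
    define w where "w = y \<otimes>\<^bsub>F\<^esub> inv\<^bsub>F\<^esub> z"
    have w: "w \<in> carrier F" using iz by (simp add: w_def)
    have "(\<phi> y \<oplus>\<^bsub>L\<^esub> t \<otimes>\<^bsub>L\<^esub> \<phi> z) \<otimes>\<^bsub>L\<^esub> \<phi> (inv\<^bsub>F\<^esub> z) = \<phi> w \<oplus>\<^bsub>L\<^esub> t"
      using t(1) iz \<phi>.hom_mult[of z "inv\<^bsub>F\<^esub> z"]
      by (simp add: w_def L.l_distr L.m_assoc del: \<phi>.hom_mult) (simp add: L.m_assoc flip: \<phi>.hom_mult)
    then have "\<phi> w \<oplus>\<^bsub>L\<^esub> t = \<zero>\<^bsub>L\<^esub>" unfolding e using iz by simp
    then have "\<phi> w = \<ominus>\<^bsub>L\<^esub> t" using w t(1) by (simp add: L.eq_neg_iff_add_eq_0)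
    then have "\<phi> (w \<otimes>\<^bsub>F\<^esub> w) = \<phi> (\<ominus>\<^bsub>F\<^esub> \<guillemotleft>2\<guillemotright>\<^bsub>F\<^esub>)"
      using w t by (simp add: F.of_int_2 L.of_int_2 L.l_minus L.r_minus)
    then have "w \<otimes>\<^bsub>F\<^esub> w = \<ominus>\<^bsub>F\<^esub> \<guillemotleft>2\<guillemotright>\<^bsub>F\<^esub>" by (rule inj_onD[OF inj]) (use w in simp_all)
    then show ?thesis using nonsquare[OF w] by simp
  }
qed

text \<open>
  One faithful representation over \<open>L\<close> does the work of two over \<open>F\<close>, also in the count: its matrix ring has
  \<open>q\<^sup>8\<close> elements. Its trace relation \<open>y + tz = 0\<close> with \<open>y\<close> and \<open>z\<close> in \<open>F\<close> forces \<open>y = 0\<close>.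
\<close>

lemma units_QD16_nonsplit:
  assumes "field F" and fin: "finite (carrier F)" and two: "\<guillemotleft>2\<guillemotright>\<^bsub>F\<^esub> \<noteq> \<zero>\<^bsub>F\<^esub>"
    and nonsquare: "\<And>y. y \<in> carrier F \<Longrightarrow> y \<otimes>\<^bsub>F\<^esub> y \<noteq> \<ominus>\<^bsub>F\<^esub> \<guillemotleft>2\<guillemotright>\<^bsub>F\<^esub>"
    and "field L" and finL: "finite (carrier L)" and cardL: "card (carrier L) = card (carrier F) ^ 2"
    and \<phi>: "\<phi> \<in> ring_hom F L"
    and t: "t \<in> carrier L" "t \<otimes>\<^bsub>L\<^esub> t = \<ominus>\<^bsub>L\<^esub> \<guillemotleft>2\<guillemotright>\<^bsub>L\<^esub>"
  shows "units_of (group_algebra F QD16) \<cong>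
    product_group {..<4::nat} (\<lambda>_. integer_mod_group (card (carrier F) - 1)) \<times>\<times> GL 2 F \<times>\<times> GL 2 L"
proof -
  interpret F: field F by fact
  interpret L: field L by fact
  define A where "A = group_algebra F QD16"
  interpret E: finite_group_algebra F QD16 by (rule finite_group_algebra_QD16[OF F.ring_axioms])
  interpret A: ring A unfolding A_def by (rule E.ring_KG)
  let ?N = "mat_monoid 2 F \<times>\<times> mat_monoid 2 L"
  note D = F.dihedral_rep[OF two, folded A_def]
  note P = L.faithful_rep[OF F.cring_axioms \<phi> t, folded A_def]
  show ?thesis
  proof (rule D, rule P)
    fix D P
    assume D: "D \<in> hom A (mat_monoid 2 F)" "D \<one>\<^bsub>A\<^esub> = \<one>\<^bsub>mat_monoid 2 F\<^esub>"
      and P: "P \<in> hom A (mat_monoid 2 L)" "P \<one>\<^bsub>A\<^esub> = \<one>\<^bsub>mat_monoid 2 L\<^esub>"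
    assume kerD: "\<And>f h g. f \<in> carrier A \<Longrightarrow> h \<in> carrier A \<Longrightarrow> D f = D h \<Longrightarrow> g \<in> carrier QD16 \<Longrightarrow>
        (let d = \<lambda>k. (f \<ominus>\<^bsub>A\<^esub> h) (g \<otimes>\<^bsub>QD16\<^esub> qd_elt k 0) in (d 0 \<oplus>\<^bsub>F\<^esub> d 4) \<ominus>\<^bsub>F\<^esub> (d 2 \<oplus>\<^bsub>F\<^esub> d 6) = \<zero>\<^bsub>F\<^esub>)"
      and kerP: "\<And>f h g. f \<in> carrier A \<Longrightarrow> h \<in> carrier A \<Longrightarrow> P f = P h \<Longrightarrow> g \<in> carrier QD16 \<Longrightarrow>
        (let d = \<lambda>k. (f \<ominus>\<^bsub>A\<^esub> h) (g \<otimes>\<^bsub>QD16\<^esub> qd_elt k 0) in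
          \<phi> ((d 0 \<ominus>\<^bsub>F\<^esub> d 4) \<oplus>\<^bsub>F\<^esub> (d 0 \<ominus>\<^bsub>F\<^esub> d 4)) \<oplus>\<^bsub>L\<^esub> t \<otimes>\<^bsub>L\<^esub> \<phi> ((d 1 \<ominus>\<^bsub>F\<^esub> d 5) \<oplus>\<^bsub>F\<^esub> (d 3 \<ominus>\<^bsub>F\<^esub> d 7)) = \<zero>\<^bsub>L\<^esub>)"
    have "units_of A \<cong> product_group {..<4::nat} (\<lambda>_. integer_mod_group (card (carrier F) - 1)) \<times>\<times> units_of ?N"
    proof (rule units_QD16[OF assms(1) fin two, folded A_def])
      show "(\<lambda>f. (D f, P f)) \<in> hom A ?N" by (rule hom_into_DirProd[OF D(1) P(1)])
      show "(D \<one>\<^bsub>A\<^esub>, P \<one>\<^bsub>A\<^esub>) = \<one>\<^bsub>?N\<^esub>" by (simp add: D P)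
      show "finite (carrier ?N)" using finite_mat_monoid[OF fin] finite_mat_monoid[OF finL] by simp
      show "card (carrier ?N) = card (carrier F) ^ 12"
        by (simp add: card_cartesian_product card_mat_monoid_2 cardL flip: power_add power_mult)
      fix f h g assume f: "f \<in> carrier A" and h: "h \<in> carrier A" and g: "g \<in> carrier QD16"
        and eq: "(D f, P f) = (D h, P h)"
      define d where "d k = (f \<ominus>\<^bsub>A\<^esub> h) (g \<otimes>\<^bsub>QD16\<^esub> qd_elt k 0)" for k
      have d [simp]: "d k \<in> carrier F" for k
        unfolding d_def using E.KG_app[of "f \<ominus>\<^bsub>A\<^esub> h"] f h g by (simp add: A_def[symmetric])
      have "\<phi> ((d 0 \<ominus>\<^bsub>F\<^esub> d 4) \<oplus>\<^bsub>F\<^esub> (d 0 \<ominus>\<^bsub>F\<^esub> d 4)) \<oplus>\<^bsub>L\<^esub> t \<otimes>\<^bsub>L\<^esub> \<phi> ((d 1 \<ominus>\<^bsub>F\<^esub> d 5) \<oplus>\<^bsub>F\<^esub> (d 3 \<ominus>\<^bsub>F\<^esub> d 7)) = \<zero>\<^bsub>L\<^esub>"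
        using kerP[OF f h _ g] eq unfolding Let_def d_def[symmetric] by simp
      then have "(d 0 \<ominus>\<^bsub>F\<^esub> d 4) \<oplus>\<^bsub>F\<^esub> (d 0 \<ominus>\<^bsub>F\<^esub> d 4) = \<zero>\<^bsub>F\<^esub>"
        by (rule sqrt_independent[OF assms(1,5) \<phi> t nonsquare, rotated -1]) simp_all
      from F.double_zero[OF two _ this] have "d 0 \<ominus>\<^bsub>F\<^esub> d 4 = \<zero>\<^bsub>F\<^esub>" by simp
      then show "let d = \<lambda>k. (f \<ominus>\<^bsub>A\<^esub> h) (g \<otimes>\<^bsub>QD16\<^esub> qd_elt k 0) in
          d 0 \<ominus>\<^bsub>F\<^esub> d 4 = \<zero>\<^bsub>F\<^esub> \<and> (d 0 \<oplus>\<^bsub>F\<^esub> d 4) \<ominus>\<^bsub>F\<^esub> (d 2 \<oplus>\<^bsub>F\<^esub> d 6) = \<zero>\<^bsub>F\<^esub>"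
        using kerD[OF f h _ g] eq unfolding Let_def d_def by blast
    qed
    then show ?thesis by (simp only: A_def units_of_DirProd GL_def)
  qed
qed

lemma unit_group_char_2:
  fixes F :: "('k, 'm) ring_scheme"
  assumes "field F" and fin: "finite (carrier F)" and card: "card (carrier F) = 2 ^ n"
  defines "U \<equiv> units_of (group_algebra F QD16)" and "V \<equiv> one_plus_jacobson (group_algebra F QD16)"
  defines "VG \<equiv> U\<lparr>carrier := V\<rparr>"
  shows "V \<lhd> U" "U Mod V \<cong> integer_mod_group (2 ^ n - 1)" "p_group 2 VG" "order VG = 2 ^ (15 * n)"
    "group_exponent VG = 8" "nilpotent_of_class VG 4" "centrally_metabelian VG"
proof -
  interpret F: field F by fact
  have two: "\<one>\<^bsub>F\<^esub> \<oplus>\<^bsub>F\<^esub> \<one>\<^bsub>F\<^esub> = \<zero>\<^bsub>F\<^esub>"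
    using F.prime_eq_zero[OF fin card] by (simp add: F.of_int_2)
  let ?A = "group_algebra F QD16"
  obtain \<iota> \<epsilon> t x where Q: "qd_char2 ?A F \<iota> \<epsilon> t x"
    using qd_char2_QD16[OF assms(1) two] by blast
  note V = qd_char2.one_plus_jacobson_eq[OF Q]
  show "V \<lhd> U" unfolding V_def U_def V by (rule qd_char2.V_normal[OF Q])
  have "U Mod V \<cong> units_of F" unfolding V_def U_def V by (rule qd_char2.U_Mod_V[OF Q])
  moreover have "units_of F \<cong> integer_mod_group (2 ^ n - 1)"
    using F.units_cyclic[OF fin] by (simp add: card)
  ultimately show "U Mod V \<cong> integer_mod_group (2 ^ n - 1)" by (rule iso_trans)
  show "p_group 2 VG" unfolding VG_def V_def U_def V by (rule qd_char2.p_group_VG[OF Q])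
  show "group_exponent VG = 8" unfolding VG_def V_def U_def V by (rule qd_char2.exponent_VG[OF Q])
  show "nilpotent_of_class VG 4" unfolding VG_def V_def U_def V by (rule qd_char2.nilpotent_VG[OF Q])
  show "centrally_metabelian VG" unfolding VG_def V_def U_def V by (rule qd_char2.centrally_metabelian_VG[OF Q])
  have "card V * 2 ^ n = (2 ^ n) ^ 16"
    using qd_char2.card_V[OF Q] card_group_algebra_QD16[OF F.ring_axioms] by (simp add: V_def V card)
  also have "\<dots> = (2::nat) ^ (15 * n) * 2 ^ n" by (simp flip: power_mult power_add)
  finally show "order VG = 2 ^ (15 * n)" by (simp add: VG_def Coset.order_def)
qed

lemma mod_8_square: "odd q \<Longrightarrow> (q::nat) ^ 2 mod 8 = 1"
proof -
  assume "odd q"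
  then have "q mod 8 = 1 \<or> q mod 8 = 3 \<or> q mod 8 = 5 \<or> q mod 8 = 7" by presburger
  then have "(q mod 8) ^ 2 mod 8 = 1" by auto
  then show ?thesis by (simp add: power_mod)
qed

theorem theorem3p1:
  fixes F :: "('k, 'm) ring_scheme" and p n q :: nat
    and U VG :: "(qd_gen word set \<Rightarrow> 'k) monoid"
    and V :: "(qd_gen word set \<Rightarrow> 'k) set"
  assumes "Factorial_Ring.prime p" and "n \<ge> 1" and "q = p ^ n"
    and "field F" and "finite (carrier F)" and "card (carrier F) = q"
    and "U = units_of (group_algebra F QD16)"
    and "V = one_plus_jacobson (group_algebra F QD16)"
    and "VG = U\<lparr>carrier := V\<rparr>"
  shows
    "(p = 2 \<longrightarrow>
        (V \<lhd> U \<and> U Mod V \<cong> integer_mod_group (q - 1)) \<and>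
        (p_group 2 VG \<and> order VG = 2 ^ (15 * n) \<and> group_exponent VG = 8) \<and>
        nilpotent_of_class VG 4 \<and>
        centrally_metabelian VG) \<and>
     (p > 2 \<longrightarrow>
        ([q = 1] (mod 8) \<or> [q = 3] (mod 8) \<longrightarrow>
           U \<cong> product_group {..<4::nat} (\<lambda>_. integer_mod_group (q - 1))
               \<times>\<times> product_group {..<3::nat} (\<lambda>_. GL 2 F)) \<and>
        ([int q = -1] (mod 8) \<or> [int q = -3] (mod 8) \<longrightarrow>
           (\<forall>L :: 'l ring. field L \<and> finite (carrier L) \<and> card (carrier L) = q ^ 2 \<longrightarrow>
              U \<cong> product_group {..<4::nat} (\<lambda>_. integer_mod_group (q - 1))
                  \<times>\<times> GL 2 F \<times>\<times> GL 2 L)))"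
proof (intro conjI impI allI)
  assume p: "p = 2"
  have card: "card (carrier F) = 2 ^ n" using assms p by simp
  note main = unit_group_char_2[OF assms(4,5) card]
  show "V \<lhd> U" "p_group 2 VG" "order VG = 2 ^ (15 * n)" "group_exponent VG = 8" "nilpotent_of_class VG 4"
    "centrally_metabelian VG"
    unfolding assms(7-9) by (rule main)+
  show "U Mod V \<cong> integer_mod_group (q - 1)"
    using main(2) by (simp add: assms(3,7,8) p)
next
  interpret F: field F by fact
  assume "p > 2"
  then have odd: "odd p" using assms(1) prime_odd_nat by blast
  have card: "card (carrier F) = p ^ n" using assms by simp
  note two = F.two_neq_zero[OF assms(5) card odd]
  {
    assume "[q = 1] (mod 8) \<or> [q = 3] (mod 8)"
    then have "card (carrier F) mod 8 = 1 \<or> card (carrier F) mod 8 = 3"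
      using assms(6) by (auto simp: cong_def)
    from F.sqrt_minus_two_if_1_3_mod_8[OF assms(1) odd assms(5) card this]
    obtain s where "s \<in> carrier F" "s \<otimes>\<^bsub>F\<^esub> s = \<ominus>\<^bsub>F\<^esub> \<guillemotleft>2\<guillemotright>\<^bsub>F\<^esub>" by (rule bexE)
    from units_QD16_split[OF assms(4,5) two this]
    show "U \<cong> product_group {..<4::nat} (\<lambda>_. integer_mod_group (q - 1)) \<times>\<times> product_group {..<3::nat} (\<lambda>_. GL 2 F)"
      by (simp only: assms(6,7))
  }
  fix L :: "'l ring"
  assume q: "[int q = -1] (mod 8) \<or> [int q = -3] (mod 8)"
    and "field L \<and> finite (carrier L) \<and> card (carrier L) = q ^ 2"
  then have L: "field L" "finite (carrier L)" "card (carrier L) = q ^ 2" by simp_all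
  interpret L: field L by fact
  have "int q mod 8 = 7 \<or> int q mod 8 = 5" using q by (auto simp: cong_def)
  then have q57: "card (carrier F) mod 8 = 5 \<or> card (carrier F) mod 8 = 7"
    unfolding assms(6) by presburger
  have cardL: "card (carrier L) = p ^ (n * 2)" by (simp add: L(3) assms(3) power_mult)
  have "odd q" using odd assms(3) by simp
  then have "card (carrier L) mod 8 = 1" by (simp add: L(3) mod_8_square)
  then have "card (carrier L) mod 8 = 1 \<or> card (carrier L) mod 8 = 3" ..
  from L.sqrt_minus_two_if_1_3_mod_8[OF assms(1) odd L(2) cardL this]
  obtain t where t: "t \<in> carrier L" "t \<otimes>\<^bsub>L\<^esub> t = \<ominus>\<^bsub>L\<^esub> \<guillemotleft>2\<guillemotright>\<^bsub>L\<^esub>" by (rule bexE)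
  obtain g where g: "g \<in> carrier F" "g \<noteq> \<zero>\<^bsub>F\<^esub>" "Units F = {g [^]\<^bsub>F\<^esub> i | i::nat. True}"
    using F.finite_units_generator[OF assms(5)] .
  have "\<exists>\<phi>. \<phi> \<in> ring_hom F L"
  proof (rule finite_field_embedding[OF assms(4,5) L(1,2) assms(1)])
    show "\<guillemotleft>int p\<guillemotright>\<^bsub>F\<^esub> = \<zero>\<^bsub>F\<^esub>" by (rule F.prime_eq_zero[OF assms(5) card])
    show "\<guillemotleft>int p\<guillemotright>\<^bsub>L\<^esub> = \<zero>\<^bsub>L\<^esub>" by (rule L.prime_eq_zero[OF L(2) cardL])
    show "g \<in> carrier F" by fact
    show "\<exists>i::nat. y = g [^]\<^bsub>F\<^esub> i" if "y \<in> carrier F" "y \<noteq> \<zero>\<^bsub>F\<^esub>" for y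
      using g(3) that F.field_Units by auto
    have gq: "g [^]\<^bsub>F\<^esub> q = g" using F.pow_card[OF assms(5) g(1)] assms(6) by simp
    then have "(g [^]\<^bsub>F\<^esub> q) [^]\<^bsub>F\<^esub> q = g" by simp
    then show "g [^]\<^bsub>F\<^esub> card (carrier L) = g"
      using g(1) by (simp add: L(3) F.nat_pow_pow power2_eq_square)
    show "b [^]\<^bsub>L\<^esub> card (carrier L) = b" if "b \<in> carrier L" for b
      by (rule L.pow_card[OF L(2) that])
  qed
  then obtain \<phi> where \<phi>: "\<phi> \<in> ring_hom F L" by blast
  have "units_of (group_algebra F QD16) \<cong>
      product_group {..<4::nat} (\<lambda>_. integer_mod_group (card (carrier F) - 1)) \<times>\<times> GL 2 F \<times>\<times> GL 2 L"
    by (rule units_QD16_nonsplit[OF assms(4,5) two F.no_sqrt_minus_two_if_5_7_mod_8[OF assms(1) odd assms(5) card q57]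
          L(1,2) _ \<phi> t])
       (simp_all add: L(3) assms(6))
  then show "U \<cong> product_group {..<4::nat} (\<lambda>_. integer_mod_group (q - 1)) \<times>\<times> GL 2 F \<times>\<times> GL 2 L"
    by (simp only: assms(6,7))
qed

end
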